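(* Let $q$, $r$ be positive integers and $k \geq 3$ an integer, and let $R \subseteq [q]^r$ be a relation of arity $r$ over $[q]$ from which an OR relation of arity $k$ is definable. Then, for any real $\varepsilon > 0$, the $R$-Constrained List Coloring problem parameterized by the number of vertices $n$ does not admit a compression of size $O(n^{k-\varepsilon})$ unless $\mathsf{NP} \subseteq \mathsf{coNP}/\mathsf{poly}$.
   Context: An OR relation of arity $k$ is definable from $R\subseteq[q]^r$ if there exist sets $D_1,\dots,D_r\subseteq[q]$, exactly $k$ of size $2$ and the others of size $1$, such that $|(D_1\times\cdots\times D_r)\cap R|=2^k-1$. The $R$-Constrained List Coloring problem: input is a graph $G=(V,E)$, a function $L:V\to\mathcal{P}([q])$ and a collection $\mathcal{F}\subseteq V^r$; decide whether there is a proper coloring $c:V\to[q]$ of $G$ with $c(v)\in L(v)$ for all $v$ and $(c(x_1),\dots,c(x_r))\in R$ for every $(x_1,\dots,x_r)\in\mathcal{F}$. The parameter is $n=|V|$. A parameterized problem is a set $Q\subseteq\Sigma^*\times\mathbb{N}$. A compression of $Q$ into $Q'$ is a polynomial-time algorithm mapping $(x,k)$ to $(x',k')$ with $(x,k)\in Q\iff(x',k')\in Q'$ and $|x'|+k'\le h(k)$ for a computable $h$ (the size); $Q$ admits a compression of size $h$ if one exists into some parameterized problem. *)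

theory Defs
  imports Complex_Main "HOL-Library.Landau_Symbols" "HOL-Computational_Algebra.Polynomial"
begin

section \<open>Deterministic multi-tape Turing machines\<close>

datatype dir = Go_left | Go_stay | Go_right

text \<open>
  Finite control and finite tape alphabet are represented by initial segments of the naturals;
  the start state is 0. The transition function is partial: the machine halts when it is
  undefined. Symbol 0 is the blank, 1 and 2 are the bits of input and output strings.
\<close>

record tm =
  ntapes :: nat
  nstates :: nat
  nsyms :: nat
  delta :: "nat \<Rightarrow> nat list \<Rightarrow> (nat \<times> (nat \<times> dir) list) option"

definition wf_tm :: "tm \<Rightarrow> bool" where
  "wf_tm M \<longleftrightarrow> ntapes M \<ge> 1 \<and> nstates M \<ge> 1 \<and> nsyms M \<ge> 3 \<and>
     (\<forall>s as s' acts. s < nstates M \<longrightarrow> length as = ntapes M \<longrightarrow> set as \<subseteq> {..<nsyms M} \<longrightarrow>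
        delta M s as = Some (s', acts) \<longrightarrow>
        s' < nstates M \<and> length acts = ntapes M \<and> fst ` set acts \<subseteq> {..<nsyms M})"

text \<open>A tape is two-way infinite, given by its content and the position of the head.\<close>

type_synonym tape = "(int \<Rightarrow> nat) \<times> int"
type_synonym config = "nat \<times> tape list"

fun read_tape :: "tape \<Rightarrow> nat" where
  "read_tape (f, p) = f p"

fun shift :: "dir \<Rightarrow> int \<Rightarrow> int" where
  "shift Go_left p = p - 1"
| "shift Go_stay p = p"
| "shift Go_right p = p + 1"

fun act_tape :: "nat \<times> dir \<Rightarrow> tape \<Rightarrow> tape" where
  "act_tape (a, d) (f, p) = (f(p := a), shift d p)"

definition next_action :: "tm \<Rightarrow> config \<Rightarrow> (nat \<times> (nat \<times> dir) list) option" where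
  "next_action M c = delta M (fst c) (map read_tape (snd c))"

definition halted :: "tm \<Rightarrow> config \<Rightarrow> bool" where
  "halted M c \<longleftrightarrow> next_action M c = None"

definition step :: "tm \<Rightarrow> config \<Rightarrow> config" where
  "step M c = (case next_action M c of
       None \<Rightarrow> c
     | Some (s, acts) \<Rightarrow> (s, map2 act_tape acts (snd c)))"

definition bit_sym :: "bool \<Rightarrow> nat" where
  "bit_sym b = (if b then 2 else 1)"

definition blank_tape :: tape where
  "blank_tape = ((\<lambda>_. 0), 0)"

definition input_tape :: "bool list \<Rightarrow> tape" where
  "input_tape x =
     ((\<lambda>i. if 0 \<le> i \<and> i < int (length x) then bit_sym (x ! nat i) else 0), 0)"

definition init_config :: "tm \<Rightarrow> bool list \<Rightarrow> config" where
  "init_config M x = (0, input_tape x # replicate (ntapes M - 1) blank_tape)"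

text \<open>
  The output is read off the first tape, from cell 0 up to the first blank.
\<close>

definition has_output :: "config \<Rightarrow> bool list \<Rightarrow> bool" where
  "has_output c y \<longleftrightarrow>
     (\<forall>i < length y. fst (hd (snd c)) (int i) = bit_sym (y ! i)) \<and>
     fst (hd (snd c)) (int (length y)) = 0"

definition tm_outputs_within :: "tm \<Rightarrow> bool list \<Rightarrow> nat \<Rightarrow> bool list \<Rightarrow> bool" where
  "tm_outputs_within M x T y \<longleftrightarrow>
     (\<exists>t \<le> T. halted M ((step M ^^ t) (init_config M x)) \<and>
               has_output ((step M ^^ t) (init_config M x)) y)"

text \<open>Computability of functions between types equipped with binary string encodings.\<close>

definition computable ::
  "('a \<Rightarrow> bool list) \<Rightarrow> ('b \<Rightarrow> bool list) \<Rightarrow> ('a \<Rightarrow> 'b) \<Rightarrow> bool" where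
  "computable enc_in enc_out f \<longleftrightarrow>
     (\<exists>M. wf_tm M \<and> (\<forall>a. \<exists>T. tm_outputs_within M (enc_in a) T (enc_out (f a))))"

definition polytime_computable ::
  "('a \<Rightarrow> bool list) \<Rightarrow> ('b \<Rightarrow> bool list) \<Rightarrow> ('a \<Rightarrow> 'b) \<Rightarrow> bool" where
  "polytime_computable enc_in enc_out f \<longleftrightarrow>
     (\<exists>M (p :: nat poly). wf_tm M \<and>
        (\<forall>a. tm_outputs_within M (enc_in a) (poly p (length (enc_in a))) (enc_out (f a))))"

section \<open>Complexity classes\<close>

type_synonym language = "bool list set"

definition str_pair :: "bool list \<Rightarrow> bool list \<Rightarrow> bool list" where
  "str_pair x y = concat (map (\<lambda>b. [True, b]) x) @ False # y"

definition PTIME :: "language set" where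
  "PTIME = {A. polytime_computable (\<lambda>x. x) (\<lambda>b. [b]) (\<lambda>x. x \<in> A)}"

definition NP :: "language set" where
  "NP = {A. \<exists>B \<in> PTIME. \<exists>p :: nat poly.
          \<forall>x. x \<in> A \<longleftrightarrow> (\<exists>w. length w \<le> poly p (length x) \<and> str_pair x w \<in> B)}"

definition coNP :: "language set" where
  "coNP = {A. - A \<in> NP}"

definition with_poly_advice :: "language set \<Rightarrow> language set" where
  "with_poly_advice C = {A. \<exists>B \<in> C. \<exists>(p :: nat poly) (adv :: nat \<Rightarrow> bool list).
     (\<forall>n. length (adv n) \<le> poly p n) \<and>
     (\<forall>x. x \<in> A \<longleftrightarrow> str_pair x (adv (length x)) \<in> B)}"

section \<open>Parameterized problems and compression\<close>

type_synonym param_problem = "(bool list \<times> nat) set"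

definition unary :: "nat \<Rightarrow> bool list" where
  "unary n = replicate n True"

text \<open>
  The parameter is written in unary, so the length of the encoded pair is one more than the sum
  of the string length and the parameter.
\<close>

fun enc_param :: "bool list \<times> nat \<Rightarrow> bool list" where
  "enc_param (x, k) = unary k @ False # x"

definition compression_of_size ::
  "param_problem \<Rightarrow> param_problem \<Rightarrow> (bool list \<times> nat \<Rightarrow> bool list \<times> nat) \<Rightarrow> (nat \<Rightarrow> nat) \<Rightarrow> bool"
where
  "compression_of_size Q Q' f h \<longleftrightarrow>
     polytime_computable enc_param enc_param f \<and>
     computable unary unary h \<and>
     (\<forall>x k. ((x, k) \<in> Q \<longleftrightarrow> f (x, k) \<in> Q') \<and>
            length (fst (f (x, k))) + snd (f (x, k)) \<le> h k)"

definition admits_compression :: "param_problem \<Rightarrow> (nat \<Rightarrow> nat) \<Rightarrow> bool" where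
  "admits_compression Q h \<longleftrightarrow> (\<exists>Q' f. compression_of_size Q Q' f h)"

section \<open>Relations and constrained list coloring\<close>

definition tuples :: "'a set \<Rightarrow> nat \<Rightarrow> 'a list set" where
  "tuples A r = {t. length t = r \<and> set t \<subseteq> A}"

text \<open>The list Ds collects the sets $D_1, \dots, D_r$; their product is listset Ds.\<close>

definition OR_definable :: "nat \<Rightarrow> nat \<Rightarrow> nat list set \<Rightarrow> nat \<Rightarrow> bool" where
  "OR_definable q r R k \<longleftrightarrow>
     (\<exists>Ds. length Ds = r \<and> (\<forall>D \<in> set Ds. D \<subseteq> {1..q}) \<and>
        card {i. i < r \<and> card (Ds ! i) = 2} = k \<and>
        (\<forall>i < r. card (Ds ! i) \<noteq> 2 \<longrightarrow> card (Ds ! i) = 1) \<and>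
        card (listset Ds \<inter> R) = 2 ^ k - 1)"

definition simple_graph :: "'v set \<Rightarrow> 'v set set \<Rightarrow> bool" where
  "simple_graph V E \<longleftrightarrow> finite V \<and> (\<forall>e \<in> E. e \<subseteq> V \<and> card e = 2)"

definition proper_coloring :: "'v set \<Rightarrow> 'v set set \<Rightarrow> nat \<Rightarrow> ('v \<Rightarrow> nat) \<Rightarrow> bool" where
  "proper_coloring V E q c \<longleftrightarrow>
     (\<forall>v \<in> V. c v \<in> {1..q}) \<and> (\<forall>u v. {u, v} \<in> E \<longrightarrow> c u \<noteq> c v)"

definition RCLC_instance ::
  "nat \<Rightarrow> nat \<Rightarrow> 'v set \<Rightarrow> 'v set set \<Rightarrow> ('v \<Rightarrow> nat set) \<Rightarrow> 'v list set \<Rightarrow> bool" where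
  "RCLC_instance q r V E L F \<longleftrightarrow>
     simple_graph V E \<and> (\<forall>v \<in> V. L v \<subseteq> {1..q}) \<and> F \<subseteq> tuples V r"

definition RCLC_solvable ::
  "nat \<Rightarrow> nat list set \<Rightarrow> 'v set \<Rightarrow> 'v set set \<Rightarrow> ('v \<Rightarrow> nat set) \<Rightarrow> 'v list set \<Rightarrow> bool" where
  "RCLC_solvable q R V E L F \<longleftrightarrow>
     (\<exists>c. proper_coloring V E q c \<and> (\<forall>v \<in> V. c v \<in> L v) \<and> (\<forall>xs \<in> F. map c xs \<in> R))"

text \<open>
  An instance on the vertex set {0, ..., n-1} is encoded by the adjacency matrix of the graph
  (n^2 bits), the incidence matrix of the color lists (n q bits) and the characteristic vector
  of the constraint set among all r-tuples of vertices in lexicographic order (n^r bits). As q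
  and r are constants, this has length polynomial in n; n itself is given by the parameter.
\<close>

definition enc_RCLC ::
  "nat \<Rightarrow> nat \<Rightarrow> nat \<Rightarrow> nat set set \<Rightarrow> (nat \<Rightarrow> nat set) \<Rightarrow> nat list set \<Rightarrow> bool list" where
  "enc_RCLC q r n E L F =
     map (\<lambda>(u, v). {u, v} \<in> E) (List.product [0..<n] [0..<n]) @
     map (\<lambda>(v, a). a \<in> L v) (List.product [0..<n] [1..<q + 1]) @
     map (\<lambda>xs. xs \<in> F) (product_lists (replicate r [0..<n]))"

definition RCLC :: "nat \<Rightarrow> nat \<Rightarrow> nat list set \<Rightarrow> param_problem" where
  "RCLC q r R = {(enc_RCLC q r n E L F, n) | n E L F.
     RCLC_instance q r {0..<n} E L F \<and> RCLC_solvable q R {0..<n} E L F}"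

end

theory Submission
  imports Defs "HOL-Library.FuncSet"
begin

text \<open>
  Let \<open>A\<close> be in NP. For all \<open>m\<close> and \<open>p\<close> there is a width-\<open>k\<close> CNF on \<open>poly(m) * p\<close> variables that
  expresses the disjunction of the \<open>p ^ k\<close> statements "the string with index \<open>f\<close> in \<open>[p] ^ k\<close> is in \<open>A\<close>"
  about strings of length \<open>m\<close>: select the \<open>k\<close> coordinates of an index \<open>f\<close> and guess a string \<open>y\<close> together
  with an accepting tableau of the verifier of \<open>A\<close>, and forbid that \<open>y\<close> differs from the string with index
  \<open>f\<close> by clauses of width \<open>k\<close>, where the variable for the first coordinate also carries a bit of \<open>y\<close>. An OR
  relation of arity \<open>k\<close> turns the CNF into a list coloring instance with \<open>n = O(poly(m) * p)\<close> vertices.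

  If \<open>p\<close> is a large power of \<open>m\<close>, a compression of size \<open>O(n ^ (k - \<epsilon>))\<close> produces fewer than \<open>p ^ k\<close> bits.
  By pigeonhole, some compressed no-instance \<open>y\<close> and some index \<open>f\<close> have the property that at least half of
  the strings outside \<open>A\<close> occur at index \<open>f\<close> in a family of strings outside \<open>A\<close> that is mapped to \<open>y\<close>
  (Dell and van Melkebeek). Iterating, \<open>m + 1\<close> pairs \<open>(y, f)\<close> cover all strings outside \<open>A\<close>, and these pairs
  serve as advice: a family with \<open>x\<close> at index \<open>f\<close> and image \<open>y\<close> witnesses that \<open>x\<close> is not in \<open>A\<close>.
  The advice also describes the instance, so that no reduction has to be computed uniformly.
\<close>

section \<open>Turing machines with an arbitrary finite state set\<close>

text \<open>Soundness of the advice rests on a collision: \<open>y\<close> is the image of a family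
  outside \<open>A\<close>, so it is a no-instance of the target problem, every OR instance mapped
  to \<open>y\<close> is unsolvable, and the string at index \<open>f\<close> of such an instance is
  outside \<open>A\<close>. The rest of the guessed instance may be arbitrary, so the verifier
  leaves it as free bits and never checks that it describes strings.

  Two counts shape the construction. A bit clause has only \<open>k\<close> literals and needs all
  of them to name one of \<open>p ^ k\<close> indices; coupling the bits of \<open>y\<close> to the
  first coordinate costs a factor polynomial in \<open>m\<close> in the number of variables, but no
  width. All other clauses are split to width 3, which is where \<open>k \<ge> 3\<close> enters.
  With \<open>n \<le> poly(m) * p\<close>, a size of order \<open>n ^ (k - \<epsilon>)\<close> drops
  below \<open>p ^ k\<close> once \<open>p ^ \<epsilon>\<close> beats a fixed power of
  \<open>poly(m)\<close>.

  Only the compression has to run in polynomial time. It is given by an unknown machine, so a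
  concrete machine that interprets the advice is built around it; everything that depends on
  \<open>A\<close> enters through the advice.\<close>

definition tstep ::
  "('q \<Rightarrow> nat list \<Rightarrow> ('q \<times> (nat \<times> dir) list) option) \<Rightarrow> 'q \<times> tape list \<Rightarrow> 'q \<times> tape list" where
  "tstep d c = (case d (fst c) (map read_tape (snd c)) of
       None \<Rightarrow> c
     | Some (s, acts) \<Rightarrow> (s, map2 act_tape acts (snd c)))"

lemma step_eq_tstep: "step M = tstep (delta M)"
  by (rule ext) (simp add: step_def tstep_def next_action_def)

definition cfg_ok :: "'q set \<Rightarrow> nat \<Rightarrow> nat \<Rightarrow> 'q \<times> tape list \<Rightarrow> bool" where
  "cfg_ok Q K n c \<longleftrightarrow> fst c \<in> Q \<and> length (snd c) = K \<and> (\<forall>tp\<in>set (snd c). \<forall>i. fst tp i < n)"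

definition closed_delta ::
  "('q \<Rightarrow> nat list \<Rightarrow> ('q \<times> (nat \<times> dir) list) option) \<Rightarrow> 'q set \<Rightarrow> nat \<Rightarrow> nat \<Rightarrow> bool" where
  "closed_delta d Q K n \<longleftrightarrow> (\<forall>q as q' acts. q \<in> Q \<longrightarrow> length as = K \<longrightarrow> set as \<subseteq> {..<n} \<longrightarrow>
     d q as = Some (q', acts) \<longrightarrow> q' \<in> Q \<and> length acts = K \<and> fst ` set acts \<subseteq> {..<n})"

abbreviation blank_tapes :: "tm \<Rightarrow> tape list" where
  "blank_tapes M \<equiv> replicate (ntapes M - 1) blank_tape"

abbreviation tm_cfg :: "tm \<Rightarrow> config \<Rightarrow> bool" where
  "tm_cfg M \<equiv> cfg_ok {..<nstates M} (ntapes M) (nsyms M)"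

lemma cfg_ok_read:
  assumes "cfg_ok Q K n c"
  shows "length (map read_tape (snd c)) = K" "set (map read_tape (snd c)) \<subseteq> {..<n}"
proof -
  have "read_tape tp = fst tp (snd tp)" for tp by (cases tp) simp
  then show "length (map read_tape (snd c)) = K" "set (map read_tape (snd c)) \<subseteq> {..<n}"
    using assms by (auto simp: cfg_ok_def)
qed

lemma cfg_ok_tstep:
  assumes "closed_delta d Q K n" "cfg_ok Q K n c"
  shows "cfg_ok Q K n (tstep d c)"
proof (cases "d (fst c) (map read_tape (snd c))")
  case None
  then show ?thesis using assms by (simp add: tstep_def)
next
  case (Some a)
  obtain q acts where a: "a = (q, acts)" by (cases a)
  have h: "q \<in> Q \<and> length acts = K \<and> fst ` set acts \<subseteq> {..<n}"
    using assms(1) cfg_ok_read[OF assms(2)] assms(2) Some a unfolding closed_delta_def cfg_ok_def by blast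
  have l: "length (snd c) = K" using assms(2) by (simp add: cfg_ok_def)
  have "fst (act_tape x y) i < n" if "(x, y) \<in> set (zip acts (snd c))" for x y i
  proof -
    have 1: "x \<in> set acts" "y \<in> set (snd c)" using that by (auto dest: set_zip_leftD set_zip_rightD)
    then have "fst x < n" "fst y i < n" using h assms(2) by (auto simp: cfg_ok_def)
    then show ?thesis by (cases x, cases y) simp
  qed
  then show ?thesis using Some a h l by (auto simp: tstep_def cfg_ok_def)
qed

lemma cfg_ok_tsteps:
  assumes "closed_delta d Q K n" "cfg_ok Q K n c"
  shows "cfg_ok Q K n ((tstep d ^^ t) c)"
  by (induction t) (auto simp: assms cfg_ok_tstep[OF assms(1)])

lemma cfg_ok_init:
  assumes "q \<in> Q" "K \<ge> 1" "n \<ge> 3"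
  shows "cfg_ok Q K n (q, input_tape x # replicate (K - 1) blank_tape)"
  using assms by (auto simp: cfg_ok_def input_tape_def blank_tape_def bit_sym_def)

lemma wf_tm_closed: "wf_tm M \<Longrightarrow> closed_delta (delta M) {..<nstates M} (ntapes M) (nsyms M)"
  by (simp add: wf_tm_def closed_delta_def)

text \<open>\<open>has_output\<close> inspects only the tapes, so the state 0 in it is a dummy. The
  bound counts the remaining steps, which lets runs be composed backwards: the halting phase is
  treated first and each earlier phase adds its own steps.\<close>

definition halts_with ::
  "('q \<Rightarrow> nat list \<Rightarrow> ('q \<times> (nat \<times> dir) list) option) \<Rightarrow> nat \<Rightarrow> bool list \<Rightarrow> 'q \<times> tape list \<Rightarrow> bool" where
  "halts_with d T y c \<longleftrightarrow> (\<exists>t\<le>T. d (fst ((tstep d ^^ t) c)) (map read_tape (snd ((tstep d ^^ t) c))) = None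
      \<and> has_output (0, snd ((tstep d ^^ t) c)) y)"

lemma halts_with_mono: "halts_with d T y c \<Longrightarrow> T \<le> T' \<Longrightarrow> halts_with d T' y c"
  by (auto simp: halts_with_def intro: order_trans)

lemma halts_with_tsteps:
  assumes "(tstep d ^^ n) c = c'" "halts_with d T y c'" "T + n \<le> T'"
  shows "halts_with d T' y c"
proof -
  obtain t where t: "t \<le> T" "d (fst ((tstep d ^^ t) c')) (map read_tape (snd ((tstep d ^^ t) c'))) = None
      \<and> has_output (0, snd ((tstep d ^^ t) c')) y" using assms(2) by (auto simp: halts_with_def)
  have "(tstep d ^^ t) c' = (tstep d ^^ (t + n)) c" using assms(1) by (simp add: funpow_add)
  then show ?thesis unfolding halts_with_def using t assms(3) by (intro exI[of _ "t + n"]) auto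
qed

lemma halts_with_tstep:
  "tstep d c = c' \<Longrightarrow> halts_with d T y c' \<Longrightarrow> T < T' \<Longrightarrow> halts_with d T' y c"
  by (rule halts_with_tsteps[where n = 1]) auto

text \<open>The states are numbered by a list with \<open>q0\<close> in front, because the start
  state of a \<open>tm\<close> is 0. The numbering is inverted only on \<open>Q\<close>;
  \<open>cfg_ok\<close> keeps the run there, and it has to bound the symbols because
  \<open>closed_delta\<close> speaks only of those below \<open>n\<close>.\<close>

lemma typed_tm_realizable:
  fixes d :: "'q \<Rightarrow> nat list \<Rightarrow> ('q \<times> (nat \<times> dir) list) option"
  assumes "finite Q" "q0 \<in> Q" "closed_delta d Q K n" "K \<ge> 1" "n \<ge> 3"
  shows "\<exists>M. wf_tm M \<and> (\<forall>x T y. halts_with d T y (q0, input_tape x # replicate (K - 1) blank_tape)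
      \<longrightarrow> tm_outputs_within M x T y)"
proof -
  obtain qs where qs: "distinct qs" "set qs = Q - {q0}"
    using assms(1) finite_distinct_list[of "Q - {q0}"] by auto
  define L where "L = q0 # qs"
  have L: "distinct L" "set L = Q" "L ! 0 = q0" using qs assms(2) by (auto simp: L_def)
  define enc where "enc q = (THE i. i < length L \<and> L ! i = q)" for q
  have enc: "enc q < length L \<and> L ! enc q = q" if "q \<in> Q" for q
    unfolding enc_def by (rule theI'[OF distinct_Ex1[OF L(1)]]) (use that L(2) in simp)
  have enc0: "enc q0 = 0" using enc[OF assms(2)] nth_eq_iff_index_eq[OF L(1), of "enc q0" 0] L(3) by (simp add: L_def)
  define M where "M = \<lparr>ntapes = K, nstates = length L, nsyms = n,
     delta = (\<lambda>s as. map_option (\<lambda>(q, acts). (enc q, acts)) (d (L ! s) as))\<rparr>"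
  have wf: "wf_tm M"
    unfolding wf_tm_def
  proof (intro conjI allI impI)
    fix s as s' acts
    assume a: "s < nstates M" "length as = ntapes M" "set as \<subseteq> {..<nsyms M}" "delta M s as = Some (s', acts)"
    then obtain q where q: "d (L ! s) as = Some (q, acts)" "s' = enc q" by (auto simp: M_def)
    have "L ! s \<in> Q" using a(1) L(2) nth_mem by (fastforce simp: M_def)
    then have "q \<in> Q \<and> length acts = K \<and> fst ` set acts \<subseteq> {..<n}"
      using assms(3) a q unfolding closed_delta_def M_def by (metis tm.select_convs(1,3))
    then show "s' < nstates M" "length acts = ntapes M" "fst ` set acts \<subseteq> {..<nsyms M}"
      using enc q by (auto simp: M_def)
  qed (use assms in \<open>auto simp: M_def L_def\<close>)
  define E where "E c = (enc (fst c), snd c)" for c :: "'q \<times> tape list"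
  have sim1: "step M (E c) = E (tstep d c)" if "cfg_ok Q K n c" for c
  proof -
    have "L ! enc (fst c) = fst c" using enc that by (simp add: cfg_ok_def)
    then show ?thesis by (simp add: step_eq_tstep tstep_def E_def M_def split: option.splits prod.splits)
  qed
  have sim: "(step M ^^ t) (E c) = E ((tstep d ^^ t) c)" if "cfg_ok Q K n c" for c t
    by (induction t) (auto simp: sim1 cfg_ok_tsteps[OF assms(3) that])
  have "tm_outputs_within M x T y"
    if h: "halts_with d T y (q0, input_tape x # replicate (K - 1) blank_tape)" for x T y
  proof -
    let ?c = "(q0, input_tape x # replicate (K - 1) blank_tape)"
    have ok: "cfg_ok Q K n ?c" by (rule cfg_ok_init[OF assms(2,4,5)])
    have i: "init_config M x = E ?c" by (simp add: init_config_def E_def M_def enc0)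
    obtain t where t: "t \<le> T" "d (fst ((tstep d ^^ t) ?c)) (map read_tape (snd ((tstep d ^^ t) ?c))) = None"
      "has_output (0, snd ((tstep d ^^ t) ?c)) y" using h by (auto simp: halts_with_def)
    have "fst ((tstep d ^^ t) ?c) \<in> Q" using cfg_ok_tsteps[OF assms(3) ok] by (auto simp: cfg_ok_def)
    then have "L ! enc (fst ((tstep d ^^ t) ?c)) = fst ((tstep d ^^ t) ?c)" using enc by blast
    then have "halted M (E ((tstep d ^^ t) ?c))" using t(2)
      by (simp add: halted_def next_action_def E_def M_def)
    moreover have "has_output (E ((tstep d ^^ t) ?c)) y" using t(3) by (simp add: has_output_def E_def)
    ultimately show ?thesis unfolding tm_outputs_within_def i sim[OF ok] using t(1) by blast
  qed
  with wf show ?thesis by blast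
qed

section \<open>Tapes given by a list and a head position\<close>

definition tp :: "nat list \<Rightarrow> int \<Rightarrow> tape" where
  "tp xs p = ((\<lambda>i. if 0 \<le> i \<and> i < int (length xs) then xs ! nat i else 0), p)"

lemma input_tape_tp: "input_tape x = tp (map bit_sym x) 0"
  by (auto simp: input_tape_def tp_def fun_eq_iff)

lemma blank_tape_tp: "blank_tape = tp [] 0"
  by (auto simp: blank_tape_def tp_def fun_eq_iff)

lemma read_tp: "read_tape (tp xs p) = (if 0 \<le> p \<and> p < int (length xs) then xs ! nat p else 0)"
  by (simp add: tp_def)

lemma act_stay: "act_tape (read_tape t, Go_stay) t = t"
  by (cases t) simp

lemma act_move: "act_tape (read_tape (tp xs p), d) (tp xs p) = tp xs (shift d p)"
  by (auto simp: tp_def)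

lemma act_stays: "map2 act_tape (map (\<lambda>a. (a, Go_stay)) (map read_tape us)) us = us"
  by (induction us) (auto simp: act_stay)

lemma act_stays': "map2 act_tape (map ((\<lambda>a. (a, Go_stay)) \<circ> read_tape) us) us = us"
  using act_stays by (simp add: comp_def)

text \<open>Together with \<open>act_pop\<close>: at its end a tape behaves like a stack. Popping
  writes the blank 0, so the result equals, as a function, the tape of the shorter list.\<close>

lemma act_append: "p = int (length xs) \<Longrightarrow> act_tape (a, Go_right) (tp xs p) = tp (xs @ [a]) (p + 1)"
  by (auto simp: tp_def fun_eq_iff nth_append nat_eq_iff)

lemma act_pop: "p = int (length xs) \<Longrightarrow> act_tape (0, Go_left) (tp (xs @ [a]) p) = tp xs (p - 1)"
  by (auto simp: tp_def fun_eq_iff nth_append nat_less_iff)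

section \<open>The advice-driven verifier machine\<close>

text \<open>
  On input \<open>str_pair (str_pair x a) w\<close> the machine copies \<open>x\<close> to its second tape and the program encoded in
  the advice \<open>a\<close> to its third tape (states \<open>PA\<close>, \<open>PB\<close>), executes the program backwards from its last
  instruction, which writes a string to the first tape of \<open>M\<close> (\<open>IN\<close>, \<open>SK\<close>), runs \<open>M\<close> on that string
  (\<open>RW\<close>, \<open>RN\<close>, \<open>BK\<close>) and compares the output with a string in the program (\<open>CM\<close>); \<open>FN\<close> writes the answer.
  The fourth tape moves in step with the first tape of \<open>M\<close> and has a mark in cell 0; together with the
  flag of \<open>RN\<close>, which records the side on which cell 0 was left, it allows to find cell 0 again.

  Instructions: 1, 2 move left or right on \<open>x\<close>; 3, 4 output the current bit of \<open>x\<close> or its negation;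
  5, 6 output 0 or 1; 7 outputs the next bit of \<open>w\<close>; 8 continues if the next bit of \<open>w\<close> is 1 and
  otherwise skips to the next 8; 9 runs \<open>M\<close>, the comparison string following as a sequence of 5 and 6.
\<close>

datatype vstate = PA nat | PB bool nat | IN | SK | RW bool | RN bool nat | BK bool | CM | FN nat bool

abbreviation stays :: "nat list \<Rightarrow> (nat \<times> dir) list" where
  "stays as \<equiv> map (\<lambda>a. (a, Go_stay)) as"

text \<open>\<open>str_pair\<close> is applied twice, so a bit \<open>b\<close> of \<open>x\<close>
  arrives as the four bits True, True, True, \<open>b\<close>; \<open>PA i\<close> is the offset in
  this group, and a False at offset 1 belongs to the doubled separator. A bit of the advice takes
  two bits: \<open>PB False c\<close> reads the leading one and \<open>PB True c\<close> the bit
  itself, after \<open>c\<close> ones of the current code. \<open>RN\<close> guards the symbols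
  because \<open>wf_tm\<close> constrains \<open>delta M\<close> only on the alphabet of
  \<open>M\<close>.\<close>

fun vact :: "tm \<Rightarrow> vstate \<Rightarrow> nat \<Rightarrow> nat \<Rightarrow> nat \<Rightarrow> nat \<Rightarrow> nat \<Rightarrow> nat list \<Rightarrow> (vstate \<times> (nat \<times> dir) list) option" where
  "vact M (PA i) a0 a1 a2 a3 b bs =
     (if i = 0 \<and> a0 = 2 then Some (PA 1, (a0, Go_right) # stays (a1 # a2 # a3 # b # bs))
      else if i = 1 \<and> a0 = 2 then Some (PA 2, (a0, Go_right) # stays (a1 # a2 # a3 # b # bs))
      else if i = 1 \<and> a0 = 1 then Some (PB False 0, (a0, Go_right) # stays (a1 # a2 # a3 # b # bs))
      else if i = 2 \<and> a0 = 2 then Some (PA 3, (a0, Go_right) # stays (a1 # a2 # a3 # b # bs))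
      else if i = 3 \<and> a0 \<noteq> 0 then Some (PA 0, (a0, Go_right) # (a0, Go_right) # stays (a2 # a3 # b # bs))
      else Some (FN 0 False, stays (a0 # a1 # a2 # a3 # b # bs)))"
| "vact M (PB False c) a0 a1 a2 a3 b bs =
     (if a0 = 2 then Some (PB True c, (a0, Go_right) # stays (a1 # a2 # a3 # b # bs))
      else if a0 = 1 then Some (IN, (a0, Go_right) # (a1, Go_stay) # (a2, Go_left) # stays (a3 # b # bs))
      else Some (FN 0 False, stays (a0 # a1 # a2 # a3 # b # bs)))"
| "vact M (PB True c) a0 a1 a2 a3 b bs =
     (if a0 = 2 \<and> c < 8 then Some (PB False (c + 1), (a0, Go_right) # stays (a1 # a2 # a3 # b # bs))
      else if a0 = 1 then Some (PB False 0, (a0, Go_right) # (a1, Go_stay) # (c + 1, Go_right) # stays (a3 # b # bs))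
      else Some (FN 0 False, stays (a0 # a1 # a2 # a3 # b # bs)))"
| "vact M IN a0 a1 a2 a3 b bs =
     (if a2 = 1 then Some (IN, (a0, Go_stay) # (a1, Go_left) # (0, Go_left) # stays (a3 # b # bs))
      else if a2 = 2 then Some (IN, (a0, Go_stay) # (a1, Go_right) # (0, Go_left) # stays (a3 # b # bs))
      else if a2 = 3 \<and> a1 \<noteq> 0 then
        Some (IN, (a0, Go_stay) # (a1, Go_stay) # (0, Go_left) # (a3, Go_stay) # (a1, Go_right) # stays bs)
      else if a2 = 4 \<and> a1 \<noteq> 0 then
        Some (IN, (a0, Go_stay) # (a1, Go_stay) # (0, Go_left) # (a3, Go_stay) # (3 - a1, Go_right) # stays bs)
      else if a2 = 5 then
        Some (IN, (a0, Go_stay) # (a1, Go_stay) # (0, Go_left) # (a3, Go_stay) # (1, Go_right) # stays bs)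
      else if a2 = 6 then
        Some (IN, (a0, Go_stay) # (a1, Go_stay) # (0, Go_left) # (a3, Go_stay) # (2, Go_right) # stays bs)
      else if a2 = 7 \<and> a0 \<noteq> 0 then
        Some (IN, (a0, Go_right) # (a1, Go_stay) # (0, Go_left) # (a3, Go_stay) # (a0, Go_right) # stays bs)
      else if a2 = 8 \<and> a0 \<noteq> 0 then
        Some (if a0 = 2 then IN else SK,
          (a0, Go_right) # (a1, Go_stay) # (0, Go_left) # stays (a3 # b # bs))
      else if a2 = 9 then
        Some (RW False, (a0, Go_stay) # (a1, Go_stay) # (0, Go_left) # (a3, Go_stay) # (b, Go_left) # stays bs)
      else Some (FN 0 False, stays (a0 # a1 # a2 # a3 # b # bs)))"
| "vact M SK a0 a1 a2 a3 b bs =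
     (if a2 = 8 then Some (IN, stays (a0 # a1 # a2 # a3 # b # bs))
      else if a2 = 0 then Some (FN 0 False, stays (a0 # a1 # a2 # a3 # b # bs))
      else Some (SK, (a0, Go_stay) # (a1, Go_stay) # (0, Go_left) # stays (a3 # b # bs)))"
| "vact M (RW g) a0 a1 a2 a3 b bs =
     (if b \<noteq> 0 then Some (RW (g \<or> b = 1), stays (a0 # a1 # a2 # a3 # []) @ (b, Go_left) # stays bs)
      else if g then Some (RN False 0, stays (a0 # a1 # a2 # []) @ (1, Go_stay) # (b, Go_right) # stays bs)
      else Some (FN 0 False, stays (a0 # a1 # a2 # a3 # b # bs)))"
| "vact M (RN g s) a0 a1 a2 a3 b bs =
     (if set (b # bs) \<subseteq> {..<nsyms M} then
        (case delta M s (b # bs) of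
           None \<Rightarrow> Some (BK g, stays (a0 # a1 # a2 # a3 # b # bs))
         | Some (s', acts) \<Rightarrow>
            Some (RN (if a3 = 1 then snd (hd acts) = Go_left else g) s',
                  stays (a0 # a1 # a2 # []) @ (a3, snd (hd acts)) # acts))
      else None)"
| "vact M (BK g) a0 a1 a2 a3 b bs =
     (if a3 = 1 then Some (CM, stays (a0 # a1 # a2 # a3 # b # bs))
      else Some (BK g, stays (a0 # a1 # a2 # []) @ (a3, if g then Go_right else Go_left) #
             (b, if g then Go_right else Go_left) # stays bs))"
| "vact M CM a0 a1 a2 a3 b bs =
     (if (a2 = 5 \<and> b = 1) \<or> (a2 = 6 \<and> b = 2) then
        Some (CM, (a0, Go_stay) # (a1, Go_stay) # (0, Go_left) # (a3, Go_stay) # (b, Go_right) # stays bs)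
      else Some (FN 0 (a2 \<noteq> 5 \<and> a2 \<noteq> 6 \<and> b = 0), stays (a0 # a1 # a2 # a3 # b # bs)))"
| "vact M (FN i v) a0 a1 a2 a3 b bs =
     (if i = 0 then Some (FN 1 v, (a0, Go_left) # stays (a1 # a2 # a3 # b # bs))
      else if i = 1 then (if a0 \<noteq> 0 then Some (FN 1 v, (a0, Go_left) # stays (a1 # a2 # a3 # b # bs))
                          else Some (FN 2 v, (a0, Go_right) # stays (a1 # a2 # a3 # b # bs)))
      else if i = 2 then Some (FN 3 v, (bit_sym v, Go_right) # stays (a1 # a2 # a3 # b # bs))
      else if i = 3 then Some (FN 4 v, (0, Go_stay) # stays (a1 # a2 # a3 # b # bs))
      else None)"

definition vdelta :: "tm \<Rightarrow> vstate \<Rightarrow> nat list \<Rightarrow> (vstate \<times> (nat \<times> dir) list) option" where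
  "vdelta M q as = vact M q (as ! 0) (as ! 1) (as ! 2) (as ! 3) (as ! 4) (drop 5 as)"

lemma vdelta_Cons [simp]: "vdelta M q (a0 # a1 # a2 # a3 # b # bs) = vact M q a0 a1 a2 a3 b bs"
  by (simp add: vdelta_def eval_nat_numeral)

definition vstates :: "tm \<Rightarrow> vstate set" where
  "vstates M = PA ` {..3} \<union> (\<lambda>(e, c). PB e c) ` (UNIV \<times> {..8}) \<union> {IN, SK, CM} \<union> range RW \<union> range BK \<union>
     (\<lambda>(g, s). RN g s) ` (UNIV \<times> {..<nstates M}) \<union> (\<lambda>(i, v). FN i v) ` ({..4} \<times> UNIV)"

lemma finite_vstates: "finite (vstates M)"
  by (simp add: vstates_def)

lemma vstates_iff:
  "PA i \<in> vstates M \<longleftrightarrow> i \<le> 3" "PB e c \<in> vstates M \<longleftrightarrow> c \<le> 8"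
  "IN \<in> vstates M" "SK \<in> vstates M" "CM \<in> vstates M" "RW g \<in> vstates M" "BK g \<in> vstates M"
  "RN g s \<in> vstates M \<longleftrightarrow> s < nstates M" "FN j v \<in> vstates M \<longleftrightarrow> j \<le> 4"
  by (auto simp: vstates_def)

text \<open>The bound 10 covers the blank and the nine instruction codes. \<open>RN\<close> is
  treated apart, being the only state whose successor comes from \<open>delta M\<close>.\<close>

lemma closed_vdelta:
  assumes "wf_tm M"
  shows "closed_delta (vdelta M) (vstates M) (4 + ntapes M) (max 10 (nsyms M))"
  unfolding closed_delta_def
proof (intro allI impI)
  fix q as q' acts
  assume q: "q \<in> vstates M" and l: "length as = 4 + ntapes M" and
    s: "set as \<subseteq> {..<max 10 (nsyms M)}" and d: "vdelta M q as = Some (q', acts)"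
  have K: "ntapes M \<ge> 1" using assms by (simp add: wf_tm_def)
  obtain a0 a1 a2 a3 b bs where as: "as = a0 # a1 # a2 # a3 # b # bs" "length bs = ntapes M - 1"
    using l K by (auto simp: numeral_eq_Suc length_Suc_conv Suc_le_eq gr0_conv_Suc)
  have n0: "0 < nstates M" using assms by (simp add: wf_tm_def)
  show "q' \<in> vstates M \<and> length acts = 4 + ntapes M \<and> fst ` set acts \<subseteq> {..<max 10 (nsyms M)}"
  proof (cases "\<exists>g n. q = RN g n")
    case True
    then obtain g n where qn: "q = RN g n" by blast
    have n: "n < nstates M" using q qn by (auto simp: vstates_def)
    have v: "set (b # bs) \<subseteq> {..<nsyms M}" using d unfolding qn as by (auto split: if_splits)
    show ?thesis
    proof (cases "delta M n (b # bs)")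
      case None
      then show ?thesis using d v s K as(2) unfolding qn as(1) by (auto simp: vstates_def)
    next
      case (Some a)
      obtain s' ac where a: "a = (s', ac)" by (cases a)
      have "n \<in> {..<nstates M}" "length (b # bs) = ntapes M" using n as(2) K by auto
      then have h: "s' < nstates M" "length ac = ntapes M" "fst ` set ac \<subseteq> {..<nsyms M}"
        using wf_tm_closed[OF assms, unfolded closed_delta_def, rule_format, OF _ _ v Some[unfolded a]] by auto
      have e: "q' = RN (if a3 = 1 then snd (hd ac) = Go_left else g) s'"
        "acts = stays (a0 # a1 # a2 # []) @ (a3, snd (hd ac)) # ac"
        using d v Some a unfolding qn as(1) by auto
      have "q' \<in> vstates M" using h(1) e(1) by (auto simp: vstates_def)
      moreover have "fst ` set acts \<subseteq> {..<max 10 (nsyms M)}" using s h(3) unfolding e(2) as(1) by auto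
      ultimately show ?thesis using h(2) e(2) by auto
    qed
  next
    case False
    have l': "length bs + 5 = 4 + ntapes M" using K as(2) by simp
    have s': "a0 < max 10 (nsyms M)" "a1 < max 10 (nsyms M)" "a2 < max 10 (nsyms M)" "a3 < max 10 (nsyms M)"
      "b < max 10 (nsyms M)" "\<forall>x\<in>set bs. x < max 10 (nsyms M)" using s unfolding as(1) by auto
    define N where "N = max 10 (nsyms M)"
    have N: "3 < N" "9 < N" "0 < N" "3 - a1 < N" by (auto simp: N_def)
    note f = s'[folded N_def] l' n0 N
    have "case vact M q a0 a1 a2 a3 b bs of None \<Rightarrow> True | Some (q', acts) \<Rightarrow>
      q' \<in> vstates M \<and> length acts = 4 + ntapes M \<and> (\<forall>x\<in>set acts. fst x < N)"
    proof (cases q)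
      case (PB e c)
      then have "c \<le> 8" using q by (simp add: vstates_iff)
      then show ?thesis using f unfolding PB by (cases e) (simp_all add: vstates_iff)
    next
      case (RN g s)
      then show ?thesis using False by blast
    qed (use f in \<open>simp_all add: vstates_iff bit_sym_def\<close>)
    then have "q' \<in> vstates M \<and> length acts = 4 + ntapes M \<and> fst ` set acts \<subseteq> {..<N}"
      using d unfolding as(1) by auto
    then show ?thesis by (simp add: N_def)
  qed
qed

section \<open>Phases of the verifier, from the last to the first\<close>

abbreviation bits_tape :: "bool list \<Rightarrow> int \<Rightarrow> tape" where
  "bits_tape x \<equiv> tp (map bit_sym x)"

abbreviation code_tape :: "nat list \<Rightarrow> tape" where
  "code_tape cs \<equiv> tp (rev cs) (int (length cs) - 1)"

abbreviation vstep :: "tm \<Rightarrow> vstate \<times> tape list \<Rightarrow> vstate \<times> tape list" where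
  "vstep M \<equiv> tstep (vdelta M)"

abbreviation vhalts :: "tm \<Rightarrow> nat \<Rightarrow> bool list \<Rightarrow> vstate \<times> tape list \<Rightarrow> bool" where
  "vhalts M \<equiv> halts_with (vdelta M)"

text \<open>The head runs left to the blank in cell -1, turns, and writes the answer in cell 0 and a
  blank in cell 1, so the output has length one whatever remains of the input.\<close>

lemma halts_FN1:
  assumes "-1 \<le> p" "p < int (length S)"
  shows "vhalts M (length S + 5) [v] (FN 1 v, bits_tape S p # t1 # t2 # t3 # u # us)"
proof -
  have *: "vhalts M (nat (p + 1) + 4) [v] (FN 1 v, bits_tape S p # t1 # t2 # t3 # u # us)"
    using assms
  proof (induction "nat (p + 1)" arbitrary: p)
    case 0
    then have p: "p = -1" by simp
    let ?c = "(FN 1 v, bits_tape S p # t1 # t2 # t3 # u # us)"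
    define f where "f = (fst (bits_tape S p))(0 := bit_sym v, 1 := 0)"
    have 1: "vstep M ?c = (FN 2 v, bits_tape S 0 # t1 # t2 # t3 # u # us)"
      by (simp add: tstep_def p read_tp act_stays' act_stay)  (simp add: tp_def fun_eq_iff)
    have 2: "vstep M (FN 2 v, bits_tape S 0 # t1 # t2 # t3 # u # us) = (FN 3 v, ((fst (bits_tape S p))(0 := bit_sym v), 1) # t1 # t2 # t3 # u # us)"
      by (simp add: tstep_def act_stays' act_stay) (simp add: tp_def fun_eq_iff)
    have 3: "vstep M (FN 3 v, ((fst (bits_tape S p))(0 := bit_sym v), 1) # t1 # t2 # t3 # u # us) = (FN 4 v, (f, 1) # t1 # t2 # t3 # u # us)"
      by (simp add: tstep_def act_stays' act_stay f_def)
    have 4: "vhalts M 0 [v] (FN 4 v, (f, 1) # t1 # t2 # t3 # u # us)"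
      by (simp add: halts_with_def has_output_def f_def)
    show ?case
      by (rule halts_with_tstep[OF 1], rule halts_with_tstep[OF 2], rule halts_with_tstep[OF 3 4]) auto
  next
    case (Suc n)
    then have p: "0 \<le> p" "p < int (length S)" by auto
    have nz: "bit_sym (S ! nat p) \<noteq> 0" by (simp add: bit_sym_def)
    have 1: "vstep M (FN 1 v, bits_tape S p # t1 # t2 # t3 # u # us) = (FN 1 v, bits_tape S (p - 1) # t1 # t2 # t3 # u # us)"
      using p nz by (simp add: tstep_def read_tp act_stays' act_stay nat_less_iff) (auto simp: tp_def fun_eq_iff)
    show ?case
      by (rule halts_with_tstep[OF 1 Suc(1)]) (use Suc in auto)
  qed
  show ?thesis by (rule halts_with_mono[OF *]) (use assms in auto)
qed

lemma halts_FN: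
  assumes "0 \<le> p" "p \<le> int (length S)"
  shows "vhalts M (length S + 6) [v] (FN 0 v, bits_tape S p # t1 # t2 # t3 # u # us)"
proof -
  have 1: "vstep M (FN 0 v, bits_tape S p # t1 # t2 # t3 # u # us) = (FN 1 v, bits_tape S (p - 1) # t1 # t2 # t3 # u # us)"
    by (simp add: tstep_def act_stays' act_stay) (auto simp: tp_def fun_eq_iff)
  show ?thesis by (rule halts_with_tstep[OF 1 halts_FN1]) (use assms in auto)
qed

abbreviation skip_item :: "nat list \<Rightarrow> nat list" where
  "skip_item \<equiv> dropWhile (\<lambda>c. c \<noteq> 8)"

text \<open>The comparison string has no terminator of its own: the end of the program or any code
  other than 5 and 6 ends it, in practice the 8 of the next item.\<close>

primrec matches_codes :: "nat list \<Rightarrow> bool list \<Rightarrow> bool" where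
  "matches_codes [] y \<longleftrightarrow> y = []"
| "matches_codes (c # cs) y \<longleftrightarrow>
     (if c = 5 then y \<noteq> [] \<and> \<not> hd y \<and> matches_codes cs (tl y)
      else if c = 6 then y \<noteq> [] \<and> hd y \<and> matches_codes cs (tl y)
      else y = [])"

lemma read_code: "read_tape (tp (rev cs @ [c]) (int (length cs))) = c"
  by (simp add: read_tp nth_append)

lemma pop_code:
  "act_tape (0, Go_left) (tp (rev cs @ [c]) (int (length cs))) = code_tape cs"
  using act_pop[of "int (length cs)" "rev cs" c] by simp

lemma tstep_vdelta:
  "vstep M (q, t0 # t1 # t2 # t3 # u # us) =
     (case vact M q (read_tape t0) (read_tape t1) (read_tape t2) (read_tape t3) (read_tape u) (map read_tape us) of
        None \<Rightarrow> (q, t0 # t1 # t2 # t3 # u # us)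
      | Some (s, acts) \<Rightarrow> (s, map2 act_tape acts (t0 # t1 # t2 # t3 # u # us)))"
  by (simp add: tstep_def split: option.splits)

lemma halts_reject:
  assumes "vact M q (read_tape (bits_tape S p)) (read_tape t1) (read_tape t2) (read_tape t3) (read_tape u) (map read_tape us)
    = Some (FN 0 v, stays (map read_tape (bits_tape S p # t1 # t2 # t3 # u # us)))"
  assumes "0 \<le> p" "p \<le> int (length S)" "length S + 6 < T"
  shows "vhalts M T [v] (q, bits_tape S p # t1 # t2 # t3 # u # us)"
proof -
  have 1: "vstep M (q, bits_tape S p # t1 # t2 # t3 # u # us)
     = (FN 0 v, bits_tape S p # t1 # t2 # t3 # u # us)"
    unfolding tstep_vdelta assms(1) by (simp add: act_stay act_stays')
  show ?thesis by (rule halts_with_tstep[OF 1 halts_FN]) (use assms in auto)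
qed

lemma halts_CM:
  assumes "\<forall>i < length y. f (p + int i) = bit_sym (y ! i)" "f (p + int (length y)) = 0"
    and "0 \<le> j" "j \<le> int (length S)" "set cs \<subseteq> {1..9}"
  shows "vhalts M (length cs + length S + 8) [matches_codes cs y]
     (CM, bits_tape S j # t1 # code_tape cs # t3 # (f, p) # us)"
  using assms
proof (induction cs arbitrary: y p)
  case Nil
  have "f p = 0 \<longleftrightarrow> y = []" using Nil.prems(1,2) by (cases y) (auto simp: bit_sym_def split: if_splits)
  then show ?case using Nil
    by (intro halts_reject) (auto simp: read_tp)
next
  case (Cons c cs)
  let ?t2 = "code_tape (c # cs)"
  have rc: "read_tape ?t2 = c" by (simp add: read_code)
  show ?case
  proof (cases "(c = 5 \<and> f p = 1) \<or> (c = 6 \<and> f p = 2)")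
    case True
    then obtain b ys where y: "y = b # ys" using Cons.prems(2) by (cases y) auto
    have b: "f p = bit_sym b" using Cons.prems(1) y by auto
    have 1: "vstep M (CM, bits_tape S j # t1 # ?t2 # t3 # (f, p) # us)
       = (CM, bits_tape S j # t1 # code_tape cs # t3 # (f, p + 1) # us)"
      using True unfolding tstep_vdelta rc by (auto simp: act_stay act_stays' pop_code)
    have m: "matches_codes (c # cs) y = matches_codes cs ys" using True b y by (auto simp: bit_sym_def split: if_splits)
    have ih: "vhalts M (length cs + length S + 8) [matches_codes cs ys]
     (CM, bits_tape S j # t1 # code_tape cs # t3 # (f, p + 1) # us)"
    proof (rule Cons.IH)
      show "\<forall>i<length ys. f (p + 1 + int i) = bit_sym (ys ! i)"
      proof (intro allI impI)
        fix i assume "i < length ys"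
        then show "f (p + 1 + int i) = bit_sym (ys ! i)"
          using Cons.prems(1)[rule_format, of "Suc i"] y by (simp add: algebra_simps)
      qed
      show "f (p + 1 + int (length ys)) = 0" using Cons.prems(2) y by (simp add: algebra_simps)
    qed (use Cons.prems in auto)
    show ?thesis unfolding m by (rule halts_with_tstep[OF 1 ih]) auto
  next
    case False
    have m: "matches_codes (c # cs) y \<longleftrightarrow> c \<noteq> 5 \<and> c \<noteq> 6 \<and> f p = 0"
    proof (cases y)
      case Nil then show ?thesis using Cons.prems(2) by auto
    next
      case (Cons b ys)
      then have "f p = bit_sym b" using Cons.prems(1) by auto
      then show ?thesis using False Cons by (auto simp: bit_sym_def split: if_splits)
    qed
    show ?thesis unfolding m
      by (rule halts_reject) (use False Cons.prems(3,4) in \<open>simp_all add: read_code\<close>)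
  qed
qed

definition mark_tape :: "int \<Rightarrow> tape" where
  "mark_tape p = ((\<lambda>i. if i = 0 then 1 else 0), p)"

lemma read_mark: "read_tape (mark_tape p) = (if p = 0 then 1 else 0)"
  by (simp add: mark_tape_def)

lemma act_mark: "act_tape (read_tape (mark_tape p), d) (mark_tape p) = mark_tape (shift d p)"
  by (auto simp: mark_tape_def)

text \<open>The mark tape moves along with the tape of \<open>M\<close>, so a head on the mark means
  cell 0. The first premise says that \<open>g\<close> points towards it, and each step lowers the
  distance.\<close>

lemma halts_BK:
  assumes "p \<noteq> 0 \<longrightarrow> (g \<longleftrightarrow> p < 0)"
    and "vhalts M T y (CM, t0 # t1 # t2 # mark_tape 0 # (f, 0) # us)"
    and "nat \<bar>p\<bar> + 1 + T \<le> T'"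
  shows "vhalts M T' y (BK g, t0 # t1 # t2 # mark_tape p # (f, p) # us)"
  using assms(1,3)
proof (induction "nat \<bar>p\<bar>" arbitrary: p T')
  case 0
  then have p: "p = 0" by simp
  have 1: "vstep M (BK g, t0 # t1 # t2 # mark_tape p # (f, p) # us)
    = (CM, t0 # t1 # t2 # mark_tape 0 # (f, 0) # us)"
    unfolding tstep_vdelta using act_stay[of "(f, p)"] act_stay[of "mark_tape p"] p
    by (simp add: act_stay act_stays' read_mark)
  show ?case by (rule halts_with_tstep[OF 1 assms(2)]) (use 0 in auto)
next
  case (Suc n)
  then have p: "p \<noteq> 0" by auto
  let ?d = "if g then Go_right else Go_left"
  let ?p = "shift ?d p"
  have 1: "vstep M (BK g, t0 # t1 # t2 # mark_tape p # (f, p) # us)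
    = (BK g, t0 # t1 # t2 # mark_tape ?p # (f, ?p) # us)"
    unfolding tstep_vdelta using p act_mark[of p ?d]
    by (simp add: act_stay act_stays' read_mark split: if_splits)
  have q: "n = nat \<bar>?p\<bar>" using Suc p by (cases g) auto
  have "?p \<noteq> 0 \<longrightarrow> (g \<longleftrightarrow> ?p < 0)" using Suc(3) p by (cases g) auto
  from Suc(1)[OF q this order_refl] show ?case
    by (rule halts_with_tstep[OF 1]) (use Suc q in auto)
qed

text \<open>The flag is rewritten only when the head acts on cell 0, which preserves the premise
  about the side. A simulated step moves the head at most one cell further away, so the return takes
  at most \<open>t + \<bar>p\<bar>\<close> moves; hence the factor 2.\<close>

lemma halts_RN:
  assumes wf: "wf_tm M"
    and c: "tm_cfg M (s, (f, p) # us)"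
    and h: "halted M ((step M ^^ t) (s, (f, p) # us))"
    and o: "has_output ((step M ^^ t) (s, (f, p) # us)) y"
    and g: "p \<noteq> 0 \<longrightarrow> (g \<longleftrightarrow> p < 0)"
    and j: "0 \<le> j" "j \<le> int (length S)" and cs: "set cs \<subseteq> {1..9}"
  shows "vhalts M (2 * t + nat \<bar>p\<bar> + length cs + length S + 10) [matches_codes cs y]
     (RN g s, bits_tape S j # t1 # code_tape cs # mark_tape p # (f, p) # us)"
  using c h o g
proof (induction t arbitrary: s f p us g)
  case 0
  have v: "set (f p # map read_tape us) \<subseteq> {..<nsyms M}" using cfg_ok_read(2)[OF 0(1)] by simp
  have n: "delta M s (f p # map read_tape us) = None" using 0(2) by (simp add: halted_def next_action_def)
  have 1: "vstep M (RN g s, bits_tape S j # t1 # code_tape cs # mark_tape p # (f, p) # us)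
    = (BK g, bits_tape S j # t1 # code_tape cs # mark_tape p # (f, p) # us)"
    unfolding tstep_vdelta using v n act_stay[of "(f, p)"] act_stay[of "mark_tape p"]
    by (simp add: act_stay act_stays')
  have "\<forall>i < length y. f (0 + int i) = bit_sym (y ! i)" "f (0 + int (length y)) = 0"
    using 0(3) by (auto simp: has_output_def)
  note 2 = halts_CM[OF this j cs]
  show ?case by (rule halts_with_tstep[OF 1], rule halts_BK[OF 0(4) 2 order_refl]) auto
next
  case (Suc t)
  have v: "set (f p # map read_tape us) \<subseteq> {..<nsyms M}" using cfg_ok_read(2)[OF Suc.prems(1)] by simp
  have l: "length (f p # map read_tape us) = ntapes M" using cfg_ok_read(1)[OF Suc.prems(1)] by simp
  show ?case
  proof (cases "delta M s (f p # map read_tape us)")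
    case None
    \<comment> \<open>\<open>t\<close> may exceed the halting time of \<open>M\<close>, as
      \<open>step\<close> fixes halted configurations; the induction hypothesis then applies to the
      same configuration.\<close>
    have "step M (s, (f, p) # us) = (s, (f, p) # us)" by (simp add: step_def next_action_def None)
    then have "(step M ^^ Suc t) (s, (f, p) # us) = (step M ^^ t) (s, (f, p) # us)"
      by (simp add: funpow_Suc_right del: funpow.simps)
    then show ?thesis using Suc.IH[OF Suc.prems(1) _ _ Suc.prems(4)] Suc.prems(2,3) halts_with_mono by fastforce
  next
    case (Some a)
    obtain s' ac where a: "a = (s', ac)" by (cases a)
    have "s \<in> {..<nstates M}" using Suc.prems(1) by (simp add: cfg_ok_def)
    then have "length ac = ntapes M"
      using wf_tm_closed[OF wf, unfolded closed_delta_def, rule_format, OF _ l v Some[unfolded a]] by auto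
    then obtain e d ac' where ac: "ac = (e, d) # ac'" using l by (cases ac) auto
    let ?us = "map2 act_tape ac' us"
    have st: "step M (s, (f, p) # us) = (s', (f(p := e), shift d p) # ?us)"
      by (simp add: step_def next_action_def Some a ac)
    let ?g = "if p = 0 then d = Go_left else g"
    have 1: "vstep M (RN g s, bits_tape S j # t1 # code_tape cs # mark_tape p # (f, p) # us)
      = (RN ?g s', bits_tape S j # t1 # code_tape cs # mark_tape (shift d p) # (f(p := e), shift d p) # ?us)"
      unfolding tstep_vdelta using v Some a ac act_mark[of p d]
      by (simp add: act_stay act_stays' read_mark)
    have g': "shift d p \<noteq> 0 \<longrightarrow> (?g \<longleftrightarrow> shift d p < 0)" using Suc.prems(4) by (cases d) auto
    have c': "tm_cfg M (s', (f(p := e), shift d p) # ?us)"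
      using cfg_ok_tstep[OF wf_tm_closed[OF wf] Suc.prems(1)] st by (simp add: step_eq_tstep)
    have e: "(step M ^^ Suc t) (s, (f, p) # us) = (step M ^^ t) (s', (f(p := e), shift d p) # ?us)"
      by (simp add: funpow_Suc_right st del: funpow.simps)
    have b: "nat \<bar>shift d p\<bar> \<le> nat \<bar>p\<bar> + 1" by (cases d) auto
    from Suc.IH[OF c' Suc.prems(2,3)[unfolded e] g'] show ?thesis
      by (rule halts_with_tstep[OF 1]) (use b in auto)
  qed
qed

text \<open>The behavior from state \<open>IN\<close> on, as a function: \<open>g\<close> is what
  \<open>M\<close> computes, \<open>p\<close> the head position on \<open>x\<close>,
  \<open>z\<close> the string written so far. Code 9 asks for a \<open>False\<close> in
  \<open>z\<close> because a time bound for \<open>M\<close> is known only on such strings.\<close>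

function interp :: "(bool list \<Rightarrow> bool list) \<Rightarrow> bool list \<Rightarrow> nat list \<Rightarrow> bool list \<Rightarrow> int \<Rightarrow> bool list \<Rightarrow> bool" where
  "interp g x [] w p z \<longleftrightarrow> False"
| "interp g x (c # cs) w p z \<longleftrightarrow>
     (if c = 1 then interp g x cs w (p - 1) z
      else if c = 2 then interp g x cs w (p + 1) z
      else if c = 3 then 0 \<le> p \<and> p < int (length x) \<and> interp g x cs w p (z @ [x ! nat p])
      else if c = 4 then 0 \<le> p \<and> p < int (length x) \<and> interp g x cs w p (z @ [\<not> x ! nat p])
      else if c = 5 then interp g x cs w p (z @ [False])
      else if c = 6 then interp g x cs w p (z @ [True])
      else if c = 7 then (case w of [] \<Rightarrow> False | b # w' \<Rightarrow> interp g x cs w' p (z @ [b]))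
      else if c = 8 then (case w of [] \<Rightarrow> False
        | b # w' \<Rightarrow> if b then interp g x cs w' p z else interp g x (skip_item cs) w' p z)
      else if c = 9 then False \<in> set z \<and> matches_codes cs (g z)
      else False)"
  by pat_completeness auto
termination
  by (relation "measure (\<lambda>(g, x, cs, w, p, z). length cs)") (auto simp: le_imp_less_Suc length_dropWhile_le)

fun parse :: "(bool list \<Rightarrow> bool list) \<Rightarrow> vstate \<Rightarrow> bool list \<Rightarrow> nat list \<Rightarrow> bool list \<Rightarrow> bool" where
  "parse g (PA i) x cs (b # s) \<longleftrightarrow>
     (if i = 0 \<or> i = 2 then b \<and> parse g (PA (i + 1)) x cs s
      else if i = 1 then (if b then parse g (PA 2) x cs s else parse g (PB False 0) x cs s)
      else i = 3 \<and> parse g (PA 0) (x @ [b]) cs s)"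
| "parse g (PB False c) x cs (b # s) \<longleftrightarrow>
     (if b then parse g (PB True c) x cs s else interp g x cs s (int (length x)) [])"
| "parse g (PB True c) x cs (b # s) \<longleftrightarrow>
     (if b then c < 8 \<and> parse g (PB False (c + 1)) x cs s else parse g (PB False 0) x ((c + 1) # cs) s)"
| "parse g _ x cs _ \<longleftrightarrow> False"

lemma bit_sym_simps [simp]: "bit_sym b \<noteq> 0" "bit_sym b = 2 \<longleftrightarrow> b" "bit_sym b = 1 \<longleftrightarrow> \<not> b" "bit_sym b = Suc 0 \<longleftrightarrow> \<not> b" "3 - bit_sym b = bit_sym (\<not> b)"
  by (auto simp: bit_sym_def)

text \<open>\<open>n\<close> counts the bits of \<open>z\<close> not yet passed on the way to cell
  -1, and \<open>g\<close> records a \<open>False\<close> among the others. The mark is written in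
  the step in which the head of \<open>M\<close> turns back to cell 0.\<close>

lemma halts_RW:
  assumes H: "False \<in> set z \<Longrightarrow> vhalts M T [v] (RN False 0, bits_tape S j # t1 # t2 # mark_tape 0 # bits_tape z 0 # us)"
    and j: "0 \<le> j" "j \<le> int (length S)" and T: "length S + 7 \<le> T" and n: "n \<le> length z"
    and g: "g \<longleftrightarrow> False \<in> set (drop n z)"
  shows "vhalts M (T + n + 1) [False \<in> set z \<and> v]
    (RW g, bits_tape S j # t1 # t2 # blank_tape # bits_tape z (int n - 1) # us)"
  using n g
proof (induction n arbitrary: g)
  case 0
  show ?case
  proof (cases g)
    case True
    have rz: "read_tape (bits_tape z (- 1)) = 0" by (simp add: read_tp)
    have "act_tape (0, Go_right) (bits_tape z (- 1)) = bits_tape z 0"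
      using act_move[of "map bit_sym z" "-1" Go_right] by (simp add: read_tp)
    then have 1: "vstep M (RW g, bits_tape S j # t1 # t2 # blank_tape # bits_tape z (int 0 - 1) # us)
      = (RN False 0, bits_tape S j # t1 # t2 # mark_tape 0 # bits_tape z 0 # us)"
      using True rz unfolding tstep_vdelta
      by (simp add: act_stay act_stays') (auto simp: mark_tape_def blank_tape_def)
    have "False \<in> set z" using True 0 by simp
    then show ?thesis using halts_with_tstep[OF 1 H] by simp
  next
    case False
    have "\<not> (False \<in> set z \<and> v)" using False 0 by simp
    then show ?thesis using False j T by (intro halts_reject) (auto simp: read_tp)
  qed
next
  case (Suc n)
  have r: "read_tape (bits_tape z (int n)) = bit_sym (z ! n)" using Suc by (simp add: read_tp)
  have "act_tape (bit_sym (z ! n), Go_left) (bits_tape z (int n)) = bits_tape z (int n - 1)"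
    using act_move[of "map bit_sym z" "int n" Go_left] r by simp
  then have 1: "vstep M (RW g, bits_tape S j # t1 # t2 # blank_tape # bits_tape z (int (Suc n) - 1) # us)
    = (RW (g \<or> \<not> z ! n), bits_tape S j # t1 # t2 # blank_tape # bits_tape z (int n - 1) # us)"
    unfolding tstep_vdelta by (simp add: act_stay act_stays' r)
  have "drop n z = z ! n # drop (Suc n) z" using Suc.prems(1) by (simp add: Cons_nth_drop_Suc)
  then have g: "(g \<or> \<not> z ! n) \<longleftrightarrow> False \<in> set (drop n z)" using Suc.prems(2) by auto
  show ?case by (rule halts_with_tstep[OF 1 Suc.IH[OF _ g]]) (use Suc in auto)
qed

lemma halts_run:
  assumes wf: "wf_tm M" and out: "False \<in> set z \<Longrightarrow> tm_outputs_within M z P (g z)"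
    and j: "0 \<le> j" "j \<le> int (length S)" and cs: "set cs \<subseteq> {1..9}"
  shows "vhalts M (2 * P + length z + length cs + length S + 12) [False \<in> set z \<and> matches_codes cs (g z)]
    (RW False, bits_tape S j # t1 # code_tape cs # blank_tape #
       bits_tape z (int (length z) - 1) # blank_tapes M)"
proof -
  have H: "vhalts M (2 * P + length cs + length S + 10) [matches_codes cs (g z)]
    (RN False 0, bits_tape S j # t1 # code_tape cs # mark_tape 0 #
       bits_tape z 0 # blank_tapes M)" if F: "False \<in> set z"
  proof -
    obtain t where t: "t \<le> P" "halted M ((step M ^^ t) (init_config M z))" "has_output ((step M ^^ t) (init_config M z)) (g z)"
      using out[OF F] by (auto simp: tm_outputs_within_def)
    obtain f where f: "bits_tape z 0 = (f, 0)" by (simp add: tp_def)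
    have i: "init_config M z = (0, (f, 0) # blank_tapes M)"
      by (simp add: init_config_def input_tape_tp f)
    have ok: "tm_cfg M (init_config M z)"
      unfolding init_config_def by (rule cfg_ok_init) (use wf in \<open>auto simp: wf_tm_def\<close>)
    show ?thesis unfolding f
      by (rule halts_with_mono[OF halts_RN[OF wf ok[unfolded i] t(2,3)[unfolded i] _ j cs]]) (use t(1) in auto)
  qed
  show ?thesis
    by (rule halts_with_mono[OF halts_RW[OF H j]]) auto
qed

text \<open>Skipping stops at an 8 without erasing it, so that \<open>IN\<close> reads the next bit
  of \<open>w\<close> for it. If no 8 is left, the machine rejects, which \<open>T\<close> is large
  enough to cover.\<close>

lemma halts_SK:
  assumes j: "0 \<le> j" "j \<le> int (length S)" and T: "length S + 7 \<le> T"
    and cs: "set cs \<subseteq> {1..9}"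
    and H: "skip_item cs \<noteq> [] \<Longrightarrow> vhalts M T [v]
      (IN, bits_tape S j # t1 # code_tape (skip_item cs) # t3 # u # us)"
    and v: "skip_item cs = [] \<Longrightarrow> \<not> v"
  shows "vhalts M (T + (length cs - length (skip_item cs)) + 1) [v]
      (SK, bits_tape S j # t1 # code_tape cs # t3 # u # us)"
  using cs H v
proof (induction cs)
  case Nil
  then show ?case using j T by (intro halts_reject) (auto simp: read_tp)
next
  case (Cons c cs)
  show ?case
  proof (cases "c = 8")
    case True
    have 1: "vstep M (SK, bits_tape S j # t1 # code_tape (c # cs) # t3 # u # us)
      = (IN, bits_tape S j # t1 # code_tape (c # cs) # t3 # u # us)"
      using True act_stay[of "tp (rev cs @ [c]) (int (length cs))"] unfolding tstep_vdelta
      by (simp add: act_stay act_stays' read_code)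
    have d: "skip_item (c # cs) = c # cs" using True by simp
    show ?thesis using halts_with_tstep[OF 1 Cons.prems(2)[unfolded d]] unfolding d by simp
  next
    case False
    have 1: "vstep M (SK, bits_tape S j # t1 # code_tape (c # cs) # t3 # u # us)
      = (SK, bits_tape S j # t1 # code_tape cs # t3 # u # us)"
      using False Cons.prems(1) unfolding tstep_vdelta
      by (simp add: act_stay act_stays' read_code pop_code)
    have l: "length (skip_item cs) \<le> length cs" by (rule length_dropWhile_le)
    show ?thesis
      by (rule halts_with_tstep[OF 1 Cons.IH]) (use Cons.prems False l in auto)
  qed
qed

text \<open>Each instruction emits at most one bit, so \<open>length z + length cs\<close> never
  increases and \<open>M\<close> is run only on strings of length at most \<open>N\<close>. A code
  costs at most two steps: one for being executed or skipped, and one more for the end of a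
  skip.\<close>

lemma halts_IN:
  assumes wf: "wf_tm M" and out: "\<And>z. False \<in> set z \<Longrightarrow> length z \<le> N \<Longrightarrow> tm_outputs_within M z P (g z)"
    and cs: "set cs \<subseteq> {1..9}" and S: "S = pre @ w" and N: "length z + length cs \<le> N"
  shows "vhalts M (2 * length cs + (2 * P + 2 * N + length S + 20)) [interp g x cs w p z]
    (IN, bits_tape S (int (length pre)) # bits_tape x p # code_tape cs #
       blank_tape # bits_tape z (int (length z)) # blank_tapes M)"
  using cs S N
proof (induction "length cs" arbitrary: cs pre w p z rule: less_induct)
  case less
  let ?B = "2 * P + 2 * N + length S + 20"
  let ?us = "blank_tapes M"
  have j: "0 \<le> int (length pre)" "int (length pre) \<le> int (length S)" using less.prems by auto
  show ?case
  proof (cases cs)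
    case Nil
    then show ?thesis using j by (intro halts_reject) (auto simp: read_tp)
  next
    case (Cons c cs')
    have cs': "set cs' \<subseteq> {1..9}" and c: "c \<in> {1..9}" using less.prems Cons by auto
    let ?C = "\<lambda>q pre p cs z. (q, bits_tape S (int (length pre)) # bits_tape x p # code_tape cs #
       blank_tape # bits_tape z (int (length z)) # ?us)"
    have IH: "vhalts M (2 * length cs' + ?B) [interp g x cs' w' p' z'] (?C IN pre' p' cs' z')"
      if "S = pre' @ w'" "length z' \<le> Suc (length z)" for pre' w' p' z'
      by (rule less.hyps) (use that Cons less.prems in auto)
    have app: "act_tape (bit_sym b, Go_right) (bits_tape z (int (length z))) = tp (map bit_sym (z @ [b])) (int (length (z @ [b])))" for b
      using act_append[of "int (length z)" "map bit_sym z" "bit_sym b"] by (simp add: add.commute)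
    have adv: "act_tape (bit_sym b, Go_right) (bits_tape S (int (length pre))) = bits_tape S (int (length (pre @ [b])))"
      "read_tape (bits_tape S (int (length pre))) = bit_sym b" if "w = b # w'" for b w'
    proof -
      show r: "read_tape (bits_tape S (int (length pre))) = bit_sym b"
        using that less.prems by (simp add: read_tp nth_append)
      show "act_tape (bit_sym b, Go_right) (bits_tape S (int (length pre))) = bits_tape S (int (length (pre @ [b])))"
        using act_move[of "map bit_sym S" "int (length pre)" Go_right] r by (simp add: add.commute)
    qed
    have adv0: "read_tape (bits_tape S (int (length pre))) = 0" if "w = []"
      using that less.prems by (simp add: read_tp)
    have rx: "read_tape (bits_tape x p) = (if 0 \<le> p \<and> p < int (length x) then bit_sym (x ! nat p) else 0)"
      by (simp add: read_tp nat_less_iff)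
    have mx: "act_tape (read_tape (bits_tape x p), d) (bits_tape x p) = bits_tape x (shift d p)" for d
      by (rule act_move)
    note st = tstep_vdelta act_stay act_stays' read_code pop_code
    consider "c = 1" | "c = 2" | "c = 3" | "c = 4" | "c = 5" | "c = 6" | "c = 7" | "c = 8" | "c = 9"
      using c by force
    then show ?thesis
    proof cases
      case 1
      have s: "vstep M (?C IN pre p cs z) = ?C IN pre (p - 1) cs' z"
        using mx[of Go_left] unfolding Cons 1 by (simp add: st)
      show ?thesis using halts_with_tstep[OF s IH[OF less.prems(2)]] unfolding Cons 1 by simp
    next
      case 2
      have s: "vstep M (?C IN pre p cs z) = ?C IN pre (p + 1) cs' z"
        using mx[of Go_right] unfolding Cons 2 by (simp add: st)
      show ?thesis using halts_with_tstep[OF s IH[OF less.prems(2)]] unfolding Cons 2 by simp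
    next
      case 3
      show ?thesis
      proof (cases "0 \<le> p \<and> p < int (length x)")
        case True
        have s: "vstep M (?C IN pre p cs z) = ?C IN pre p cs' (z @ [x ! nat p])"
          using mx[of Go_stay] app[of "x ! nat p"] rx True unfolding Cons 3 by (simp add: st)
        show ?thesis using halts_with_tstep[OF s IH[OF less.prems(2)]] True unfolding Cons 3 by simp
      next
        case False
        then have "\<not> interp g x cs w p z" unfolding Cons 3 by auto
        then show ?thesis using rx False j unfolding Cons 3
          by (intro halts_reject) (simp_all add: read_code)
      qed
    next
      case 4
      show ?thesis
      proof (cases "0 \<le> p \<and> p < int (length x)")
        case True
        have s: "vstep M (?C IN pre p cs z) = ?C IN pre p cs' (z @ [\<not> x ! nat p])"
          using mx[of Go_stay] app[of "\<not> x ! nat p"] rx True unfolding Cons 4 by (simp add: st)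
        show ?thesis using halts_with_tstep[OF s IH[OF less.prems(2)]] True unfolding Cons 4 by simp
      next
        case False
        then have "\<not> interp g x cs w p z" unfolding Cons 4 by auto
        then show ?thesis using rx False j unfolding Cons 4
          by (intro halts_reject) (simp_all add: read_code)
      qed
    next
      case 5
      have s: "vstep M (?C IN pre p cs z) = ?C IN pre p cs' (z @ [False])"
        using app[of False] unfolding Cons 5 by (simp add: st bit_sym_def)
      show ?thesis using halts_with_tstep[OF s IH[OF less.prems(2)]] unfolding Cons 5 by simp
    next
      case 6
      have s: "vstep M (?C IN pre p cs z) = ?C IN pre p cs' (z @ [True])"
        using app[of True] unfolding Cons 6 by (simp add: st bit_sym_def)
      show ?thesis using halts_with_tstep[OF s IH[OF less.prems(2)]] unfolding Cons 6 by simp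
    next
      case 7
      show ?thesis
      proof (cases w)
        case Nil
        then have "\<not> interp g x cs w p z" unfolding Cons 7 by auto
        then show ?thesis using adv0[OF Nil] j unfolding Cons 7
          by (intro halts_reject) (simp_all add: read_code)
      next
        case w: (Cons b w')
        have s: "vstep M (?C IN pre p cs z) = ?C IN (pre @ [b]) p cs' (z @ [b])"
          using app[of b] adv[OF w] unfolding Cons 7 by (simp add: st)
        show ?thesis using halts_with_tstep[OF s IH[of "pre @ [b]" w']] less.prems(2) unfolding Cons 7 w by simp
      qed
    next
      case 8
      show ?thesis
      proof (cases w)
        case Nil
        then have "\<not> interp g x cs w p z" unfolding Cons 8 by auto
        then show ?thesis using adv0[OF Nil] j unfolding Cons 8
          by (intro halts_reject) (simp_all add: read_code)
      next
        case w: (Cons b w')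
        show ?thesis
        proof (cases b)
          case True
          have s: "vstep M (?C IN pre p cs z) = ?C IN (pre @ [b]) p cs' z"
            using adv[OF w] True unfolding Cons 8 by (simp add: st)
          show ?thesis using halts_with_tstep[OF s IH[of "pre @ [b]" w']] less.prems(2) True unfolding Cons 8 w by simp
        next
          case False
          let ?dr = "skip_item cs'"
          have s: "vstep M (?C IN pre p cs z) = ?C SK (pre @ [b]) p cs' z"
            using adv[OF w] False unfolding Cons 8 by (simp add: st)
          have l: "length ?dr \<le> length cs'" by (rule length_dropWhile_le)
          have d: "set ?dr \<subseteq> {1..9}" using cs' set_dropWhileD by fastforce
          have I: "vhalts M (2 * length ?dr + ?B) [interp g x ?dr w' p z] (?C IN (pre @ [b]) p ?dr z)"
            by (rule less.hyps) (use l d Cons w less.prems in auto)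
          have K: "vhalts M (2 * length ?dr + ?B + (length cs' - length ?dr) + 1) [interp g x ?dr w' p z] (?C SK (pre @ [b]) p cs' z)"
          proof (rule halts_SK)
            show "\<not> interp g x ?dr w' p z" if "?dr = []" unfolding that by simp
          qed (use I cs' less.prems w in auto)
          have e: "interp g x cs w p z = interp g x ?dr w' p z" using False unfolding Cons 8 w by simp
          show ?thesis unfolding e by (rule halts_with_tstep[OF s K]) (use l Cons in auto)
        qed
      qed
    next
      case 9
      have "act_tape (read_tape (bits_tape z (int (length z))), Go_left) (bits_tape z (int (length z))) = bits_tape z (int (length z) - 1)"
        by (simp add: act_move)
      then have s: "vstep M (?C IN pre p cs z) = (RW False, bits_tape S (int (length pre)) # bits_tape x p # code_tape cs' #
       blank_tape # bits_tape z (int (length z) - 1) # ?us)"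
        unfolding Cons 9 by (simp add: st)
      have e: "interp g x cs w p z \<longleftrightarrow> False \<in> set z \<and> matches_codes cs' (g z)" unfolding Cons 9 by simp
      have o: "tm_outputs_within M z P (g z)" if "False \<in> set z" using out that less.prems by simp
      show ?thesis unfolding e
        by (rule halts_with_tstep[OF s halts_run[where g = g and z = z and P = P, OF wf o j cs']]) (use less.prems Cons in auto)
    qed
  qed
qed

lemma halts_parse:
  assumes wf: "wf_tm M" and out: "\<And>z. False \<in> set z \<Longrightarrow> length z \<le> N \<Longrightarrow> tm_outputs_within M z P (g z)"
    and cs: "set cs \<subseteq> {1..9}" and S: "S = pre @ s" and N: "length cs + length s \<le> N"
    and q: "(\<exists>i. q = PA i) \<or> (\<exists>e c. q = PB e c \<and> c \<le> 8)"
  shows "vhalts M (length s + 2 * N + (2 * P + 2 * N + length S + 21)) [parse g q x cs s]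
    (q, bits_tape S (int (length pre)) # bits_tape x (int (length x)) # tp (rev cs) (int (length cs)) #
       blank_tape # blank_tape # blank_tapes M)"
  using cs S N q
proof (induction s arbitrary: cs pre q x)
  case Nil
  have r: "read_tape (bits_tape S (int (length pre))) = 0" using Nil by (simp add: read_tp)
  have p: "\<not> parse g q x cs []" by simp
  have "vact M q 0 a1 a2 a3 b bs = Some (FN 0 False, stays (0 # a1 # a2 # a3 # b # bs))" for a1 a2 a3 b bs
  proof -
    consider i where "q = PA i" | c where "q = PB False c" | c where "q = PB True c"
      using Nil(4) by (metis (full_types))
    then show ?thesis by cases simp_all
  qed
  then show ?case using p r Nil by (intro halts_reject) auto
next
  case (Cons b s)
  let ?B = "2 * P + 2 * N + length S + 21"
  let ?us = "blank_tapes M"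
  let ?C = "\<lambda>q pre x cs. (q, bits_tape S (int (length pre)) # bits_tape x (int (length x)) # tp (rev cs) (int (length cs)) #
       blank_tape # blank_tape # ?us)"
  have r: "read_tape (bits_tape S (int (length pre))) = bit_sym b"
    using Cons by (simp add: read_tp nth_append)
  have adv: "act_tape (bit_sym b, Go_right) (bits_tape S (int (length pre))) = bits_tape S (int (length (pre @ [b])))"
    using act_move[of "map bit_sym S" "int (length pre)" Go_right] r by (simp add: add.commute)
  have S': "S = (pre @ [b]) @ s" using Cons by simp
  have IH: "vhalts M (length s + 2 * N + ?B) [parse g q' x' cs' s] (?C q' (pre @ [b]) x' cs')"
    if "set cs' \<subseteq> {1..9}" "length cs' \<le> Suc (length cs)" "(\<exists>i. q' = PA i) \<or> (\<exists>e c. q' = PB e c \<and> c \<le> 8)" for q' x' cs'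
    by (rule Cons.IH) (use that Cons.prems S' in auto)
  have rej: ?case if "vact M q (read_tape (bits_tape S (int (length pre)))) (read_tape (bits_tape x (int (length x))))
       (read_tape (tp (rev cs) (int (length cs)))) (read_tape blank_tape) (read_tape blank_tape) (map read_tape ?us)
     = Some (FN 0 False, stays (map read_tape (bits_tape S (int (length pre)) # bits_tape x (int (length x)) #
         tp (rev cs) (int (length cs)) # blank_tape # blank_tape # ?us)))" "\<not> parse g q x cs (b # s)"
  proof -
    have e: "parse g q x cs (b # s) = False" using that(2) by simp
    show ?thesis unfolding e by (rule halts_reject[OF that(1)]) (use Cons.prems(2) in auto)
  qed
  have go: ?case if "vstep M (?C q pre x cs) = ?C q' (pre @ [b]) x' cs'" "parse g q x cs (b # s) = parse g q' x' cs' s"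
    "set cs' \<subseteq> {1..9}" "length cs' \<le> Suc (length cs)" "(\<exists>i. q' = PA i) \<or> (\<exists>e c. q' = PB e c \<and> c \<le> 8)" for q' x' cs'
    unfolding that(2) by (rule halts_with_tstep[OF that(1) IH[OF that(3-5)]]) simp
  have appx: "act_tape (bit_sym b, Go_right) (bits_tape x (int (length x))) = tp (map bit_sym (x @ [b])) (int (length (x @ [b])))"
    using act_append[of "int (length x)" "map bit_sym x" "bit_sym b"] by (simp add: add.commute)
  have appc: "act_tape (c, Go_right) (tp (rev cs) (int (length cs))) = tp (rev (c # cs)) (int (length (c # cs)))" for c
    using act_append[of "int (length cs)" "rev cs" c] by (simp add: add.commute)
  note st = tstep_vdelta act_stay act_stays'
  consider i where "q = PA i" | c where "q = PB False c" "c \<le> 8" | c where "q = PB True c" "c \<le> 8"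
    using Cons.prems(4) by (metis (full_types))
  then show ?case
  proof cases
    case 1
    consider "(i = 0 \<or> i = 2) \<and> b" | "i = 1 \<and> b" | "i = 1 \<and> \<not> b" | "i = 3" | "(i = 0 \<or> i = 2) \<and> \<not> b \<or> i > 3" by fastforce
    then show ?thesis
    proof cases
      case a: 1 then show ?thesis unfolding 1 by (intro go[unfolded 1, of "PA (i + 1)" x cs]) (use Cons.prems(1) adv r in \<open>auto simp: st\<close>)
    next
      case a: 2 then show ?thesis unfolding 1 by (intro go[unfolded 1, of "PA 2" x cs]) (use Cons.prems(1) adv r in \<open>auto simp: st\<close>)
    next
      case a: 3 then show ?thesis unfolding 1 by (intro go[unfolded 1, of "PB False 0" x cs]) (use Cons.prems(1) adv r in \<open>auto simp: st\<close>)
    next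
      case a: 4 then show ?thesis unfolding 1 by (intro go[unfolded 1, of "PA 0" "x @ [b]" cs]) (use Cons.prems(1) adv r appx in \<open>auto simp: st\<close>)
    next
      case a: 5 then show ?thesis unfolding 1 by (intro rej[unfolded 1]) (auto simp: r)
    qed
  next
    case 2
    show ?thesis
    proof (cases b)
      case True then show ?thesis unfolding 2 by (intro go[unfolded 2, of "PB True c" x cs]) (use Cons.prems(1) adv r 2 in \<open>auto simp: st\<close>)
    next
      case False
      have l: "act_tape (read_tape (tp (rev cs) (int (length cs))), Go_left) (tp (rev cs) (int (length cs))) = code_tape cs"
        by (simp add: act_move)
      have s: "vstep M (?C q pre x cs) = (IN, bits_tape S (int (length (pre @ [b]))) # bits_tape x (int (length x)) #
        code_tape cs # blank_tape # bits_tape [] (int (length [])) # ?us)"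
        using False l adv r unfolding 2 by (simp add: st blank_tape_tp[symmetric])
      have e: "parse g q x cs (b # s) = interp g x cs s (int (length x)) []" using False unfolding 2 by simp
      show ?thesis unfolding e
        by (rule halts_with_tstep[OF s halts_IN[OF wf out Cons.prems(1) S']]) (use Cons.prems in auto)
    qed
  next
    case 3
    consider "b" "c < 8" | "b" "c = 8" | "\<not> b" using 3 by linarith
    then show ?thesis
    proof cases
      case a: 1 then show ?thesis unfolding 3 by (intro go[unfolded 3, of "PB False (c + 1)" x cs]) (use Cons.prems(1) adv r in \<open>auto simp: st\<close>)
    next
      case a: 2 then show ?thesis unfolding 3 by (intro rej[unfolded 3]) (auto simp: r)
    next
      case a: 3 then show ?thesis unfolding 3(1)
        by (intro go[unfolded 3(1), of "PB False 0" x "(c + 1) # cs"]) (use Cons.prems(1) adv r 3 appc[of "c + 1"] in \<open>auto simp: st\<close>)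
    qed
  qed
qed

lemma poly_nat_mono: "x \<le> y \<Longrightarrow> poly (p :: nat poly) x \<le> poly p y"
  by (induction p) (auto intro: add_mono mult_mono)

text \<open>The program, and hence the string handed to \<open>M\<close>, is no longer than the
  input. With \<open>N = length s\<close>, \<open>halts_parse\<close> gives an overhead of
  \<open>21 + 6 * length s\<close> plus twice the running time of \<open>M\<close>, which is
  \<open>?P\<close>.\<close>

theorem parse_PTIME:
  assumes wf: "wf_tm M" and out: "\<And>z. False \<in> set z \<Longrightarrow> tm_outputs_within M z (poly pf (length z)) (g z)"
  shows "{s. parse g (PA 0) [] [] s} \<in> PTIME"
proof -
  have K: "ntapes M \<ge> 1" "nstates M \<ge> 1" using wf by (auto simp: wf_tm_def)
  have "PA 0 \<in> vstates M" by (simp add: vstates_iff)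
  have "1 \<le> 4 + ntapes M" "3 \<le> max 10 (nsyms M)" by auto
  from typed_tm_realizable[OF finite_vstates \<open>PA 0 \<in> vstates M\<close> closed_vdelta[OF wf] this]
  obtain M' where M': "wf_tm M'"
    "\<And>x T y. vhalts M T y (PA 0, input_tape x # replicate (4 + ntapes M - 1) blank_tape) \<Longrightarrow> tm_outputs_within M' x T y"
    by auto
  have rep: "replicate (4 + ntapes M - 1) blank_tape = blank_tape # blank_tape # blank_tape # blank_tape # blank_tapes M"
    using K by (cases "ntapes M") (auto simp: numeral_eq_Suc)
  let ?P = "[:21, 6:] + smult 2 pf"
  have "tm_outputs_within M' s (poly ?P (length s)) [parse g (PA 0) [] [] s]" for s
  proof (rule M'(2))
    have o: "tm_outputs_within M z (poly pf (length s)) (g z)" if "False \<in> set z" "length z \<le> length s" for z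
      using out[OF that(1)] poly_nat_mono[OF that(2), of pf] unfolding tm_outputs_within_def by (meson order_trans)
    have "vhalts M (length s + 2 * length s + (2 * poly pf (length s) + 2 * length s + length s + 21)) [parse g (PA 0) [] [] s]
      (PA 0, bits_tape s 0 # blank_tape # blank_tape # blank_tape # blank_tape # blank_tapes M)"
      using halts_parse[OF wf o, where N = "length s" and cs = "[]" and S = s and pre = "[]" and s = s and q = "PA 0" and x = "[]"] by (simp add: blank_tape_tp)
    then show "vhalts M (poly ?P (length s)) [parse g (PA 0) [] [] s] (PA 0, input_tape s # replicate (4 + ntapes M - 1) blank_tape)"
      unfolding rep input_tape_tp by (rule halts_with_mono) simp
  qed
  then show ?thesis unfolding PTIME_def polytime_computable_def mem_Collect_eq using M'(1) by blast
qed

section \<open>List coloring instances from CNF formulas\<close>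

lemma listset_iff: "xs \<in> listset As \<longleftrightarrow> length xs = length As \<and> (\<forall>i<length As. xs ! i \<in> As ! i)"
proof (induction As arbitrary: xs)
  case (Cons A As)
  then show ?case
    by (cases xs) (auto simp: set_Cons_def nth_Cons less_Suc_eq_0_disj split: nat.splits)
qed simp

lemma card_listset: "\<forall>A\<in>set As. finite A \<Longrightarrow> finite (listset As) \<and> card (listset As) = prod_list (map card As)"
proof (induction As)
  case (Cons A As)
  have "set_Cons A (listset As) = (\<lambda>(x, xs). x # xs) ` (A \<times> listset As)" by (auto simp: set_Cons_def)
  moreover have "inj_on (\<lambda>(x, xs). x # xs) (A \<times> listset As)" by (auto simp: inj_on_def)
  ultimately show ?case using Cons by (simp add: card_image card_cartesian_product)
qed simp

lemma prod_list_one_two: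
  assumes "\<forall>i<length ns. ns ! i = (1::nat) \<or> ns ! i = 2"
  shows "prod_list ns = 2 ^ card {i. i < length ns \<and> ns ! i = 2}"
  using assms
proof (induction ns)
  case (Cons n ns)
  have e: "{i. i < length (n # ns) \<and> (n # ns) ! i = 2} =
      (if n = 2 then {0} else {}) \<union> Suc ` {i. i < length ns \<and> ns ! i = 2}"
  proof (rule set_eqI)
    fix x show "x \<in> {i. i < length (n # ns) \<and> (n # ns) ! i = 2} \<longleftrightarrow>
      x \<in> (if n = 2 then {0} else {}) \<union> Suc ` {i. i < length ns \<and> ns ! i = 2}"
      by (cases x) auto
  qed
  have "card {i. i < length (n # ns) \<and> (n # ns) ! i = 2} = (if n = 2 then 1 else 0) + card {i. i < length ns \<and> ns ! i = 2}"
    unfolding e by (subst card_Un_disjoint) (auto simp: card_image)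
  moreover have "n = 1 \<or> n = 2" "\<forall>i<length ns. ns ! i = 1 \<or> ns ! i = 2" using Cons.prems by force+
  ultimately show ?case using Cons.IH by auto
qed simp

text \<open>The box has \<open>2 ^ k\<close> tuples, so exactly one of them, \<open>d\<close>, is
  missing from \<open>R\<close>. Inside the box, membership in \<open>R\<close> thus says that some
  position carries the other color \<open>e\<close>. Outside \<open>I\<close> the two coincide, and
  \<open>rk\<close> matches the positions in \<open>I\<close> with the \<open>k\<close> literals of
  a clause.\<close>

lemma OR_definableE:
  assumes "OR_definable q r R k"
  obtains I d e rk where "I \<subseteq> {..<r}" "bij_betw rk I {..<k}"
    "\<And>i. i < r \<Longrightarrow> d i \<in> {1..q} \<and> e i \<in> {1..q}"
    "\<And>i. i \<in> I \<Longrightarrow> d i \<noteq> e i" "\<And>i. i \<notin> I \<Longrightarrow> d i = e i"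
    "\<And>t. length t = r \<Longrightarrow> (\<And>i. i < r \<Longrightarrow> t ! i \<in> {d i, e i}) \<Longrightarrow> t \<in> R \<longleftrightarrow> t \<noteq> map d [0..<r]"
proof -
  obtain Ds where D: "length Ds = r" "\<forall>D\<in>set Ds. D \<subseteq> {1..q}" "card {i. i < r \<and> card (Ds ! i) = 2} = k"
    "\<forall>i<r. card (Ds ! i) \<noteq> 2 \<longrightarrow> card (Ds ! i) = 1" "card (listset Ds \<inter> R) = 2 ^ k - 1"
    using assms by (auto simp: OR_definable_def)
  define I where "I = {i. i < r \<and> card (Ds ! i) = 2}"
  have finD: "\<forall>D\<in>set Ds. finite D" using D(2) finite_subset by blast
  have "prod_list (map card Ds) = 2 ^ card {i. i < length (map card Ds) \<and> map card Ds ! i = 2}"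
    by (rule prod_list_one_two) (use D(1,4) in auto)
  also have "{i. i < length (map card Ds) \<and> map card Ds ! i = 2} = I" using D(1) by (auto simp: I_def)
  finally have c: "card (listset Ds) = 2 ^ k" "finite (listset Ds)"
    using card_listset[OF finD] D(3) by (auto simp: I_def)
  have "card (listset Ds - R) = 1"
    using card_Diff_subset_Int[of "listset Ds" R] c D(5) by simp
  then obtain t0 where t0: "listset Ds - R = {t0}" by (meson card_1_singletonE)
  define d where "d i = t0 ! i" for i
  have t0': "length t0 = r" "\<And>i. i < r \<Longrightarrow> t0 ! i \<in> Ds ! i" using t0 listset_iff[of t0 Ds] D(1) by auto
  have tm: "t0 = map d [0..<r]" using t0'(1) by (intro nth_equalityI) (auto simp: d_def)
  have ex: "\<exists>e. i < r \<longrightarrow> Ds ! i = {t0 ! i, e} \<and> (i \<in> I \<longrightarrow> e \<noteq> t0 ! i) \<and> (i \<notin> I \<longrightarrow> e = t0 ! i)" for i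
  proof (cases "i < r")
    case True
    show ?thesis
    proof (cases "i \<in> I")
      case T: True
      then have "card (Ds ! i) = 2" by (simp add: I_def)
      then show ?thesis using t0'(2)[OF True] T by (auto simp: card_2_iff)
    next
      case F: False
      then have "card (Ds ! i) = 1" using D(4) True by (auto simp: I_def)
      then show ?thesis using t0'(2)[OF True] F by (auto simp: card_1_singleton_iff)
    qed
  qed auto
  then obtain e0 where e0: "\<And>i. i < r \<Longrightarrow> Ds ! i = {t0 ! i, e0 i} \<and> (i \<in> I \<longrightarrow> e0 i \<noteq> t0 ! i) \<and> (i \<notin> I \<longrightarrow> e0 i = t0 ! i)"
    by metis
  define e where "e i = (if i \<in> I then e0 i else d i)" for i
  have De: "Ds ! i = {d i, e i}" if "i < r" for i using e0[OF that] by (auto simp: e_def d_def)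
  have "finite I" "card I = k" using D(3) by (auto simp: I_def)
  then obtain rk where rk: "bij_betw rk I {..<k}" using ex_bij_betw_finite_nat[of I] by (auto simp: atLeast0LessThan)
  show thesis
  proof (rule that[of I rk d e])
    show "I \<subseteq> {..<r}" by (auto simp: I_def)
    show "bij_betw rk I {..<k}" by (rule rk)
    show "d i \<in> {1..q} \<and> e i \<in> {1..q}" if "i < r" for i
    proof -
      have "Ds ! i \<subseteq> {1..q}" using D(1,2) that nth_mem by blast
      then show ?thesis using De[OF that] by auto
    qed
    show "d i \<noteq> e i" if "i \<in> I" for i using that e0[of i] by (auto simp: e_def d_def I_def)
    show "d i = e i" if "i \<notin> I" for i using that by (auto simp: e_def)
    show "t \<in> R \<longleftrightarrow> t \<noteq> map d [0..<r]" if "length t = r" "\<And>i. i < r \<Longrightarrow> t ! i \<in> {d i, e i}" for t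
    proof -
      have "t \<in> listset Ds" using that De D(1) by (auto simp: listset_iff)
      then show ?thesis using t0 tm by blast
    qed
  qed
qed

section \<open>Clauses as coloring constraints\<close>

type_synonym 'v clause = "('v \<times> bool) list"

definition sat :: "('v \<Rightarrow> bool) \<Rightarrow> 'v clause set \<Rightarrow> bool" where
  "sat \<sigma> Cs \<longleftrightarrow> (\<forall>c\<in>Cs. \<exists>l\<in>set c. \<sigma> (fst l) = snd l)"

text \<open>\<open>LV v b i\<close> is the literal \<open>v = b\<close> at position \<open>i\<close>
  of a constraint, true if colored \<open>e i\<close> and false if colored \<open>d i\<close>. Each
  position has its own pair of colors, hence its own copies of all literals. \<open>GV v i j\<close>
  is a gadget that keeps opposite literals from both being true.\<close>

datatype 'v vertex = LV 'v bool nat | GV 'v nat nat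

definition vertices :: "nat \<Rightarrow> 'v set \<Rightarrow> 'v vertex set" where
  "vertices r V = (\<lambda>(v, b, i). LV v b i) ` (V \<times> UNIV \<times> {..<r}) \<union> (\<lambda>(v, i, j). GV v i j) ` (V \<times> {..<r} \<times> {..<r})"

lemma vertices_iff:
  "LV v b i \<in> vertices r V \<longleftrightarrow> v \<in> V \<and> i < r" "GV v i j \<in> vertices r V \<longleftrightarrow> v \<in> V \<and> i < r \<and> j < r"
  by (auto simp: vertices_def image_iff)

lemma finite_vertices: "finite V \<Longrightarrow> finite (vertices r V)"
  by (simp add: vertices_def)

lemma card_vertices_le:
  assumes "finite V"
  shows "card (vertices r V) \<le> card V * (2 * r + r * r)"
proof -
  have "card (vertices r V) \<le> card (V \<times> (UNIV :: bool set) \<times> {..<r}) + card (V \<times> {..<r} \<times> {..<r})"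
    unfolding vertices_def using assms
    by (intro order_trans[OF card_Un_le] add_mono card_image_le) auto
  then show ?thesis by (simp add: card_cartesian_product algebra_simps)
qed

context
  fixes q r k :: nat and R :: "nat list set" and I :: "nat set" and d e rk :: "nat \<Rightarrow> nat"
  assumes I: "I \<subseteq> {..<r}" and rk: "bij_betw rk I {..<k}"
    and de: "\<And>i. i < r \<Longrightarrow> d i \<in> {1..q} \<and> e i \<in> {1..q}"
    and ne: "\<And>i. i \<in> I \<Longrightarrow> d i \<noteq> e i" and eq: "\<And>i. i \<notin> I \<Longrightarrow> d i = e i"
    and R: "\<And>t. length t = r \<Longrightarrow> (\<And>i. i < r \<Longrightarrow> t ! i \<in> {d i, e i}) \<Longrightarrow> t \<in> R \<longleftrightarrow> t \<noteq> map d [0..<r]"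
    and k: "k \<ge> 1"
begin

text \<open>Opposite literals at positions \<open>i\<close> and \<open>j\<close> must not be colored
  \<open>e i\<close> and \<open>e j\<close> at once. If these colors agree, an edge forbids it;
  otherwise the gadget vertex with list \<open>{e i, e j}\<close>, adjacent to both, would have no
  color left. Both literals may be false, which does no harm.\<close>

definition sat_edges :: "'v set \<Rightarrow> 'v vertex set set" where
  "sat_edges V = {{LV v True i, LV v False j} | v i j. v \<in> V \<and> i \<in> I \<and> j \<in> I \<and> e i = e j} \<union>
     {{LV v True i, GV v i j} | v i j. v \<in> V \<and> i \<in> I \<and> j \<in> I \<and> e i \<noteq> e j} \<union>
     {{LV v False j, GV v i j} | v i j. v \<in> V \<and> i \<in> I \<and> j \<in> I \<and> e i \<noteq> e j}"

fun sat_lists :: "'v vertex \<Rightarrow> nat set" where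
  "sat_lists (LV v b i) = {d i, e i}"
| "sat_lists (GV v i j) = {e i, e j}"

text \<open>
  Position \<open>i\<close> of a constraint carries the literal of rank \<open>rk i\<close> in the clause. At the positions
  outside \<open>I\<close> the list is a singleton, so any vertex of the right position will do.
\<close>
definition lit_at :: "'v clause \<Rightarrow> nat \<Rightarrow> 'v \<times> bool" where
  "lit_at c i = c ! (if i \<in> I then rk i else 0)"

definition clause_tuple :: "'v clause \<Rightarrow> 'v vertex list" where
  "clause_tuple c = map (\<lambda>i. LV (fst (lit_at c i)) (snd (lit_at c i)) i) [0..<r]"

text \<open>\<open>rk\<close> maps \<open>I\<close> onto the positions of a clause, so every literal
  can be read off the tuple.\<close>

lemma clause_tuple_inj:
  assumes "length c = k" "length c' = k" "clause_tuple c = clause_tuple c'"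
  shows "c = c'"
proof (rule nth_equalityI)
  show "length c = length c'" using assms by simp
  fix j assume "j < length c"
  then have "j \<in> rk ` I" using rk assms(1) by (simp add: bij_betw_def)
  then obtain i where i: "i \<in> I" "rk i = j" by blast
  have "clause_tuple c ! i = clause_tuple c' ! i" using assms(3) by simp
  then show "c ! j = c' ! j" using i I by (auto simp: clause_tuple_def lit_at_def prod_eq_iff)
qed

lemma clause_tuple_tuples:
  assumes "length c = k" "fst ` set c \<subseteq> V"
  shows "clause_tuple c \<in> tuples (vertices r V) r"
proof -
  have "lit_at c i \<in> set c" if "i < r" for i
  proof -
    have "(if i \<in> I then rk i else 0) < k" using rk k by (auto simp: bij_betw_def)
    then show ?thesis using assms(1) by (simp add: lit_at_def)
  qed
  then show ?thesis using assms(2) by (force simp: tuples_def clause_tuple_def vertices_iff)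
qed

lemma sat_instance:
  assumes "finite V" "\<And>c. c \<in> Cs \<Longrightarrow> length c = k \<and> fst ` set c \<subseteq> V"
  shows "RCLC_instance q r (vertices r V) (sat_edges V) sat_lists (clause_tuple ` Cs)"
  unfolding RCLC_instance_def simple_graph_def
proof (intro conjI ballI)
  show "finite (vertices r V)" using assms(1) by (rule finite_vertices)
  show "h \<subseteq> vertices r V" "card h = 2" if "h \<in> sat_edges V" for h
    using that I by (auto simp: sat_edges_def vertices_iff card_insert_if)
  show "sat_lists v \<subseteq> {1..q}" if "v \<in> vertices r V" for v
    using that de by (cases v) (auto simp: vertices_iff)
  show "clause_tuple ` Cs \<subseteq> tuples (vertices r V) r" using assms(2) clause_tuple_tuples by blast
qed

lemma sat_solvable_iff:
  assumes "finite V" and Cs: "\<And>c. c \<in> Cs \<Longrightarrow> length c = k \<and> fst ` set c \<subseteq> V"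
  shows "RCLC_solvable q R (vertices r V) (sat_edges V) sat_lists (clause_tuple ` Cs) \<longleftrightarrow> (\<exists>\<sigma>. sat \<sigma> Cs)"
proof
  assume "RCLC_solvable q R (vertices r V) (sat_edges V) sat_lists (clause_tuple ` Cs)"
  then obtain c where c: "proper_coloring (vertices r V) (sat_edges V) q c"
    "\<And>v. v \<in> vertices r V \<Longrightarrow> c v \<in> sat_lists v" "\<And>xs. xs \<in> clause_tuple ` Cs \<Longrightarrow> map c xs \<in> R"
    by (auto simp: RCLC_solvable_def)
  have pc: "c u \<noteq> c v" if "{u, v} \<in> sat_edges V" for u v using c(1) that by (auto simp: proper_coloring_def)
  \<comment> \<open>A variable is true if some copy of its positive literal is; \<open>excl\<close>
    then makes every true copy of a negative literal correct.\<close>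
  define \<sigma> where "\<sigma> v \<longleftrightarrow> (\<exists>i\<in>I. c (LV v True i) = e i)" for v
  have excl: "\<not> (c (LV v True i) = e i \<and> c (LV v False j) = e j)" if "v \<in> V" "i \<in> I" "j \<in> I" for v i j
  proof (cases "e i = e j")
    case True
    then have "{LV v True i, LV v False j} \<in> sat_edges V" using that by (auto simp: sat_edges_def)
    then show ?thesis using pc True by fastforce
  next
    case False
    then have "{LV v True i, GV v i j} \<in> sat_edges V" "{LV v False j, GV v i j} \<in> sat_edges V"
      using that by (auto simp: sat_edges_def)
    moreover have "c (GV v i j) \<in> {e i, e j}" using c(2)[of "GV v i j"] that I by (auto simp: vertices_iff)
    ultimately show ?thesis using pc by fastforce
  qed
  have "sat \<sigma> Cs" unfolding sat_def
  proof
    fix cl assume cl: "cl \<in> Cs"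
    have tu: "clause_tuple cl \<in> tuples (vertices r V) r" using clause_tuple_tuples Cs[OF cl] by blast
    let ?t = "map c (clause_tuple cl)"
    have n: "?t ! i = c (LV (fst (lit_at cl i)) (snd (lit_at cl i)) i)" if "i < r" for i
      using that by (simp add: clause_tuple_def)
    have "?t \<in> R" using c(3) cl by blast
    moreover have m: "?t ! i \<in> {d i, e i}" if "i < r" for i
    proof -
      have "clause_tuple cl ! i \<in> vertices r V" using tu that by (auto simp: tuples_def)
      then show ?thesis using c(2)[of "clause_tuple cl ! i"] that by (auto simp: clause_tuple_def)
    qed
    moreover have l: "length ?t = r" by (simp add: clause_tuple_def)
    ultimately have "?t \<noteq> map d [0..<r]" using R[of ?t] by blast
    then obtain i where i: "i < r" "?t ! i \<noteq> d i" using l by (metis add.left_neutral diff_zero length_map length_upt nth_equalityI nth_map_upt)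
    then have ii: "i \<in> I" "?t ! i = e i" using m[of i] eq[of i] by auto
    have "rk i < k" using ii(1) rk by (auto simp: bij_betw_def)
    then have li: "lit_at cl i \<in> set cl" using ii(1) Cs[OF cl] by (simp add: lit_at_def)
    obtain v b where vb: "lit_at cl i = (v, b)" by (cases "lit_at cl i")
    have v: "v \<in> V" using li vb Cs[OF cl] by force
    have col: "c (LV v b i) = e i" using n[OF i(1)] ii(2) vb by simp
    have "\<sigma> v = b"
    proof (cases b)
      case True then show ?thesis using col ii(1) by (auto simp: \<sigma>_def)
    next
      case False then show ?thesis using col excl[OF v _ ii(1)] by (auto simp: \<sigma>_def)
    qed
    then show "\<exists>l\<in>set cl. \<sigma> (fst l) = snd l" using li vb by force
  qed
  then show "\<exists>\<sigma>. sat \<sigma> Cs" by blast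
next
  assume "\<exists>\<sigma>. sat \<sigma> Cs"
  then obtain \<sigma> where \<sigma>: "sat \<sigma> Cs" by blast
  define c where "c u = (case u of LV v b i \<Rightarrow> (if \<sigma> v = b then e i else d i) | GV v i j \<Rightarrow> (if \<sigma> v then e j else e i))" for u
  have "map c (clause_tuple cl) \<in> R" if cl: "cl \<in> Cs" for cl
  proof -
    let ?t = "map c (clause_tuple cl)"
    have n: "?t ! i = c (LV (fst (lit_at cl i)) (snd (lit_at cl i)) i)" if "i < r" for i
      using that by (simp add: clause_tuple_def)
    obtain l where l: "l \<in> set cl" "\<sigma> (fst l) = snd l" using \<sigma> cl by (auto simp: sat_def)
    obtain j where j: "j < k" "cl ! j = l" using l(1) Cs[OF cl] by (auto simp: in_set_conv_nth)
    have "j \<in> rk ` I" using rk j by (simp add: bij_betw_def)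
    then obtain i where i: "i \<in> I" "rk i = j" by blast
    have "?t ! i = e i" using n[of i] i j l(2) I by (auto simp: c_def lit_at_def)
    then have "?t \<noteq> map d [0..<r]" using ne[OF i(1)] i(1) I by (metis add.left_neutral diff_zero lessThan_iff nth_map_upt subsetD)
    moreover have "length ?t = r" by (simp add: clause_tuple_def)
    moreover have "?t ! i \<in> {d i, e i}" if "i < r" for i using n[OF that] by (auto simp: c_def)
    ultimately show ?thesis using R[of ?t] by blast
  qed
  moreover have "c v \<in> sat_lists v" for v by (cases v) (auto simp: c_def)
  moreover have "proper_coloring (vertices r V) (sat_edges V) q c"
    unfolding proper_coloring_def
  proof (intro conjI ballI allI impI)
    show "c v \<in> {1..q}" if "v \<in> vertices r V" for v
      using that de by (cases v) (auto simp: c_def vertices_iff)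
    show "c u \<noteq> c v" if "{u, v} \<in> sat_edges V" for u v
      using that ne unfolding sat_edges_def by (auto simp: c_def doubleton_eq_iff) metis+
  qed
  ultimately show "RCLC_solvable q R (vertices r V) (sat_edges V) sat_lists (clause_tuple ` Cs)"
    unfolding RCLC_solvable_def by blast
qed

end

section \<open>Numbering the vertices and encoding instances\<close>

abbreviation edge_bits :: "nat \<Rightarrow> nat set set \<Rightarrow> bool list" where
  "edge_bits n E \<equiv> map (\<lambda>(u, v). {u, v} \<in> E) (List.product [0..<n] [0..<n])"

abbreviation list_bits :: "nat \<Rightarrow> nat \<Rightarrow> (nat \<Rightarrow> nat set) \<Rightarrow> bool list" where
  "list_bits q n L \<equiv> map (\<lambda>(v, a). a \<in> L v) (List.product [0..<n] [1..<q + 1])"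

abbreviation tuple_list :: "nat \<Rightarrow> nat \<Rightarrow> nat list list" where
  "tuple_list r n \<equiv> product_lists (replicate r [0..<n])"

lemma RCLC_transport:
  assumes bij: "bij_betw \<pi> V W" and inst: "RCLC_instance q r V E L F"
  shows "RCLC_instance q r W ((`) \<pi> ` E) (L \<circ> inv_into V \<pi>) (map \<pi> ` F)"
    and "RCLC_solvable q R W ((`) \<pi> ` E) (L \<circ> inv_into V \<pi>) (map \<pi> ` F) \<longleftrightarrow> RCLC_solvable q R V E L F"
proof -
  let ?inv = "inv_into V \<pi>"
  have img: "\<pi> ` V = W" and inj: "inj_on \<pi> V" using bij by (auto simp: bij_betw_def)
  have iv: "?inv (\<pi> v) = v" if "v \<in> V" for v using that inj by simp
  have E: "h \<subseteq> V" "card h = 2" if "h \<in> E" for h using inst that by (auto simp: RCLC_instance_def simple_graph_def)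
  have F: "set xs \<subseteq> V" "length xs = r" if "xs \<in> F" for xs using inst that by (auto simp: RCLC_instance_def tuples_def)
  have mF: "map ?inv (map \<pi> xs) = xs" if "xs \<in> F" for xs
    using F(1)[OF that] iv by (auto intro!: map_idI)
  show "RCLC_instance q r W ((`) \<pi> ` E) (L \<circ> inv_into V \<pi>) (map \<pi> ` F)"
    unfolding RCLC_instance_def simple_graph_def
  proof (intro conjI ballI)
    show "finite W" using inst img by (auto simp: RCLC_instance_def simple_graph_def)
    show "h \<subseteq> W" "card h = 2" if "h \<in> (`) \<pi> ` E" for h
      using that E img inj by (auto simp: card_image inj_on_subset)
    show "(L \<circ> ?inv) v \<subseteq> {1..q}" if "v \<in> W" for v
      using that img iv inst by (auto simp: RCLC_instance_def)
    show "map \<pi> ` F \<subseteq> tuples W r" using F img by (fastforce simp: tuples_def)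
  qed
  show "RCLC_solvable q R W ((`) \<pi> ` E) (L \<circ> ?inv) (map \<pi> ` F) \<longleftrightarrow> RCLC_solvable q R V E L F"
  proof
    assume "RCLC_solvable q R W ((`) \<pi> ` E) (L \<circ> ?inv) (map \<pi> ` F)"
    then obtain c where c: "proper_coloring W ((`) \<pi> ` E) q c" "\<forall>v\<in>W. c v \<in> (L \<circ> ?inv) v" "\<forall>xs\<in>map \<pi> ` F. map c xs \<in> R"
      by (auto simp: RCLC_solvable_def)
    have "proper_coloring V E q (c \<circ> \<pi>)"
      unfolding proper_coloring_def
    proof (intro conjI ballI allI impI)
      show "(c \<circ> \<pi>) v \<in> {1..q}" if "v \<in> V" for v using c(1) that img by (auto simp: proper_coloring_def)
      show "(c \<circ> \<pi>) u \<noteq> (c \<circ> \<pi>) v" if "{u, v} \<in> E" for u v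
      proof -
        have "{\<pi> u, \<pi> v} \<in> (`) \<pi> ` E" using that by (metis image_empty image_insert image_eqI)
        then show ?thesis using c(1) by (auto simp: proper_coloring_def)
      qed
    qed
    moreover have "\<forall>v\<in>V. (c \<circ> \<pi>) v \<in> L v" using c(2) img iv by force
    ultimately show "RCLC_solvable q R V E L F"
      unfolding RCLC_solvable_def using c(3) by (intro exI[of _ "c \<circ> \<pi>"]) auto
  next
    assume "RCLC_solvable q R V E L F"
    then obtain c where c: "proper_coloring V E q c" "\<forall>v\<in>V. c v \<in> L v" "\<forall>xs\<in>F. map c xs \<in> R"
      by (auto simp: RCLC_solvable_def)
    have "proper_coloring W ((`) \<pi> ` E) q (c \<circ> ?inv)"
      unfolding proper_coloring_def
    proof (intro conjI ballI allI impI)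
      show "(c \<circ> ?inv) v \<in> {1..q}" if "v \<in> W" for v
        using c(1) that img iv by (auto simp: proper_coloring_def)
      show "(c \<circ> ?inv) u \<noteq> (c \<circ> ?inv) v" if "{u, v} \<in> (`) \<pi> ` E" for u v
      proof -
        from that obtain h where h: "{u, v} = \<pi> ` h" "h \<in> E" by (rule imageE)
        have "{?inv u, ?inv v} = ?inv ` (\<pi> ` h)" using h(1) by (metis image_empty image_insert)
        also have "\<dots> = h" using E(1)[OF h(2)] inj by (simp add: inv_into_image_cancel)
        finally show ?thesis using c(1) h(2) by (auto simp: proper_coloring_def)
      qed
    qed
    moreover have "\<forall>v\<in>W. (c \<circ> ?inv) v \<in> (L \<circ> ?inv) v" using c(2) img iv by force
    moreover have "\<forall>xs\<in>map \<pi> ` F. map (c \<circ> ?inv) xs \<in> R"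
    proof
      fix ys assume "ys \<in> map \<pi> ` F"
      then obtain xs where xs: "xs \<in> F" "ys = map \<pi> xs" by blast
      have "map (c \<circ> ?inv) ys = map c (map ?inv (map \<pi> xs))" unfolding xs(2) by simp
      then show "map (c \<circ> ?inv) ys \<in> R" unfolding mF[OF xs(1)] using c(3) xs(1) by simp
    qed
    ultimately show "RCLC_solvable q R W ((`) \<pi> ` E) (L \<circ> ?inv) (map \<pi> ` F)"
      unfolding RCLC_solvable_def by blast
  qed
qed

text \<open>The graph and the lists depend on \<open>V\<close> only; the clauses enter through the
  constraints alone. As \<open>\<tau>\<close> is injective, adding a clause amounts to switching one
  bit of the encoded instance.\<close>

lemma cnf_to_RCLC:
  fixes V :: "'v set"
  assumes "OR_definable q r R k" "k \<ge> 1" "finite V"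
  obtains n E L and \<tau> :: "'v clause \<Rightarrow> nat list" where "n \<le> card V * (2 * r + r * r)"
    "inj_on \<tau> {c. length c = k \<and> fst ` set c \<subseteq> V}"
    "\<And>Cs. Cs \<subseteq> {c. length c = k \<and> fst ` set c \<subseteq> V} \<Longrightarrow> RCLC_instance q r {0..<n} E L (\<tau> ` Cs) \<and>
       (RCLC_solvable q R {0..<n} E L (\<tau> ` Cs) \<longleftrightarrow> (\<exists>\<sigma>. sat \<sigma> Cs))"
proof -
  from assms(1) obtain I d e rk where or: "I \<subseteq> {..<r}" "bij_betw rk I {..<k}"
    "\<And>i. i < r \<Longrightarrow> d i \<in> {1..q} \<and> e i \<in> {1..q}"
    "\<And>i. i \<in> I \<Longrightarrow> d i \<noteq> e i" "\<And>i. i \<notin> I \<Longrightarrow> d i = e i"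
    "\<And>t. length t = r \<Longrightarrow> (\<And>i. i < r \<Longrightarrow> t ! i \<in> {d i, e i}) \<Longrightarrow> t \<in> R \<longleftrightarrow> t \<noteq> map d [0..<r]"
    by (rule OR_definableE) blast
  let ?U = "vertices r V" and ?C = "{c :: 'v clause. length c = k \<and> fst ` set c \<subseteq> V}"
  let ?tu = "clause_tuple r I rk :: 'v clause \<Rightarrow> 'v vertex list"
  define n where "n = card ?U"
  obtain \<pi> where \<pi>: "bij_betw \<pi> ?U {0..<n}"
    using ex_bij_betw_finite_nat[OF finite_vertices[OF assms(3)]] unfolding n_def by blast
  define E where "E = (`) \<pi> ` sat_edges I e V"
  define L where "L = sat_lists d e \<circ> inv_into ?U \<pi>"
  define \<tau> where "\<tau> = map \<pi> \<circ> ?tu"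
  have tt: "?tu c \<in> tuples ?U r" if "c \<in> ?C" for c
    using clause_tuple_tuples[OF or assms(2)] that by blast
  have "inj_on \<tau> ?C"
  proof (rule inj_onI)
    fix c c' assume h: "c \<in> ?C" "c' \<in> ?C" "\<tau> c = \<tau> c'"
    have "?tu c = ?tu c'"
      using h(3) tt[OF h(1)] tt[OF h(2)] \<pi>
      by (auto simp: \<tau>_def bij_betw_def tuples_def intro!: map_inj_on[of \<pi>] elim!: inj_on_subset)
    then show "c = c'" using clause_tuple_inj[OF or assms(2), of c c'] h by auto
  qed
  moreover have "RCLC_instance q r {0..<n} E L (\<tau> ` Cs) \<and>
       (RCLC_solvable q R {0..<n} E L (\<tau> ` Cs) \<longleftrightarrow> (\<exists>\<sigma>. sat \<sigma> Cs))" if "Cs \<subseteq> ?C" for Cs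
  proof -
    have C: "\<And>c. c \<in> Cs \<Longrightarrow> length c = k \<and> fst ` set c \<subseteq> V" using that by blast
    note i = sat_instance[OF or assms(2,3) C]
    have "\<tau> ` Cs = map \<pi> ` ?tu ` Cs" by (auto simp: \<tau>_def)
    then show ?thesis unfolding E_def L_def
      using RCLC_transport(1)[OF \<pi> i] RCLC_transport(2)[OF \<pi> i, where R = R] sat_solvable_iff[OF or assms(2,3) C] by simp
  qed
  moreover have "n \<le> card V * (2 * r + r * r)" unfolding n_def by (rule card_vertices_le[OF assms(3)])
  ultimately show thesis using that by blast
qed

lemma set_product_lists_replicate: "set (tuple_list r n) = tuples {0..<n} r"
proof -
  have "list_all2 (\<lambda>x ys. x \<in> set ys) xs (replicate r [0..<n]) \<longleftrightarrow> length xs = r \<and> set xs \<subseteq> {0..<n}" for xs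
    by (auto simp: list_all2_conv_all_nth subset_eq all_set_conv_all_nth)
  then show ?thesis by (auto simp: product_lists_set tuples_def)
qed

text \<open>\<open>RCLC\<close> asks for some instance with this encoding, so the encoding has to
  determine the answer. It fixes \<open>E\<close>, \<open>F\<close>, and \<open>L\<close> on the
  vertices, which is all that solvability sees.\<close>

lemma enc_RCLC_mem_iff:
  assumes "RCLC_instance q r {0..<n} E L F"
  shows "(enc_RCLC q r n E L F, n) \<in> RCLC q r R \<longleftrightarrow> RCLC_solvable q R {0..<n} E L F"
proof
  assume "RCLC_solvable q R {0..<n} E L F"
  then show "(enc_RCLC q r n E L F, n) \<in> RCLC q r R" using assms unfolding RCLC_def by blast
next
  assume "(enc_RCLC q r n E L F, n) \<in> RCLC q r R"
  then obtain E' L' F' where h: "enc_RCLC q r n E L F = enc_RCLC q r n E' L' F'"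
    "RCLC_instance q r {0..<n} E' L' F'" "RCLC_solvable q R {0..<n} E' L' F'"
    unfolding RCLC_def by blast
  have 1: "edge_bits n E = edge_bits n E'"
    "list_bits q n L = list_bits q n L'"
    "map (\<lambda>xs. xs \<in> F) (tuple_list r n) = map (\<lambda>xs. xs \<in> F') (tuple_list r n)"
    using h(1) unfolding enc_RCLC_def by simp_all
  have E: "e \<in> E \<longleftrightarrow> e \<in> E'" for e
  proof (cases "\<exists>u v. e = {u, v} \<and> u < n \<and> v < n")
    case True
    then show ?thesis using 1(1) by (force simp: map_eq_conv)
  next
    case False
    have "e \<notin> D" if "simple_graph {0..<n} D" for D
      using False that by (auto simp: simple_graph_def card_2_iff) (metis atLeastLessThan_iff insert_subset)
    then show ?thesis using assms h(2) by (auto simp: RCLC_instance_def)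
  qed
  have F: "F = F'"
    using 1(3) assms h(2) unfolding RCLC_instance_def map_eq_conv set_product_lists_replicate by blast
  have L: "L v = L' v" if "v < n" for v
  proof -
    have "L v \<subseteq> {1..q}" "L' v \<subseteq> {1..q}" using assms h(2) that by (auto simp: RCLC_instance_def)
    moreover have "a \<in> L v \<longleftrightarrow> a \<in> L' v" if "a \<in> {1..q}" for a
    proof -
      have "(v, a) \<in> set (List.product [0..<n] [1..<q + 1])" using \<open>v < n\<close> that by auto
      then show ?thesis using 1(2)[unfolded map_eq_conv] by blast
    qed
    ultimately show ?thesis by blast
  qed
  have "E = E'" using E by blast
  then show "RCLC_solvable q R {0..<n} E L F" using h(3) F L by (auto simp: RCLC_solvable_def)
qed

section \<open>Computation tableaux\<close>

definition poly_bounded :: "(nat \<Rightarrow> nat) \<Rightarrow> bool" where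
  "poly_bounded f \<longleftrightarrow> (\<exists>p :: nat poly. \<forall>m. f m \<le> poly p m)"

lemma poly_bounded_const: "poly_bounded (\<lambda>m. c)"
  unfolding poly_bounded_def by (rule exI[of _ "[:c:]"]) simp

lemma poly_bounded_id: "poly_bounded (\<lambda>m. m)"
  unfolding poly_bounded_def by (rule exI[of _ "[:0, 1:]"]) simp

lemma poly_bounded_add: "poly_bounded f \<Longrightarrow> poly_bounded g \<Longrightarrow> poly_bounded (\<lambda>m. f m + g m)"
  unfolding poly_bounded_def by (metis add_mono poly_add)

lemma poly_bounded_mult: "poly_bounded f \<Longrightarrow> poly_bounded g \<Longrightarrow> poly_bounded (\<lambda>m. f m * g m)"
  unfolding poly_bounded_def by (metis mult_le_mono poly_mult)

lemma poly_bounded_power: "poly_bounded f \<Longrightarrow> poly_bounded (\<lambda>m. f m ^ n)"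
  by (induction n) (auto intro: poly_bounded_const poly_bounded_mult)

lemma poly_bounded_sum: "(\<And>i. i \<in> S \<Longrightarrow> poly_bounded (f i)) \<Longrightarrow> finite S \<Longrightarrow> poly_bounded (\<lambda>m. \<Sum>i\<in>S. f i m)"
  by (induction S rule: infinite_finite_induct) (auto intro: poly_bounded_const poly_bounded_add)

lemma poly_bounded_poly: "poly_bounded f \<Longrightarrow> poly_bounded (\<lambda>m. poly p (f m))"
  unfolding poly_bounded_def by (metis poly_nat_mono poly_pcompose)

lemmas poly_bounded_intros = poly_bounded_const poly_bounded_id poly_bounded_add poly_bounded_mult
  poly_bounded_power poly_bounded_sum poly_bounded_poly

section \<open>Cells of a paired input and locality of one step\<close>

lemma length_str_pair: "length (str_pair x w) = 2 * length x + 1 + length w"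
  by (induction x) (auto simp: str_pair_def)

lemma str_pair_nth:
  "j < length x \<Longrightarrow> str_pair x w ! (2 * j) = True"
  "j < length x \<Longrightarrow> str_pair x w ! (2 * j + 1) = x ! j"
  "str_pair x w ! (2 * length x) = False"
  "i < length w \<Longrightarrow> str_pair x w ! (2 * length x + 1 + i) = w ! i"
proof -
  have c: "length (concat (map (\<lambda>b. [True, b]) x)) = 2 * length x" for x by (induction x) auto
  have "j < length x \<Longrightarrow> concat (map (\<lambda>b. [True, b]) x) ! (2 * j) = True \<and> concat (map (\<lambda>b. [True, b]) x) ! (2 * j + 1) = x ! j" for j
  proof (induction x arbitrary: j)
    case (Cons a x) then show ?case by (cases j) auto
  qed simp
  then show "j < length x \<Longrightarrow> str_pair x w ! (2 * j) = True" "j < length x \<Longrightarrow> str_pair x w ! (2 * j + 1) = x ! j"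
    by (auto simp: str_pair_def nth_append c)
  show "str_pair x w ! (2 * length x) = False" "i < length w \<Longrightarrow> str_pair x w ! (2 * length x + 1 + i) = w ! i"
    by (auto simp: str_pair_def nth_append c)
qed

definition heads :: "config \<Rightarrow> nat \<Rightarrow> int" where
  "heads c i = snd (snd c ! i)"

definition cell :: "config \<Rightarrow> nat \<Rightarrow> int \<Rightarrow> nat" where
  "cell c i p = fst (snd c ! i) p"

lemma read_tape_eq: "read_tape t = fst t (snd t)"
  by (cases t) simp

lemma act_tape_eq: "act_tape a t = ((fst t)(snd t := fst a), shift (snd a) (snd t))"
  by (cases a, cases t) simp

text \<open>On a halted configuration every tape rewrites its scanned symbol and stays, which gives
  \<open>step\<close> one description in all cases.\<close>

definition local_action :: "tm \<Rightarrow> config \<Rightarrow> nat \<times> (nat \<times> dir) list" where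
  "local_action M c = (case delta M (fst c) (map (\<lambda>i. cell c i (heads c i)) [0..<ntapes M]) of
     None \<Rightarrow> (fst c, map (\<lambda>i. (cell c i (heads c i), Go_stay)) [0..<ntapes M]) | Some a \<Rightarrow> a)"

lemma step_local_action:
  assumes "wf_tm M" "tm_cfg M c"
  shows "fst (step M c) = fst (local_action M c)"
    "i < ntapes M \<Longrightarrow> heads (step M c) i = shift (snd (snd (local_action M c) ! i)) (heads c i)"
    "i < ntapes M \<Longrightarrow> cell (step M c) i p = (if p = heads c i then fst (snd (local_action M c) ! i) else cell c i p)"
proof -
  have l: "length (snd c) = ntapes M" using assms(2) by (simp add: cfg_ok_def)
  have r: "map read_tape (snd c) = map (\<lambda>i. cell c i (heads c i)) [0..<ntapes M]"
    by (rule nth_equalityI) (auto simp: l cell_def heads_def read_tape_eq)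
  have "fst (step M c) = fst (local_action M c) \<and> (i < ntapes M \<longrightarrow>
      heads (step M c) i = shift (snd (snd (local_action M c) ! i)) (heads c i) \<and>
      cell (step M c) i p = (if p = heads c i then fst (snd (local_action M c) ! i) else cell c i p))"
  proof (cases "delta M (fst c) (map read_tape (snd c))")
    case None
    then show ?thesis by (auto simp: step_def next_action_def r local_action_def cell_def heads_def)
  next
    case (Some a)
    obtain s' acts where a: "a = (s', acts)" by (cases a)
    have "fst c \<in> {..<nstates M}" using assms(2) by (simp add: cfg_ok_def)
    then have "length acts = ntapes M"
      using wf_tm_closed[OF assms(1), unfolded closed_delta_def, rule_format, OF _ cfg_ok_read[OF assms(2)] Some[unfolded a]] by auto
    then show ?thesis using l Some a
      by (auto simp: step_def next_action_def r local_action_def cell_def heads_def act_tape_eq)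
  qed
  then show "fst (step M c) = fst (local_action M c)"
    "i < ntapes M \<Longrightarrow> heads (step M c) i = shift (snd (snd (local_action M c) ! i)) (heads c i)"
    "i < ntapes M \<Longrightarrow> cell (step M c) i p = (if p = heads c i then fst (snd (local_action M c) ! i) else cell c i p)"
    by auto
qed

text \<open>The action is a function of the state and the scanned symbols, so with the head
  positions \<open>2 * ntapes M + 1\<close> facts decide a step. This is the origin of the clause
  width in \<open>tableau\<close>.\<close>

lemma step_local:
  assumes "wf_tm M" "tm_cfg M c" "tm_cfg M c'"
    and "fst c = fst c'" "\<And>i. i < ntapes M \<Longrightarrow> heads c i = heads c' i \<and> cell c i (heads c i) = cell c' i (heads c i)"
  shows "fst (step M c) = fst (step M c')"
    "i < ntapes M \<Longrightarrow> heads (step M c) i = heads (step M c') i"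
    "i < ntapes M \<Longrightarrow> cell (step M c) i (heads c i) = cell (step M c') i (heads c i)"
proof -
  have "heads c i = heads c' i" "cell c i (heads c' i) = cell c' i (heads c' i)" if "i < ntapes M" for i
    using assms(5)[OF that] by auto
  then have "map (\<lambda>i. cell c i (heads c i)) [0..<ntapes M] = map (\<lambda>i. cell c' i (heads c' i)) [0..<ntapes M]"
    "map (\<lambda>i. (cell c i (heads c i), Go_stay)) [0..<ntapes M] = map (\<lambda>i. (cell c' i (heads c' i), Go_stay)) [0..<ntapes M]"
    by auto
  then have e: "local_action M c = local_action M c'" unfolding local_action_def assms(4) by (simp only:)
  note 1 = step_local_action[OF assms(1,2)] and 2 = step_local_action[OF assms(1,3)]
  show "fst (step M c) = fst (step M c')" using 1(1) 2(1) e by simp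
  show "i < ntapes M \<Longrightarrow> heads (step M c) i = heads (step M c') i" using 1(2) 2(2) e assms(5) by simp
  show "i < ntapes M \<Longrightarrow> cell (step M c) i (heads c i) = cell (step M c') i (heads c i)"
    using 1(3) 2(3) e assms(5) by simp
qed

lemma step_frame:
  assumes "wf_tm M" "tm_cfg M c" "i < ntapes M"
  shows "p \<noteq> heads c i \<Longrightarrow> cell (step M c) i p = cell c i p" "\<bar>heads (step M c) i\<bar> \<le> \<bar>heads c i\<bar> + 1"
proof -
  note 1 = step_local_action[OF assms(1,2)]
  show "p \<noteq> heads c i \<Longrightarrow> cell (step M c) i p = cell c i p" using 1(3)[OF assms(3)] by simp
  show "\<bar>heads (step M c) i\<bar> \<le> \<bar>heads c i\<bar> + 1" using 1(2)[OF assms(3)] by (cases "snd (snd (local_action M c) ! i)") auto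
qed

section \<open>Variables and clauses of the tableau\<close>

datatype tvar = Yv nat | Qv nat nat | Hv nat nat int | Cv nat nat int nat

definition tab_vars :: "tm \<Rightarrow> nat \<Rightarrow> nat \<Rightarrow> tvar set" where
  "tab_vars M m T = Yv ` {..<m} \<union> (\<lambda>(t, s). Qv t s) ` ({..T} \<times> {..<nstates M}) \<union>
     (\<lambda>(t, i, c). Hv t i c) ` ({..T} \<times> {..<ntapes M} \<times> {- int T - 1..int T + 1}) \<union>
     (\<lambda>(t, i, c, a). Cv t i c a) ` ({..T} \<times> {..<ntapes M} \<times> {- int T - 1..int T + 1} \<times> {..<nsyms M})"

lemma tab_vars_iff:
  "Yv j \<in> tab_vars M m T \<longleftrightarrow> j < m"
  "Qv t s \<in> tab_vars M m T \<longleftrightarrow> t \<le> T \<and> s < nstates M"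
  "Hv t i c \<in> tab_vars M m T \<longleftrightarrow> t \<le> T \<and> i < ntapes M \<and> \<bar>c\<bar> \<le> int T + 1"
  "Cv t i c a \<in> tab_vars M m T \<longleftrightarrow> t \<le> T \<and> i < ntapes M \<and> \<bar>c\<bar> \<le> int T + 1 \<and> a < nsyms M"
  by (auto simp: tab_vars_def image_iff)

lemma finite_tab_vars: "finite (tab_vars M m T)"
  by (simp add: tab_vars_def)

abbreviation tab_size :: "tm \<Rightarrow> nat \<Rightarrow> nat \<Rightarrow> nat" where
  "tab_size M m T \<equiv> m + (T + 1) * nstates M + (T + 1) * (ntapes M * (2 * T + 3)) +
     (T + 1) * (ntapes M * ((2 * T + 3) * nsyms M))"

lemma card_tab_vars:
  "card (tab_vars M m T) \<le> tab_size M m T"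
proof -
  have i: "card {- int T - 1..int T + 1} = 2 * T + 3" by simp
  have "card (tab_vars M m T) \<le> card {..<m} + card ({..T} \<times> {..<nstates M}) +
      card ({..T} \<times> {..<ntapes M} \<times> {- int T - 1..int T + 1}) +
      card ({..T} \<times> {..<ntapes M} \<times> {- int T - 1..int T + 1} \<times> {..<nsyms M})"
    unfolding tab_vars_def by (intro order_trans[OF card_Un_le] add_mono card_image_le) auto
  then show ?thesis unfolding card_cartesian_product i by simp
qed

context
  fixes M :: tm and m pl T :: nat and B :: "bool list set"
  assumes wf: "wf_tm M"
    and T: "T \<ge> 2 * m + 2 + pl"
    and dec: "\<And>x. length x \<le> 2 * m + 1 + pl \<Longrightarrow> tm_outputs_within M x T [x \<in> B]"
begin

definition run_cfg :: "bool list \<Rightarrow> bool list \<Rightarrow> nat \<Rightarrow> config" where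
  "run_cfg x w t = (step M ^^ t) (init_config M (str_pair x w))"

fun history :: "bool list \<Rightarrow> bool list \<Rightarrow> tvar \<Rightarrow> bool" where
  "history x w (Yv j) \<longleftrightarrow> x ! j"
| "history x w (Qv t s) \<longleftrightarrow> fst (run_cfg x w t) = s"
| "history x w (Hv t i c) \<longleftrightarrow> heads (run_cfg x w t) i = c"
| "history x w (Cv t i c a) \<longleftrightarrow> cell (run_cfg x w t) i c = a"

definition accepted :: "(bool list \<times> bool list) set" where
  "accepted = {(x, w). length x = m \<and> length w \<le> pl \<and> str_pair x w \<in> B}"

text \<open>
  All clauses of bounded width that hold in every accepting history. The tableau constraints are
  among them, and the histories satisfy them by definition.
\<close>
definition tableau :: "tvar clause set" where
  "tableau = {c. set c \<subseteq> tab_vars M m T \<times> UNIV \<and> length c \<le> 2 * ntapes M + 3 \<and>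
     (\<forall>(x, w) \<in> accepted. \<exists>l\<in>set c. history x w (fst l) = snd l)}"

lemma tapes_pos: "ntapes M > 0"
  using wf by (simp add: wf_tm_def)

lemma run_cfg_ok: "tm_cfg M (run_cfg x w t)"
proof -
  have "tm_cfg M (init_config M (str_pair x w))"
    unfolding init_config_def by (rule cfg_ok_init) (use wf in \<open>auto simp: wf_tm_def\<close>)
  then show ?thesis unfolding run_cfg_def step_eq_tstep
    by (rule cfg_ok_tsteps[OF wf_tm_closed[OF wf]])
qed

lemma run_cfg_Suc: "run_cfg x w (Suc t) = step M (run_cfg x w t)"
  by (simp add: run_cfg_def)

lemma run_cfg_bounds:
  "fst (run_cfg x w t) < nstates M"
  "i < ntapes M \<Longrightarrow> cell (run_cfg x w t) i c < nsyms M"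
  "i < ntapes M \<Longrightarrow> \<bar>heads (run_cfg x w t) i\<bar> \<le> int t"
proof -
  show "fst (run_cfg x w t) < nstates M" "i < ntapes M \<Longrightarrow> cell (run_cfg x w t) i c < nsyms M"
    using run_cfg_ok[of x w t] by (auto simp: cfg_ok_def cell_def)
  show "i < ntapes M \<Longrightarrow> \<bar>heads (run_cfg x w t) i\<bar> \<le> int t"
  proof (induction t)
    case 0
    then show ?case by (cases i) (auto simp: run_cfg_def init_config_def heads_def input_tape_def blank_tape_def)
  next
    case (Suc t)
    then show ?case using step_frame(2)[OF wf run_cfg_ok Suc.prems, of x w t] by (simp add: run_cfg_Suc)
  qed
qed

lemma initial_cell:
  "i < ntapes M \<Longrightarrow> cell (run_cfg x w 0) i c =
    (if i = 0 \<and> 0 \<le> c \<and> c < int (2 * length x + 1 + length w) then bit_sym (str_pair x w ! nat c) else 0)"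
  by (cases i) (auto simp: run_cfg_def init_config_def cell_def input_tape_def blank_tape_def length_str_pair)

text \<open>A halted configuration is a fixed point of \<open>step\<close>, so the output bit is
  still in cell 0 at time \<open>T\<close>.\<close>

lemma final_cell:
  assumes "length x = m" "length w \<le> pl"
  shows "cell (run_cfg x w T) 0 0 = bit_sym (str_pair x w \<in> B)"
proof -
  let ?c = "init_config M (str_pair x w)"
  obtain t where t: "t \<le> T" "halted M ((step M ^^ t) ?c)" "has_output ((step M ^^ t) ?c) [str_pair x w \<in> B]"
    using dec[of "str_pair x w"] assms by (auto simp: length_str_pair tm_outputs_within_def)
  have "(step M ^^ (n + t)) ?c = (step M ^^ t) ?c" for n
    using t(2) by (induction n) (auto simp: step_def halted_def)
  from this[of "T - t"] have e: "run_cfg x w T = (step M ^^ t) ?c" using t(1) by (simp add: run_cfg_def)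
  have "snd (run_cfg x w T) \<noteq> []" using run_cfg_ok[of x w T] tapes_pos by (auto simp: cfg_ok_def)
  then show ?thesis using t(3) e by (simp add: has_output_def cell_def hd_conv_nth)
qed

lemma tableau_clause:
  assumes "sat \<sigma> tableau" "set c \<subseteq> tab_vars M m T \<times> UNIV" "length c \<le> 2 * ntapes M + 3"
    "\<And>x w. length x = m \<Longrightarrow> length w \<le> pl \<Longrightarrow> str_pair x w \<in> B \<Longrightarrow> \<exists>l\<in>set c. history x w (fst l) = snd l"
  shows "\<exists>l\<in>set c. \<sigma> (fst l) = snd l"
proof -
  have "c \<in> tableau" using assms(2-4) by (auto simp: tableau_def accepted_def)
  then show ?thesis using assms(1) by (auto simp: sat_def)
qed

lemma tableau_imp:
  assumes "sat \<sigma> tableau" "set ps \<subseteq> tab_vars M m T" "v \<in> tab_vars M m T" "length ps \<le> 2 * ntapes M + 2"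
    "\<And>x w. length x = m \<Longrightarrow> length w \<le> pl \<Longrightarrow> str_pair x w \<in> B \<Longrightarrow> \<forall>u\<in>set ps. history x w u \<Longrightarrow> history x w v"
    "\<forall>u\<in>set ps. \<sigma> u"
  shows "\<sigma> v"
proof -
  have "\<exists>l\<in>set (map (\<lambda>u. (u, False)) ps @ [(v, True)]). \<sigma> (fst l) = snd l"
    by (rule tableau_clause[OF assms(1)]) (use assms in auto)
  then show ?thesis using assms(6) by auto
qed

text \<open>Short valid clauses suffice because each local rule of the machine is one of them. A
  satisfying assignment is read as an initial tape, from which \<open>w\<close> is extracted; by
  induction on time it agrees with the true run on \<open>x\<close> and \<open>w\<close>. That cell
  0 finally holds a 2 is also valid, which forces acceptance.\<close>

lemma tableau_sound:
  assumes s: "sat \<sigma> tableau" and x: "length x = m" and Y: "\<And>j. j < m \<Longrightarrow> \<sigma> (Yv j) = x ! j"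
  shows "\<exists>w. length w \<le> pl \<and> str_pair x w \<in> B"
proof -
  have K: "0 < ntapes M" by (rule tapes_pos)
  have syms: "0 < nsyms M" "1 < nsyms M" "2 < nsyms M" and sts: "0 < nstates M" using wf by (auto simp: wf_tm_def)
  let ?w0 = "int (2 * m + 1)"
  \<comment> \<open>This cell lies behind every admissible \<open>w\<close>, so \<open>len\<close>,
    the first blank counted from the start of \<open>w\<close>, exists and is at most
    \<open>pl\<close>.\<close>
  have blank_end: "\<sigma> (Cv 0 0 (?w0 + int pl) 0)"
    by (rule tableau_imp[OF s, of "[]"]) (use T K syms in \<open>auto simp: tab_vars_iff initial_cell\<close>)
  define len where "len = (LEAST i. \<sigma> (Cv 0 0 (?w0 + int i) 0))"
  have len: "\<sigma> (Cv 0 0 (?w0 + int len) 0)" "len \<le> pl" "\<And>i. i < len \<Longrightarrow> \<not> \<sigma> (Cv 0 0 (?w0 + int i) 0)"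
    unfolding len_def using LeastI[of "\<lambda>i. \<sigma> (Cv 0 0 (?w0 + int i) 0)", OF blank_end]
      Least_le[of "\<lambda>i. \<sigma> (Cv 0 0 (?w0 + int i) 0)", OF blank_end] not_less_Least by blast+
  define w where "w = map (\<lambda>i. \<sigma> (Cv 0 0 (?w0 + int i) 2)) [0..<len]"
  have lw: "length w = len" by (simp add: w_def)
  have cellw: "cell (run_cfg x' w' 0) 0 (?w0 + int i) = (if i < length w' then bit_sym (w' ! i) else 0)"
    if "length x' = m" for x' w' i
  proof -
    have "nat (?w0 + int i) = 2 * length x' + 1 + i" using that by simp
    then show ?thesis using that str_pair_nth(4)[of i w' x'] K by (simp add: initial_cell)
  qed
  have init: "\<sigma> (Cv 0 i c (cell (run_cfg x w 0) i c))" if i: "i < ntapes M" and c: "\<bar>c\<bar> \<le> int T" for i c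
  proof -
    consider "i \<noteq> 0 \<or> c < 0" | j where "i = 0" "j < m" "c = int (2 * j)" | j where "i = 0" "j < m" "c = int (2 * j + 1)"
      | "i = 0" "c = int (2 * m)" | l where "i = 0" "c = ?w0 + int l"
    proof -
      have "\<exists>l. c = ?w0 + int l" if "c > int (2 * m)" using that by (intro exI[of _ "nat (c - ?w0)"]) auto
      moreover have "(\<exists>j<m. c = int (2 * j)) \<or> (\<exists>j<m. c = int (2 * j + 1))" if "0 \<le> c" "c < int (2 * m)"
      proof (cases "even c")
        case True then show ?thesis using that by (intro disjI1 exI[of _ "nat (c div 2)"]) auto
      next
        case False then show ?thesis using that by (intro disjI2 exI[of _ "nat (c div 2)"]) (auto elim!: oddE)
      qed
      ultimately show thesis using that by (metis linorder_neqE_linordered_idom not_less)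
    qed
    then show ?thesis
    proof cases
      case 1
      then have e: "cell (run_cfg x' w' 0) i c = 0" for x' w' using i by (auto simp: initial_cell)
      show ?thesis unfolding e
        by (rule tableau_imp[OF s, of "[]"]) (use i c syms e in \<open>auto simp: tab_vars_iff\<close>)
    next
      case (2 j)
      have e: "cell (run_cfg x' w' 0) i c = 2" if "length x' = m" for x' w'
      proof -
        have "nat c = 2 * j" using 2 by simp
        then show ?thesis using 2 that K str_pair_nth(1)[of j x' w'] by (simp add: initial_cell bit_sym_def)
      qed
      show ?thesis unfolding e[OF x]
        by (rule tableau_imp[OF s, of "[]"]) (use i c syms e in \<open>auto simp: tab_vars_iff\<close>)
    next
      case (3 j)
      have e: "cell (run_cfg x' w' 0) i c = bit_sym (x' ! j)" if "length x' = m" for x' w'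
      proof -
        have "nat c = 2 * j + 1" using 3 by simp
        then show ?thesis using 3 that K str_pair_nth(2)[of j x' w'] by (simp add: initial_cell)
      qed
      have "\<exists>l\<in>set [(Yv j, \<not> x ! j), (Cv 0 i c (bit_sym (x ! j)), True)]. \<sigma> (fst l) = snd l"
        by (rule tableau_clause[OF s]) (use i c syms e 3 in \<open>auto simp: tab_vars_iff bit_sym_def\<close>)
      then show ?thesis using Y[OF 3(2)] unfolding e[OF x] by auto
    next
      case 4
      have e: "cell (run_cfg x' w' 0) i c = 1" if "length x' = m" for x' w'
      proof -
        have "nat c = 2 * m" using 4 by simp
        then show ?thesis using 4 that K str_pair_nth(3)[of x' w'] by (simp add: initial_cell bit_sym_def)
      qed
      show ?thesis unfolding e[OF x]
        by (rule tableau_imp[OF s, of "[]"]) (use i c syms e in \<open>auto simp: tab_vars_iff\<close>)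
    next
      case (5 l)
      have e: "cell (run_cfg x' w' 0) i c = (if l < length w' then bit_sym (w' ! l) else 0)" if "length x' = m" for x' w'
        using cellw[OF that] 5 by simp
      have lT: "\<bar>?w0 + int l\<bar> \<le> int T" using c 5 by simp
      show ?thesis
      proof (cases "l < len")
        case True
        \<comment> \<open>In this region every history has a blank, a 1 or a 2, so a nonblank cell
          carries exactly the bit that \<open>w\<close> reads off the variable for 2.\<close>
        have "\<exists>l'\<in>set [(Cv 0 0 (?w0 + int l) 0, True), (Cv 0 0 (?w0 + int l) 1, True), (Cv 0 0 (?w0 + int l) 2, True)]. \<sigma> (fst l') = snd l'"
          by (rule tableau_clause[OF s]) (use K lT syms cellw in \<open>auto simp: tab_vars_iff bit_sym_def\<close>)
        then have "\<sigma> (Cv 0 0 (?w0 + int l) (bit_sym (w ! l)))"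
          using len(3)[OF True] True by (auto simp: w_def bit_sym_def)
        then show ?thesis unfolding e[OF x] using True lw 5 by simp
      next
        case False
        \<comment> \<open>Behind a blank there are only blanks, and this implication between
          neighboring cells is a valid clause.\<close>
        have "\<sigma> (Cv 0 0 (?w0 + int l) 0)" if "len \<le> l" "\<bar>?w0 + int l\<bar> \<le> int T" for l
          using that
        proof (induction l rule: dec_induct)
          case base show ?case by (rule len(1))
        next
          case (step n)
          show ?case
            by (rule tableau_imp[OF s, of "[Cv 0 0 (?w0 + int n) 0]"])
              (use K step syms cellw in \<open>auto simp: tab_vars_iff bit_sym_def split: if_splits simp del: of_nat_Suc of_nat_add of_nat_mult\<close>)
        qed
        then show ?thesis unfolding e[OF x] using False lw 5 lT by simp
      qed
    qed
  qed
  \<comment> \<open>The clause that preserves the content of a cell exempts the scanned one; for it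
    to take effect, \<open>\<sigma>\<close> must not place a second head there.\<close>
  have uniqH: "\<not> \<sigma> (Hv t i c)" if "\<sigma> (Hv t i c')" "c \<noteq> c'" "t \<le> T" "i < ntapes M" "\<bar>c\<bar> \<le> int T + 1" "\<bar>c'\<bar> \<le> int T + 1" for t i c c'
  proof -
    have "\<exists>l\<in>set [(Hv t i c, False), (Hv t i c', False)]. \<sigma> (fst l) = snd l"
      by (rule tableau_clause[OF s]) (use that in \<open>auto simp: tab_vars_iff\<close>)
    then show ?thesis using that by auto
  qed
  have inv: "\<sigma> (Qv t (fst (run_cfg x w t))) \<and> (\<forall>i<ntapes M. \<sigma> (Hv t i (heads (run_cfg x w t) i))) \<and>
     (\<forall>i<ntapes M. \<forall>c. \<bar>c\<bar> \<le> int T \<longrightarrow> \<sigma> (Cv t i c (cell (run_cfg x w t) i c)))" if "t \<le> T" for t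
    using that
  proof (induction t)
    case 0
    have q0: "fst (run_cfg x' w' 0) = 0" for x' w' by (simp add: run_cfg_def init_config_def)
    have h0: "heads (run_cfg x' w' 0) i = 0" if "i < ntapes M" for x' w' i
      using run_cfg_bounds(3)[OF that, of x' w' 0] by simp
    have "\<sigma> (Qv 0 0)" by (rule tableau_imp[OF s, of "[]"]) (use q0 sts in \<open>auto simp: tab_vars_iff\<close>)
    moreover have "\<sigma> (Hv 0 i 0)" if "i < ntapes M" for i
      by (rule tableau_imp[OF s, of "[]"]) (use h0 that in \<open>auto simp: tab_vars_iff\<close>)
    ultimately show ?case using q0 h0 init by simp
  next
    case (Suc t)
    let ?c = "run_cfg x w t" and ?K = "ntapes M"
    have IH: "\<sigma> (Qv t (fst ?c))" "\<And>i. i < ?K \<Longrightarrow> \<sigma> (Hv t i (heads ?c i))"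
      "\<And>i c. i < ?K \<Longrightarrow> \<bar>c\<bar> \<le> int T \<Longrightarrow> \<sigma> (Cv t i c (cell ?c i c))" using Suc by auto
    have hb: "\<bar>heads ?c i\<bar> \<le> int T" if "i < ?K" for i using run_cfg_bounds(3)[OF that, of x w t] Suc.prems by linarith
    \<comment> \<open>By \<open>step_local\<close>, these \<open>2 * ntapes M + 1\<close> facts
      determine everything that changes in this step, so each consequence is a single
      clause.\<close>
    let ?ps = "Qv t (fst ?c) # map (\<lambda>i. Hv t i (heads ?c i)) [0..<?K] @ map (\<lambda>i. Cv t i (heads ?c i) (cell ?c i (heads ?c i))) [0..<?K]"
    have ps: "set ?ps \<subseteq> tab_vars M m T" "\<forall>u\<in>set ?ps. \<sigma> u"
      using IH hb Suc.prems run_cfg_bounds(1)[of x w t] run_cfg_bounds(2)[where x = x and w = w and t = t]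
      by (force simp: tab_vars_iff)+
    have loc: "fst (run_cfg x' w' (Suc t)) = fst (run_cfg x w (Suc t))"
      "i < ?K \<Longrightarrow> heads (run_cfg x' w' (Suc t)) i = heads (run_cfg x w (Suc t)) i"
      "i < ?K \<Longrightarrow> cell (run_cfg x' w' (Suc t)) i (heads ?c i) = cell (run_cfg x w (Suc t)) i (heads ?c i)"
      if h: "\<forall>u\<in>set ?ps. history x' w' u" for x' w' i
    proof -
      have "history x' w' (Qv t (fst ?c))" by (rule h[rule_format]) simp
      moreover have "history x' w' (Hv t i (heads ?c i))" "history x' w' (Cv t i (heads ?c i) (cell ?c i (heads ?c i)))"
        if "i < ?K" for i by (rule h[rule_format], use that in simp)+
      ultimately have "fst ?c = fst (run_cfg x' w' t)"
        "\<And>i. i < ?K \<Longrightarrow> heads ?c i = heads (run_cfg x' w' t) i \<and> cell ?c i (heads ?c i) = cell (run_cfg x' w' t) i (heads ?c i)"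
        by simp_all
      note l = step_local[OF wf run_cfg_ok run_cfg_ok this]
      show "fst (run_cfg x' w' (Suc t)) = fst (run_cfg x w (Suc t))"
        "i < ?K \<Longrightarrow> heads (run_cfg x' w' (Suc t)) i = heads (run_cfg x w (Suc t)) i"
        "i < ?K \<Longrightarrow> cell (run_cfg x' w' (Suc t)) i (heads ?c i) = cell (run_cfg x w (Suc t)) i (heads ?c i)"
        unfolding run_cfg_Suc using l by auto
    qed
    have "\<sigma> (Qv (Suc t) (fst (run_cfg x w (Suc t))))"
      by (rule tableau_imp[OF s ps(1) _ _ _ ps(2)]) (use Suc.prems loc(1) run_cfg_bounds(1) in \<open>auto simp: tab_vars_iff\<close>)
    moreover have "\<sigma> (Hv (Suc t) i (heads (run_cfg x w (Suc t)) i))" if "i < ?K" for i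
    proof (rule tableau_imp[OF s ps(1) _ _ _ ps(2)])
      show "Hv (Suc t) i (heads (run_cfg x w (Suc t)) i) \<in> tab_vars M m T"
        using run_cfg_bounds(3)[OF that, of x w "Suc t"] Suc.prems that by (simp add: tab_vars_iff)
      show "history x' w' (Hv (Suc t) i (heads (run_cfg x w (Suc t)) i))" if "\<forall>u\<in>set ?ps. history x' w' u" for x' w'
        using loc(2)[OF that \<open>i < ?K\<close>] by simp
    qed simp
    moreover have "\<sigma> (Cv (Suc t) i c (cell (run_cfg x w (Suc t)) i c))" if i: "i < ?K" and c: "\<bar>c\<bar> \<le> int T" for i c
    proof (cases "c = heads ?c i")
      case True
      show ?thesis
      proof (rule tableau_imp[OF s ps(1) _ _ _ ps(2)])
        show "Cv (Suc t) i c (cell (run_cfg x w (Suc t)) i c) \<in> tab_vars M m T"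
          using run_cfg_bounds(2)[OF i] Suc.prems i c by (simp add: tab_vars_iff)
        show "history x' w' (Cv (Suc t) i c (cell (run_cfg x w (Suc t)) i c))" if "\<forall>u\<in>set ?ps. history x' w' u" for x' w'
          using loc(3)[OF that \<open>i < ?K\<close>] True by simp
      qed simp
    next
      case False
      let ?a = "cell ?c i c"
      have e: "cell (run_cfg x w (Suc t)) i c = ?a" unfolding run_cfg_Suc using step_frame(1)[OF wf run_cfg_ok i False] .
      have "\<exists>l\<in>set [(Hv t i c, True), (Cv t i c ?a, False), (Cv (Suc t) i c ?a, True)]. \<sigma> (fst l) = snd l"
      proof (rule tableau_clause[OF s])
        show "set [(Hv t i c, True), (Cv t i c ?a, False), (Cv (Suc t) i c ?a, True)] \<subseteq> tab_vars M m T \<times> UNIV"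
          using Suc.prems i c run_cfg_bounds(2)[OF i] by (auto simp: tab_vars_iff)
        show "\<exists>l\<in>set [(Hv t i c, True), (Cv t i c ?a, False), (Cv (Suc t) i c ?a, True)]. history x' w' (fst l) = snd l" for x' w'
          using step_frame(1)[OF wf run_cfg_ok i, of c x' w' t]
          by (cases "c = heads (run_cfg x' w' t) i") (auto simp: run_cfg_Suc)
      qed (use K in simp)
      moreover have "\<not> \<sigma> (Hv t i c)" by (rule uniqH[OF IH(2)[OF i] False]) (use Suc.prems i c hb[OF i] in auto)
      ultimately show ?thesis unfolding e using IH(3)[OF i c] by auto
    qed
    ultimately show ?case by blast
  qed
  have "\<sigma> (Cv T 0 0 (cell (run_cfg x w T) 0 0))" using inv[of T] K by simp
  moreover have "\<sigma> (Cv T 0 0 2)"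
    by (rule tableau_imp[OF s, of "[]"]) (use K syms final_cell in \<open>auto simp: tab_vars_iff bit_sym_def\<close>)
  moreover have "\<exists>l\<in>set [(Cv T 0 0 (cell (run_cfg x w T) 0 0), False), (Cv T 0 0 2, False)]. \<sigma> (fst l) = snd l" if "cell (run_cfg x w T) 0 0 \<noteq> 2"
    by (rule tableau_clause[OF s]) (use that K syms run_cfg_bounds(2) in \<open>auto simp: tab_vars_iff\<close>)
  ultimately have "cell (run_cfg x w T) 0 0 = 2" by auto
  then have "str_pair x w \<in> B" using final_cell[OF x, of w] lw len(2) by (simp add: bit_sym_def split: if_splits)
  then show ?thesis using lw len(2) by auto
qed

lemma tableau_iff:
  assumes "length x = m"
  shows "(\<exists>w. length w \<le> pl \<and> str_pair x w \<in> B) \<longleftrightarrow> (\<exists>\<sigma>. sat \<sigma> tableau \<and> (\<forall>j<m. \<sigma> (Yv j) = x ! j))"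
proof
  assume "\<exists>w. length w \<le> pl \<and> str_pair x w \<in> B"
  then obtain w where "(x, w) \<in> accepted" using assms by (auto simp: accepted_def)
  then have "sat (history x w) tableau" by (auto simp: sat_def tableau_def)
  then show "\<exists>\<sigma>. sat \<sigma> tableau \<and> (\<forall>j<m. \<sigma> (Yv j) = x ! j)" by (intro exI[of _ "history x w"]) simp
qed (use tableau_sound assms in blast)

end

text \<open>The formula may be given by mere validity, since it reaches the verifier as advice; only
  the width \<open>W\<close> and the number of variables have to be controlled.\<close>

lemma NP_tableau:
  assumes "A \<in> NP"
  obtains W and P :: "nat poly" where
    "\<And>m. \<exists>V \<Phi>. finite V \<and> card V \<le> poly P m \<and> (\<forall>j<m. Yv j \<in> V) \<and>
       \<Phi> \<subseteq> {c. set c \<subseteq> V \<times> UNIV \<and> length c \<le> W} \<and>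
       (\<forall>x. length x = m \<longrightarrow> (x \<in> A \<longleftrightarrow> (\<exists>\<sigma>. sat \<sigma> \<Phi> \<and> (\<forall>j<m. \<sigma> (Yv j) = x ! j))))"
proof -
  obtain B p where B: "B \<in> PTIME" "\<And>x. x \<in> A \<longleftrightarrow> (\<exists>w. length w \<le> poly p (length x) \<and> str_pair x w \<in> B)"
    using assms by (auto simp: NP_def)
  obtain M pB where M: "wf_tm M" "\<And>x. tm_outputs_within M x (poly pB (length x)) [x \<in> B]"
    using B(1) by (auto simp: PTIME_def polytime_computable_def)
  \<comment> \<open>The second summand widens the window of cells so that it contains the whole
    input and a blank behind it.\<close>
  define T where "T m = poly pB (2 * m + 1 + poly p m) + (2 * m + 2 + poly p m)" for m
  have "poly_bounded (\<lambda>m. tab_size M m (T m))"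
    unfolding T_def by (intro poly_bounded_intros)
  then obtain P where P: "\<And>m. tab_size M m (T m) \<le> poly P m"
    by (auto simp: poly_bounded_def)
  show thesis
  proof (rule that)
    fix m
    have d: "tm_outputs_within M x (T m) [x \<in> B]" if "length x \<le> 2 * m + 1 + poly p m" for x
      using M(2)[of x] poly_nat_mono[OF that, of pB] unfolding tm_outputs_within_def T_def
      by (meson le_trans trans_le_add1)
    have T2: "2 * m + 2 + poly p m \<le> T m" by (simp add: T_def)
    let ?\<Phi> = "tableau M m (poly p m) (T m) B"
    have "x \<in> A \<longleftrightarrow> (\<exists>\<sigma>. sat \<sigma> ?\<Phi> \<and> (\<forall>j<m. \<sigma> (Yv j) = x ! j))" if "length x = m" for x
      using tableau_iff[OF M(1) T2 d that] B(2)[of x] that by simp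
    moreover have "?\<Phi> \<subseteq> {c. set c \<subseteq> tab_vars M m (T m) \<times> UNIV \<and> length c \<le> 2 * ntapes M + 3}"
      by (auto simp: tableau_def[OF M(1) T2 d])
    moreover have "card (tab_vars M m (T m)) \<le> poly P m" using card_tab_vars P order_trans by blast
    ultimately show "\<exists>V \<Phi>. finite V \<and> card V \<le> poly P m \<and> (\<forall>j<m. Yv j \<in> V) \<and>
       \<Phi> \<subseteq> {c. set c \<subseteq> V \<times> UNIV \<and> length c \<le> 2 * ntapes M + 3} \<and>
       (\<forall>x. length x = m \<longrightarrow> (x \<in> A \<longleftrightarrow> (\<exists>\<sigma>. sat \<sigma> \<Phi> \<and> (\<forall>j<m. \<sigma> (Yv j) = x ! j))))"
      by (intro exI[of _ "tab_vars M m (T m)"] exI[of _ ?\<Phi>]) (simp add: finite_tab_vars tab_vars_iff)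
  qed
qed

section \<open>OR-composition\<close>

lemma sat_Un: "sat \<sigma> (\<Phi> \<union> \<Psi>) \<longleftrightarrow> sat \<sigma> \<Phi> \<and> sat \<sigma> \<Psi>"
  by (simp add: sat_def ball_Un)

section \<open>Splitting clauses to width three\<close>

datatype 'v chained = Orig 'v | Chain "'v clause" nat

text \<open>\<open>Chain c j\<close> stands for: the first \<open>j\<close> literals of
  \<open>c\<close> are false. This is the usual reduction to width 3, with auxiliary variables
  tagged by their clause.\<close>

definition chain_clauses :: "'v clause \<Rightarrow> 'v chained clause set" where
  "chain_clauses c = {[(Chain c 0, True)], [(Chain c (length c), False)]} \<union>
     (\<lambda>j. [(Chain c j, False), (Orig (fst (c ! j)), snd (c ! j)), (Chain c (Suc j), True)]) ` {..<length c}"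

lemma chain_clauses_sound:
  assumes "sat \<rho> (\<Union>c\<in>\<Phi>. chain_clauses c)"
  shows "sat (\<lambda>v. \<rho> (Orig v)) \<Phi>"
  unfolding sat_def
proof (rule ballI, rule ccontr)
  fix c assume c: "c \<in> \<Phi>" and n: "\<not> (\<exists>l\<in>set c. \<rho> (Orig (fst l)) = snd l)"
  have s: "\<exists>l\<in>set d. \<rho> (fst l) = snd l" if "d \<in> chain_clauses c" for d
    using assms c that by (auto simp: sat_def)
  have "\<rho> (Chain c j)" if "j \<le> length c" for j using that
  proof (induction j)
    case 0 show ?case using s[of "[(Chain c 0, True)]"] by (simp add: chain_clauses_def)
  next
    case (Suc j)
    have "[(Chain c j, False), (Orig (fst (c ! j)), snd (c ! j)), (Chain c (Suc j), True)] \<in> chain_clauses c"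
      using Suc.prems by (auto simp: chain_clauses_def)
    from s[OF this] show ?case using Suc n by auto
  qed
  moreover have "\<not> \<rho> (Chain c (length c))"
    using s[of "[(Chain c (length c), False)]"] by (simp add: chain_clauses_def)
  ultimately show False by blast
qed

fun chain_extend :: "('v \<Rightarrow> bool) \<Rightarrow> 'v chained \<Rightarrow> bool" where
  "chain_extend \<sigma> (Orig v) = \<sigma> v"
| "chain_extend \<sigma> (Chain c j) \<longleftrightarrow> (\<forall>i<j. \<sigma> (fst (c ! i)) \<noteq> snd (c ! i))"

lemma chain_clauses_complete:
  assumes "sat \<sigma> \<Phi>"
  shows "sat (chain_extend \<sigma>) (\<Union>c\<in>\<Phi>. chain_clauses c)"
  unfolding sat_def
proof
  fix d assume "d \<in> (\<Union>c\<in>\<Phi>. chain_clauses c)"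
  then obtain c where c: "c \<in> \<Phi>" "d \<in> chain_clauses c" by blast
  have "\<exists>i<length c. \<sigma> (fst (c ! i)) = snd (c ! i)" using assms c(1) unfolding sat_def by (metis in_set_conv_nth)
  then show "\<exists>l\<in>set d. chain_extend \<sigma> (fst l) = snd l" using c(2) by (auto simp: chain_clauses_def less_Suc_eq)
qed

text \<open>Constraints hold exactly \<open>k\<close> literals. Repeating the last one leaves the
  first in place, by which padded clauses are told apart from bit clauses.\<close>

definition pad_clause :: "nat \<Rightarrow> 'v clause \<Rightarrow> 'v clause" where
  "pad_clause k c = c @ replicate (k - length c) (last c)"

lemma set_pad_clause: "c \<noteq> [] \<Longrightarrow> set (pad_clause k c) = set c"
  by (auto simp: pad_clause_def)

lemma length_pad_clause: "length c \<le> k \<Longrightarrow> length (pad_clause k c) = k"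
  by (simp add: pad_clause_def)

definition chain_vars :: "'v clause set \<Rightarrow> 'v chained set" where
  "chain_vars \<Phi> = (\<lambda>(c, j). Chain c j) ` (SIGMA c:\<Phi>. {..length c})"

lemma card_chain_vars:
  assumes "finite \<Phi>" "\<And>c. c \<in> \<Phi> \<Longrightarrow> length c \<le> W"
  shows "finite (chain_vars \<Phi>)" "card (chain_vars \<Phi>) \<le> card \<Phi> * (W + 1)"
proof -
  show "finite (chain_vars \<Phi>)" using assms(1) by (auto simp: chain_vars_def)
  have "card (chain_vars \<Phi>) \<le> card (SIGMA c:\<Phi>. {..length c})"
    unfolding chain_vars_def by (rule card_image_le) (use assms(1) in auto)
  also have "\<dots> = (\<Sum>c\<in>\<Phi>. length c + 1)" using assms(1) by simp
  also have "\<dots> \<le> (\<Sum>c\<in>\<Phi>. W + 1)" using assms(2) by (intro sum_mono) auto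
  finally show "card (chain_vars \<Phi>) \<le> card \<Phi> * (W + 1)" by simp
qed

lemma chain_vars_Un: "chain_vars (\<Phi> \<union> \<Psi>) = chain_vars \<Phi> \<union> chain_vars \<Psi>"
  by (auto simp: chain_vars_def)

section \<open>Selecting one of \<open>p ^ k\<close> strings\<close>

definition selections :: "nat \<Rightarrow> nat \<Rightarrow> nat list set" where
  "selections k p = {f. length f = k \<and> set f \<subseteq> {..<p}}"

lemma finite_selections: "finite (selections k p)" and card_selections: "card (selections k p) = p ^ k"
  using finite_lists_length_eq[of "{..<p}" k] card_lists_length_eq[of "{..<p}" k]
  by (auto simp: selections_def conj_commute)

definition bit_indices :: "nat \<Rightarrow> nat \<Rightarrow> nat \<Rightarrow> (nat list \<times> nat \<times> bool) set" where
  "bit_indices k p m = selections k p \<times> {..<m} \<times> UNIV"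

datatype 'v selvar = Tab 'v | Sel nat nat | SelBit nat bool nat

text \<open>Several values may be chosen for one coordinate: additional choices only activate more
  clauses.\<close>

definition select_some :: "nat \<Rightarrow> nat \<Rightarrow> 'v selvar clause" where
  "select_some p i = map (\<lambda>a. (Sel i a, True)) [0..<p]"

text \<open>One direction of the equivalence is enough, as \<open>SelBit\<close> occurs only
  negatively in \<open>bit_clause\<close>.\<close>

definition select_bit :: "nat \<times> bool \<times> nat \<Rightarrow> tvar selvar clause" where
  "select_bit = (\<lambda>(j, b, a). [(Sel 0 a, False), (Tab (Yv j), \<not> b), (SelBit j b a, True)])"

definition selection_cnf :: "nat \<Rightarrow> nat \<Rightarrow> nat \<Rightarrow> tvar clause set \<Rightarrow> tvar selvar clause set" where
  "selection_cnf k p m \<Phi> = map (map_prod Tab id) ` \<Phi> \<union> select_some p ` {..<k} \<union>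
     select_bit ` ({..<m} \<times> UNIV \<times> {..<p})"

text \<open>
  The width-\<open>k\<close> clauses that carry the instances: \<open>SelBit j b a\<close> stands for "the first coordinate of the
  selection is \<open>a\<close> and bit \<open>j\<close> of the selected string is \<open>b\<close>", so the clause below says that the
  string with index \<open>f\<close> does not have bit \<open>j\<close> equal to \<open>b\<close>.
\<close>
definition bit_clause :: "nat \<Rightarrow> nat list \<times> nat \<times> bool \<Rightarrow> tvar selvar chained clause" where
  "bit_clause k = (\<lambda>(f, j, b). (Orig (SelBit j b (f ! 0)), False) # map (\<lambda>i. (Orig (Sel i (f ! i)), False)) [1..<k])"

lemma bit_clause_inj: "k \<ge> 1 \<Longrightarrow> inj_on (bit_clause k) (bit_indices k p m)"
proof (rule inj_onI)
  fix u u'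
  assume k: "k \<ge> 1" and h': "u \<in> bit_indices k p m" "u' \<in> bit_indices k p m" "bit_clause k u = bit_clause k u'"
  obtain f j b f' j' b' where u: "u = (f, j, b)" "u' = (f', j', b')" by (metis prod_cases3)
  note h = h'[unfolded u]
  have "f ! i = f' ! i" if "i < k" for i
    using h(3) that by (cases "i = 0") (auto simp: bit_clause_def)
  then have "f = f'" using h by (intro nth_equalityI) (auto simp: bit_indices_def selections_def)
  then show "u = u'" using h(3) unfolding u by (auto simp: bit_clause_def)
qed

definition selection_base_vars :: "nat \<Rightarrow> nat \<Rightarrow> nat \<Rightarrow> tvar set \<Rightarrow> tvar selvar set" where
  "selection_base_vars k p m V = Tab ` V \<union> (\<lambda>(i, a). Sel i a) ` ({..<k} \<times> {..<p}) \<union>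
     (\<lambda>(j, b, a). SelBit j b a) ` ({..<m} \<times> UNIV \<times> {..<p})"

lemma selection_base_vars_iff:
  "Tab v \<in> selection_base_vars k p m V \<longleftrightarrow> v \<in> V"
  "Sel i a \<in> selection_base_vars k p m V \<longleftrightarrow> i < k \<and> a < p"
  "SelBit j b a \<in> selection_base_vars k p m V \<longleftrightarrow> j < m \<and> a < p"
  by (auto simp: selection_base_vars_def image_iff)

text \<open>\<open>G\<close> lists forbidden triples of index, position and bit. If it forbids the
  complement of each bit of the string at index \<open>f\<close>, choosing \<open>f\<close> forces
  the guessed member of \<open>A\<close> to be that string, and the right-hand side becomes the OR
  of the memberships.\<close>

lemma selection_cnf_sat_iff:
  assumes k: "k \<ge> 1" and p: "p \<ge> 1" and G: "G \<subseteq> bit_indices k p m"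
    and tab: "\<And>x. length x = m \<Longrightarrow> x \<in> A \<longleftrightarrow> (\<exists>\<sigma>. sat \<sigma> \<Phi> \<and> (\<forall>j<m. \<sigma> (Yv j) = x ! j))"
  shows "(\<exists>\<rho>. sat \<rho> ((\<Union>c\<in>selection_cnf k p m \<Phi>. chain_clauses c) \<union> bit_clause k ` G)) \<longleftrightarrow>
    (\<exists>f\<in>selections k p. \<exists>x\<in>A. length x = m \<and> (\<forall>j<m. (f, j, x ! j) \<notin> G))"
proof
  assume "\<exists>\<rho>. sat \<rho> ((\<Union>c\<in>selection_cnf k p m \<Phi>. chain_clauses c) \<union> bit_clause k ` G)"
  then obtain \<rho> where \<rho>: "sat \<rho> (\<Union>c\<in>selection_cnf k p m \<Phi>. chain_clauses c)" "sat \<rho> (bit_clause k ` G)"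
    unfolding sat_Un by blast
  define \<sigma> where "\<sigma> = (\<lambda>v. \<rho> (Orig v))"
  have \<sigma>: "\<exists>l\<in>set c. \<sigma> (fst l) = snd l" if "c \<in> selection_cnf k p m \<Phi>" for c
    using chain_clauses_sound[OF \<rho>(1)] that unfolding \<sigma>_def sat_def by blast
  define x where "x = map (\<lambda>j. \<sigma> (Tab (Yv j))) [0..<m]"
  have "sat (\<lambda>v. \<sigma> (Tab v)) \<Phi>"
    unfolding sat_def
  proof
    fix c assume "c \<in> \<Phi>"
    then have "map (map_prod Tab id) c \<in> selection_cnf k p m \<Phi>" by (auto simp: selection_cnf_def)
    from \<sigma>[OF this] show "\<exists>l\<in>set c. \<sigma> (Tab (fst l)) = snd l" by auto
  qed
  then have xA: "x \<in> A" using tab[of x] by (auto simp: x_def)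
  have "\<exists>a<p. \<sigma> (Sel i a)" if "i < k" for i
  proof -
    have "select_some p i \<in> selection_cnf k p m \<Phi>" using that by (auto simp: selection_cnf_def)
    from \<sigma>[OF this] show ?thesis by (auto simp: select_some_def)
  qed
  then obtain g where g: "\<And>i. i < k \<Longrightarrow> g i < p \<and> \<sigma> (Sel i (g i))" by metis
  define f where "f = map g [0..<k]"
  have f: "f \<in> selections k p" using g by (auto simp: f_def selections_def)
  have "(f, j, x ! j) \<notin> G" if j: "j < m" for j
  proof
    assume "(f, j, x ! j) \<in> G"
    then have "\<exists>l\<in>set (bit_clause k (f, j, x ! j)). \<rho> (fst l) = snd l" using \<rho>(2) by (auto simp: sat_def)
    then have "\<not> \<sigma> (SelBit j (x ! j) (f ! 0)) \<or> (\<exists>i<k. \<not> \<sigma> (Sel i (f ! i)))"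
      by (auto simp: bit_clause_def \<sigma>_def)
    moreover have "\<sigma> (Sel i (f ! i))" if "i < k" for i using g[OF that] that by (simp add: f_def)
    moreover have "select_bit (j, x ! j, g 0) \<in> selection_cnf k p m \<Phi>"
      using j g[of 0] k by (auto simp: selection_cnf_def)
    from \<sigma>[OF this] have "\<sigma> (SelBit j (x ! j) (g 0))" using g[of 0] k j by (auto simp: select_bit_def x_def)
    ultimately show False using k by (auto simp: f_def)
  qed
  moreover have "length x = m" by (simp add: x_def)
  ultimately show "\<exists>f\<in>selections k p. \<exists>x\<in>A. length x = m \<and> (\<forall>j<m. (f, j, x ! j) \<notin> G)"
    using f xA by blast
next
  assume "\<exists>f\<in>selections k p. \<exists>x\<in>A. length x = m \<and> (\<forall>j<m. (f, j, x ! j) \<notin> G)"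
  then obtain f x where f: "f \<in> selections k p" and x: "x \<in> A" "length x = m" "\<forall>j<m. (f, j, x ! j) \<notin> G" by blast
  obtain \<tau> where \<tau>: "sat \<tau> \<Phi>" "\<forall>j<m. \<tau> (Yv j) = x ! j" using tab[OF x(2)] x(1) by blast
  define \<sigma> where "\<sigma> u = (case u of Tab v \<Rightarrow> \<tau> v | Sel i a \<Rightarrow> a = f ! i | SelBit j b a \<Rightarrow> a = f ! 0 \<and> b = x ! j)" for u
  have fp: "f ! i < p" if "i < k" for i using f that nth_mem[of i f] by (force simp: selections_def)
  have "sat \<sigma> (selection_cnf k p m \<Phi>)"
    unfolding sat_def
  proof
    fix c assume "c \<in> selection_cnf k p m \<Phi>"
    then consider c' where "c' \<in> \<Phi>" "c = map (map_prod Tab id) c'" | i where "i < k" "c = select_some p i"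
      | j b a where "j < m" "a < p" "c = select_bit (j, b, a)"
      by (auto simp: selection_cnf_def)
    then show "\<exists>l\<in>set c. \<sigma> (fst l) = snd l"
    proof cases
      case 1 then show ?thesis using \<tau>(1) by (auto simp: sat_def \<sigma>_def)
    next
      case 2 then show ?thesis using fp by (auto simp: select_some_def \<sigma>_def)
    next
      case 3 then show ?thesis using \<tau>(2) by (auto simp: select_bit_def \<sigma>_def)
    qed
  qed
  then have "sat (chain_extend \<sigma>) (\<Union>c\<in>selection_cnf k p m \<Phi>. chain_clauses c)" by (rule chain_clauses_complete)
  moreover have "sat (chain_extend \<sigma>) (bit_clause k ` G)"
    unfolding sat_def
  proof
    fix c assume "c \<in> bit_clause k ` G"
    then obtain f' j b where c: "(f', j, b) \<in> G" "c = bit_clause k (f', j, b)" by auto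
    have f': "f' \<in> selections k p" "j < m" using c(1) G by (auto simp: bit_indices_def)
    show "\<exists>l\<in>set c. chain_extend \<sigma> (fst l) = snd l"
    proof (cases "f' = f")
      case True
      have "b \<noteq> x ! j"
      proof
        assume "b = x ! j"
        with c(1) True have "(f, j, x ! j) \<in> G" by simp
        with x(3) f'(2) show False by blast
      qed
      then show ?thesis using c(2) by (auto simp: bit_clause_def \<sigma>_def)
    next
      case False
      \<comment> \<open>A different index differs in some coordinate, whose negative literal is
        satisfied; for coordinate 0 this is the \<open>SelBit\<close> literal.\<close>
      then obtain i where i: "i < k" "f' ! i \<noteq> f ! i"
        using f f'(1) by (auto simp: selections_def list_eq_iff_nth_eq)
      show ?thesis
      proof (cases "i = 0")
        case True then show ?thesis using i c(2) by (auto simp: bit_clause_def \<sigma>_def)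
      next
        case False
        then have "(Orig (Sel i (f' ! i)), False) \<in> set c" using i c(2) by (auto simp: bit_clause_def)
        then show ?thesis using i by (force simp: \<sigma>_def)
      qed
    qed
  qed
  ultimately show "\<exists>\<rho>. sat \<rho> ((\<Union>c\<in>selection_cnf k p m \<Phi>. chain_clauses c) \<union> bit_clause k ` G)"
    unfolding sat_Un by blast
qed


lemma selection_cnf_vars:
  assumes "\<Phi> \<subseteq> {c. set c \<subseteq> V \<times> UNIV \<and> length c \<le> W}" "\<forall>j<m. Yv j \<in> V" "k \<ge> 1" "c \<in> selection_cnf k p m \<Phi>"
  shows "fst ` set c \<subseteq> selection_base_vars k p m V"
proof -
  consider c' where "c' \<in> \<Phi>" "c = map (map_prod Tab id) c'" | i where "i < k" "c = select_some p i"
    | j b a where "j < m" "a < p" "c = select_bit (j, b, a)"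
    using assms(4) by (auto simp: selection_cnf_def)
  then show ?thesis
  proof cases
    case 1
    then have "set c' \<subseteq> V \<times> UNIV" using assms(1) by auto
    moreover have "fst ` set c = Tab ` fst ` set c'" using 1(2) by (auto simp: image_image)
    ultimately show ?thesis by (auto simp: selection_base_vars_iff)
  next
    case 2
    then have "fst ` set c = Sel i ` {..<p}" by (auto simp: select_some_def image_image atLeast0LessThan)
    then show ?thesis using 2(1) by (auto simp: selection_base_vars_iff)
  next
    case 3
    then have "fst ` set c = {Sel 0 a, Tab (Yv j), SelBit j b a}" by (auto simp: select_bit_def)
    then show ?thesis using 3(1,2) assms(2,3) by (auto simp: selection_base_vars_iff)
  qed
qed

text \<open>The last conclusion separates these clauses from the bit clauses, whose first variable
  is an \<open>Orig\<close>.\<close>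

lemma chain_clauses_vars:
  assumes "d \<in> chain_clauses c" "c \<in> \<Psi>" "fst ` set c \<subseteq> V"
  shows "fst ` set d \<subseteq> Orig ` V \<union> chain_vars \<Psi>" "d \<noteq> []" "length d \<le> 3" "\<exists>c j. fst (hd d) = Chain c j"
proof -
  have ch: "Chain c j \<in> chain_vars \<Psi>" if "j \<le> length c" for j using assms(2) that by (force simp: chain_vars_def)
  consider "d = [(Chain c 0, True)]" | "d = [(Chain c (length c), False)]"
    | j where "j < length c" "d = [(Chain c j, False), (Orig (fst (c ! j)), snd (c ! j)), (Chain c (Suc j), True)]"
    using assms(1) by (auto simp: chain_clauses_def)
  then have "fst ` set d \<subseteq> Orig ` V \<union> chain_vars \<Psi> \<and> d \<noteq> [] \<and> length d \<le> 3 \<and> (\<exists>c j. fst (hd d) = Chain c j)"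
  proof cases
    case 3
    then have "fst (c ! j) \<in> V" using assms(3) nth_mem by blast
    then show ?thesis using 3 ch by simp
  qed (use ch in simp_all)
  then show "fst ` set d \<subseteq> Orig ` V \<union> chain_vars \<Psi>" "d \<noteq> []" "length d \<le> 3" "\<exists>c j. fst (hd d) = Chain c j"
    by blast+
qed

lemma sat_pad_clause:
  assumes "\<And>c. c \<in> \<Phi> \<Longrightarrow> c \<noteq> []"
  shows "sat \<sigma> (pad_clause k ` \<Phi>) \<longleftrightarrow> sat \<sigma> \<Phi>"
  using assms by (simp add: sat_def set_pad_clause)

lemma finite_bounded_clauses:
  assumes "finite V" "\<Phi> \<subseteq> {c. set c \<subseteq> V \<times> (UNIV :: bool set) \<and> length c \<le> W}"
  shows "finite \<Phi>" "card \<Phi> \<le> (\<Sum>i\<le>W. (2 * card V) ^ i)"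
proof -
  have f: "finite (V \<times> (UNIV :: bool set))" using assms(1) by simp
  show "finite \<Phi>" using finite_subset[OF assms(2) finite_lists_length_le[OF f]] .
  have "card \<Phi> \<le> card {c. set c \<subseteq> V \<times> (UNIV :: bool set) \<and> length c \<le> W}"
    by (rule card_mono[OF finite_lists_length_le[OF f] assms(2)])
  then show "card \<Phi> \<le> (\<Sum>i\<le>W. (2 * card V) ^ i)"
    unfolding card_lists_length_le[OF f] by (simp add: card_cartesian_product mult.commute)
qed

section \<open>Size of the formula and the embedding\<close>

abbreviation sel_size :: "nat \<Rightarrow> nat \<Rightarrow> nat \<Rightarrow> nat \<Rightarrow> nat" where
  "sel_size W k m v \<equiv> v + (\<Sum>i\<le>W. (2 * v) ^ i) * (W + 1) + 3 * k + 10 * m"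

text \<open>The point is linear growth in \<open>p\<close>. The tableau contributes independently of
  \<open>p\<close>. The \<open>k\<close> clauses of length \<open>p\<close> need at most
  \<open>2 * k * p\<close> chain variables, which with the \<open>k * p\<close> selectors gives
  \<open>3 * k\<close>; the \<open>2 * m * p\<close> bit selectors and 4 chain variables for each of
  their clauses give \<open>10 * m\<close>.\<close>

lemma card_selection_vars:
  fixes k m :: nat
  assumes V: "finite V" and \<Phi>: "\<Phi> \<subseteq> {c. set c \<subseteq> V \<times> UNIV \<and> length c \<le> W}" and p: "p \<ge> 1"
  defines "U \<equiv> Orig ` selection_base_vars k p m V \<union> chain_vars (selection_cnf k p m \<Phi>)"
  shows "finite U" "card U \<le> sel_size W k m (card V) * p"
proof -
  note f\<Phi> = finite_bounded_clauses[OF V \<Phi>]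
  let ?a = "map (map_prod Tab id) ` \<Phi> :: tvar selvar clause set" and ?b = "select_some p ` {..<k} :: tvar selvar clause set"
    and ?c = "select_bit ` ({..<m} \<times> UNIV \<times> {..<p})"
  have 1: "finite (chain_vars ?a)" "card (chain_vars ?a) \<le> card ?a * (W + 1)"
    by (rule card_chain_vars; use f\<Phi>(1) \<Phi> in auto)+
  have 2: "finite (chain_vars ?b)" "card (chain_vars ?b) \<le> card ?b * (p + 1)"
    by (rule card_chain_vars; simp add: select_some_def image_iff; auto simp: select_some_def)+
  have 3: "finite (chain_vars ?c)" "card (chain_vars ?c) \<le> card ?c * (3 + 1)"
    by (rule card_chain_vars; auto simp: select_bit_def)+
  have "card ?a \<le> (\<Sum>i\<le>W. (2 * card V) ^ i)" using card_image_le[OF f\<Phi>(1)] f\<Phi>(2) order_trans by blast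
  then have a: "card (chain_vars ?a) \<le> (\<Sum>i\<le>W. (2 * card V) ^ i) * (W + 1)"
    using 1(2) by (meson mult_le_mono1 order_trans)
  have "card ?b \<le> k" using card_image_le[of "{..<k}" "select_some p :: nat \<Rightarrow> tvar selvar clause"] by simp
  then have b: "card (chain_vars ?b) \<le> k * (p + 1)" using 2(2) by (meson mult_le_mono1 order_trans)
  have "card ?c \<le> m * (2 * p)"
    using card_image_le[of "{..<m} \<times> (UNIV :: bool set) \<times> {..<p}" select_bit] by (simp add: card_cartesian_product)
  then have c: "card (chain_vars ?c) \<le> m * (2 * p) * 4" using 3(2) by simp
  let ?B = "selection_base_vars k p m V"
  have fB: "finite ?B" using V by (simp add: selection_base_vars_def)
  have "card ?B \<le> card V + card ({..<k} \<times> {..<p}) + card ({..<m} \<times> (UNIV :: bool set) \<times> {..<p})"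
    unfolding selection_base_vars_def using V by (intro order_trans[OF card_Un_le] add_mono card_image_le) auto
  then have B: "card ?B \<le> card V + k * p + m * (2 * p)" by (simp add: card_cartesian_product)
  have U: "U = Orig ` ?B \<union> (chain_vars ?a \<union> chain_vars ?b \<union> chain_vars ?c)"
    unfolding U_def selection_cnf_def chain_vars_Un by simp
  show "finite U" unfolding U using fB 1(1) 2(1) 3(1) by simp
  have "card U \<le> card (Orig ` ?B) + (card (chain_vars ?a) + card (chain_vars ?b) + card (chain_vars ?c))"
    unfolding U by (meson add_le_mono card_Un_le order_refl order_trans)
  also have "card (Orig ` ?B) \<le> card ?B" by (rule card_image_le[OF fB])
  finally have "card U \<le> card V + k * p + m * (2 * p) + ((\<Sum>i\<le>W. (2 * card V) ^ i) * (W + 1) + k * (p + 1) + m * (2 * p) * 4)"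
    using a b c B by linarith
  also have "\<dots> \<le> card V * p + k * p + m * (2 * p) + ((\<Sum>i\<le>W. (2 * card V) ^ i) * (W + 1) * p + k * (2 * p) + m * (2 * p) * 4)"
  proof -
    have le: "y \<le> y * p" for y using mult_le_mono2[OF p, of y] by simp
    have "k * (p + 1) \<le> k * (2 * p)" using p by (intro mult_le_mono2) simp
    then show ?thesis using le[of "card V"] le[of "(\<Sum>i\<le>W. (2 * card V) ^ i) * (W + 1)"] by linarith
  qed
  also have "\<dots> = sel_size W k m (card V) * p" by (simp add: algebra_simps)
  finally show "card U \<le> sel_size W k m (card V) * p" .
qed

text \<open>
  The bit of an instance string at the tuple \<open>t (f, j, b)\<close> tells whether bit \<open>j\<close> of the string with index
  \<open>f\<close> is forbidden to be \<open>b\<close>; all other bits are fixed.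
\<close>
definition OR_embedding :: "nat \<Rightarrow> nat \<Rightarrow> nat list set \<Rightarrow> nat \<Rightarrow> language \<Rightarrow> nat \<Rightarrow> nat \<Rightarrow> nat \<Rightarrow> nat set set \<Rightarrow>
    (nat \<Rightarrow> nat set) \<Rightarrow> nat list set \<Rightarrow> (nat list \<times> nat \<times> bool \<Rightarrow> nat list) \<Rightarrow> bool" where
  "OR_embedding q r R k A m p n E L F t \<longleftrightarrow>
     inj_on t (bit_indices k p m) \<and> t ` bit_indices k p m \<inter> F = {} \<and>
     (\<forall>G \<subseteq> bit_indices k p m. RCLC_instance q r {0..<n} E L (F \<union> t ` G) \<and>
       (RCLC_solvable q R {0..<n} E L (F \<union> t ` G) \<longleftrightarrow>
         (\<exists>f\<in>selections k p. \<exists>x\<in>A. length x = m \<and> (\<forall>j<m. (f, j, x ! j) \<notin> G))))"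

text \<open>Only the bit clauses vary with the strings, so all instances for given \<open>m\<close>
  and \<open>p\<close> share \<open>E\<close>, \<open>L\<close> and \<open>F\<close>. The bound uses
  one polynomial for all \<open>p\<close>, which leaves \<open>p\<close> to be chosen later.\<close>

lemma OR_composition:
  assumes A: "A \<in> NP" and or: "OR_definable q r R k" and k: "k \<ge> 3"
  obtains Q :: "nat poly" where
    "\<And>m p. p \<ge> 1 \<Longrightarrow> \<exists>n E L F t. n \<le> poly Q m * p \<and> OR_embedding q r R k A m p n E L F t"
proof -
  obtain W and P :: "nat poly" where tab: "\<And>m. \<exists>V \<Phi>. finite V \<and> card V \<le> poly P m \<and> (\<forall>j<m. Yv j \<in> V) \<and>
       \<Phi> \<subseteq> {c. set c \<subseteq> V \<times> UNIV \<and> length c \<le> W} \<and>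
       (\<forall>x. length x = m \<longrightarrow> (x \<in> A \<longleftrightarrow> (\<exists>\<sigma>. sat \<sigma> \<Phi> \<and> (\<forall>j<m. \<sigma> (Yv j) = x ! j))))"
    by (rule NP_tableau[OF A]) (rule that)
  have "poly_bounded (\<lambda>m. sel_size W k m (poly P m) * (2 * r + r * r))"
    by (intro poly_bounded_intros) auto
  then obtain Q where Q: "\<And>m. sel_size W k m (poly P m) * (2 * r + r * r) \<le> poly Q m"
    by (auto simp: poly_bounded_def)
  show thesis
  proof (rule that[of Q])
    fix m p :: nat assume p: "p \<ge> 1"
    obtain V \<Phi> where V: "finite V" "card V \<le> poly P m" "\<forall>j<m. Yv j \<in> V"
      "\<Phi> \<subseteq> {c. set c \<subseteq> V \<times> UNIV \<and> length c \<le> W}"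
      "\<And>x. length x = m \<Longrightarrow> (x \<in> A \<longleftrightarrow> (\<exists>\<sigma>. sat \<sigma> \<Phi> \<and> (\<forall>j<m. \<sigma> (Yv j) = x ! j)))"
      using tab[of m] by blast
    define \<Psi> where "\<Psi> = selection_cnf k p m \<Phi>"
    define B where "B = selection_base_vars k p m V"
    define U where "U = Orig ` B \<union> chain_vars \<Psi>"
    note cU = card_selection_vars[OF V(1,4) p, where k = k and m = m, folded \<Psi>_def B_def, folded U_def]
    have k1: "k \<ge> 1" using k by simp
    obtain n E L and \<tau> :: "tvar selvar chained clause \<Rightarrow> nat list" where n: "n \<le> card U * (2 * r + r * r)"
      "inj_on \<tau> {c. length c = k \<and> fst ` set c \<subseteq> U}"
      "\<And>Cs. Cs \<subseteq> {c. length c = k \<and> fst ` set c \<subseteq> U} \<Longrightarrow> RCLC_instance q r {0..<n} E L (\<tau> ` Cs) \<and>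
         (RCLC_solvable q R {0..<n} E L (\<tau> ` Cs) \<longleftrightarrow> (\<exists>\<sigma>. sat \<sigma> Cs))"
      by (rule cnf_to_RCLC[OF or k1 cU(1)]) (rule that)
    define C where "C = (\<Union>c\<in>\<Psi>. chain_clauses c)"
    have C: "fst ` set d \<subseteq> U" "d \<noteq> []" "length d \<le> 3" "\<exists>c j. fst (hd d) = Chain c j" if d: "d \<in> C" for d
    proof -
      obtain c where c: "c \<in> \<Psi>" "d \<in> chain_clauses c" using d by (auto simp: C_def)
      have "fst ` set c \<subseteq> B" using selection_cnf_vars[OF V(4,3) k1] c(1) by (auto simp: \<Psi>_def B_def)
      from chain_clauses_vars[OF c(2,1) this]
      show "fst ` set d \<subseteq> U" "d \<noteq> []" "length d \<le> 3" "\<exists>c j. fst (hd d) = Chain c j" by (auto simp: U_def)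
    qed
    have padC: "pad_clause k ` C \<subseteq> {c. length c = k \<and> fst ` set c \<subseteq> U}"
    proof clarsimp
      fix d assume d: "d \<in> C"
      have "length d \<le> k" using C(3)[OF d] k by simp
      then show "length (pad_clause k d) = k \<and> fst ` set (pad_clause k d) \<subseteq> U"
        using C(1,2)[OF d] by (simp add: length_pad_clause set_pad_clause)
    qed
    have bitC: "bit_clause k ` bit_indices k p m \<subseteq> {c. length c = k \<and> fst ` set c \<subseteq> U}"
    proof clarsimp
      fix f j b assume h: "(f, j, b) \<in> bit_indices k p m"
      have "f ! i < p" if "i < k" for i using h that nth_mem[of i f] by (force simp: bit_indices_def selections_def)
      then show "length (bit_clause k (f, j, b)) = k \<and> fst ` set (bit_clause k (f, j, b)) \<subseteq> U"
        using h k by (auto simp: bit_clause_def bit_indices_def U_def B_def selection_base_vars_iff)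
    qed
    define F where "F = \<tau> ` pad_clause k ` C"
    define t where "t = \<tau> \<circ> bit_clause k"
    have "inj_on t (bit_indices k p m)"
      unfolding t_def by (rule comp_inj_on[OF bit_clause_inj[OF k1] inj_on_subset[OF n(2) bitC]])
    moreover have "t ` bit_indices k p m \<inter> F = {}"
    proof -
      have "bit_clause k u \<noteq> pad_clause k d" if dC: "d \<in> C" for u d
      proof
        assume e: "bit_clause k u = pad_clause k d"
        obtain c j where "fst (hd d) = Chain c j" using C(4)[OF dC] by blast
        then have "fst (hd (pad_clause k d)) = Chain c j" using C(2)[OF dC] by (simp add: pad_clause_def)
        then show False unfolding e[symmetric] by (auto simp: bit_clause_def split: prod.splits)
      qed
      moreover have "bit_clause k u = pad_clause k d" if "u \<in> bit_indices k p m" "d \<in> C" "\<tau> (bit_clause k u) = \<tau> (pad_clause k d)" for u d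
        by (rule inj_onD[OF n(2) that(3)]) (use that padC bitC in blast)+
      ultimately show ?thesis unfolding F_def t_def by fastforce
    qed
    moreover have "RCLC_instance q r {0..<n} E L (F \<union> t ` G) \<and>
         (RCLC_solvable q R {0..<n} E L (F \<union> t ` G) \<longleftrightarrow>
           (\<exists>f\<in>selections k p. \<exists>x\<in>A. length x = m \<and> (\<forall>j<m. (f, j, x ! j) \<notin> G)))" if G: "G \<subseteq> bit_indices k p m" for G
    proof -
      let ?Cs = "pad_clause k ` C \<union> bit_clause k ` G"
      have "?Cs \<subseteq> {c. length c = k \<and> fst ` set c \<subseteq> U}" using padC bitC G by blast
      note 1 = n(3)[OF this]
      have 2: "F \<union> t ` G = \<tau> ` ?Cs" by (auto simp: F_def t_def)
      have "(\<exists>\<sigma>. sat \<sigma> ?Cs) \<longleftrightarrow> (\<exists>\<sigma>. sat \<sigma> (C \<union> bit_clause k ` G))" unfolding sat_Un using sat_pad_clause[of C] C(2) by blast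
      also have "\<dots> \<longleftrightarrow> (\<exists>f\<in>selections k p. \<exists>x\<in>A. length x = m \<and> (\<forall>j<m. (f, j, x ! j) \<notin> G))"
        unfolding C_def \<Psi>_def by (rule selection_cnf_sat_iff[OF k1 p G V(5)])
      finally show ?thesis using 1 unfolding 2 by simp
    qed
    moreover have "n \<le> poly Q m * p"
    proof -
      have "card U \<le> sel_size W k m (poly P m) * p"
        using V(2) by (intro order_trans[OF cU(2)] mult_le_mono add_mono sum_mono power_mono) auto
      then have "n \<le> sel_size W k m (poly P m) * p * (2 * r + r * r)"
        using n(1) by (meson mult_le_mono1 order_trans)
      also have "\<dots> = sel_size W k m (poly P m) * (2 * r + r * r) * p"
        by (simp only: mult_ac)
      also have "\<dots> \<le> poly Q m * p" using Q by (intro mult_le_mono1)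
      finally show ?thesis .
    qed
    ultimately have "n \<le> poly Q m * p \<and> OR_embedding q r R k A m p n E L F t" by (simp add: OR_embedding_def)
    then show "\<exists>n E L F t. n \<le> poly Q m * p \<and> OR_embedding q r R k A m p n E L F t" by blast
  qed
qed

section \<open>Complementary witnesses\<close>

text \<open>Some \<open>y\<close> has at least \<open>card S ^ card I / card Y\<close> preimages.
  They lie in the product of their projections \<open>T i\<close>; if each of these were smaller
  than half of \<open>S\<close>, the product would be too small. So a single pair
  \<open>(y, i)\<close> covers half of \<open>S\<close>, and the rest is covered
  recursively.\<close>

lemma complementary_witness_cover:
  fixes \<Phi> :: "('i \<Rightarrow> 'a) \<Rightarrow> 'y"
  assumes I: "finite I" "I \<noteq> {}" and Y: "finite Y" "card Y \<le> 2 ^ card I"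
    and S: "finite S" "card S < 2 ^ l" "\<Phi> ` (I \<rightarrow>\<^sub>E S) \<subseteq> Y"
  shows "\<exists>ys. length ys \<le> l \<and> (\<forall>(y, i)\<in>set ys. i \<in> I \<and> y \<in> \<Phi> ` (I \<rightarrow>\<^sub>E S)) \<and>
    (\<forall>x\<in>S. \<exists>(y, i)\<in>set ys. \<exists>X\<in>I \<rightarrow>\<^sub>E S. X i = x \<and> \<Phi> X = y)"
  using S
proof (induction l arbitrary: S)
  case 0
  then show ?case by (intro exI[of _ "[]"]) simp
next
  case (Suc l)
  show ?case
  proof (cases "S = {}")
    case True
    then show ?thesis by (intro exI[of _ "[]"]) simp
  next
    case False
    let ?P = "I \<rightarrow>\<^sub>E S"
    have fP: "finite ?P" using I Suc.prems by (simp add: finite_PiE)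
    have cP: "card ?P = card S ^ card I" using I by (simp add: card_PiE)
    have "?P \<noteq> {}" using False by (auto simp: PiE_eq_empty_iff)
    then have "Y \<noteq> {}" using Suc.prems by auto
    then obtain y where y: "y \<in> Y" "card (\<Phi> -` {y} \<inter> ?P) * card Y \<ge> card ?P"
      using pigeonhole_card[of \<Phi> ?P Y] fP Y Suc.prems(3) by (auto simp: image_subset_iff)
    define Z where "Z = \<Phi> -` {y} \<inter> ?P"
    define T where "T i = (\<lambda>X. X i) ` Z" for i
    have fZ: "finite Z" using fP by (simp add: Z_def)
    have "Z \<subseteq> PiE I T"
    proof
      fix X assume X: "X \<in> Z"
      then have "X \<in> ?P" by (simp add: Z_def)
      then show "X \<in> PiE I T" using X by (auto simp: T_def PiE_iff)
    qed
    then have "card Z \<le> card (PiE I T)" by (rule card_mono[rotated]) (use I fZ in \<open>auto simp: T_def intro: finite_PiE\<close>)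
    then have cZ: "card Z \<le> (\<Prod>i\<in>I. card (T i))" using I by (simp add: card_PiE)
    have "\<exists>i\<in>I. card S \<le> 2 * card (T i)"
    proof (rule ccontr)
      assume "\<not> (\<exists>i\<in>I. card S \<le> 2 * card (T i))"
      \<comment> \<open>Integrality leaves a deficit of one in each factor, which makes the final
        inequality strict although \<open>card Y\<close> may equal
        \<open>2 ^ card I\<close>.\<close>
      then have lt: "\<And>i. i \<in> I \<Longrightarrow> 2 * card (T i) \<le> card S - 1" by fastforce
      have "card S ^ card I \<le> card Z * card Y" using y(2) cP by (simp add: Z_def)
      also have "\<dots> \<le> (\<Prod>i\<in>I. card (T i)) * 2 ^ card I" using cZ Y(2) by (rule mult_le_mono)
      also have "\<dots> = (\<Prod>i\<in>I. 2 * card (T i))" by (simp add: prod.distrib mult.commute)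
      also have "\<dots> \<le> (\<Prod>i\<in>I. card S - 1)" using lt by (intro prod_mono) auto
      also have "\<dots> = (card S - 1) ^ card I" by simp
      also have "\<dots> < card S ^ card I"
        using False Suc.prems(1) I by (intro power_strict_mono) (auto simp: card_gt_0_iff)
      finally show False by simp
    qed
    then obtain i where i: "i \<in> I" "card S \<le> 2 * card (T i)" by blast
    have TS: "T i \<subseteq> S" using i(1) by (auto simp: T_def Z_def PiE_iff)
    have "card (S - T i) = card S - card (T i)" using TS Suc.prems(1) by (meson card_Diff_subset finite_subset)
    then have "card (S - T i) < 2 ^ l" using i(2) Suc.prems(2) by simp
    moreover have sub: "I \<rightarrow>\<^sub>E (S - T i) \<subseteq> ?P" by (rule PiE_mono) auto
    ultimately obtain ys where ys: "length ys \<le> l" "\<forall>(y, j)\<in>set ys. j \<in> I \<and> y \<in> \<Phi> ` (I \<rightarrow>\<^sub>E (S - T i))"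
      "\<forall>x\<in>S - T i. \<exists>(y, j)\<in>set ys. \<exists>X\<in>I \<rightarrow>\<^sub>E (S - T i). X j = x \<and> \<Phi> X = y"
      using Suc.IH[of "S - T i"] Suc.prems(1,3) by blast
    have "T i \<noteq> {}" using i(2) False Suc.prems(1) by (auto simp: card_gt_0_iff)
    then have "y \<in> \<Phi> ` ?P" by (auto simp: T_def Z_def)
    show ?thesis
    proof (intro exI[of _ "(y, i) # ys"] conjI)
      show "length ((y, i) # ys) \<le> Suc l" using ys(1) by simp
      show "\<forall>(y, i)\<in>set ((y, i) # ys). i \<in> I \<and> y \<in> \<Phi> ` ?P" using ys(2) i(1) \<open>y \<in> \<Phi> ` ?P\<close> sub by fastforce
      show "\<forall>x\<in>S. \<exists>(y, i)\<in>set ((y, i) # ys). \<exists>X\<in>?P. X i = x \<and> \<Phi> X = y"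
      proof
        fix x assume "x \<in> S"
        show "\<exists>(y, i)\<in>set ((y, i) # ys). \<exists>X\<in>?P. X i = x \<and> \<Phi> X = y"
        proof (cases "x \<in> T i")
          case True then show ?thesis by (auto simp: T_def Z_def)
        next
          case False
          then obtain y' j X where "(y', j) \<in> set ys" "X \<in> I \<rightarrow>\<^sub>E (S - T i)" "X j = x" "\<Phi> X = y'"
            using ys(3) \<open>x \<in> S\<close> by blast
          then show ?thesis using sub by (intro bexI[of _ "(y', j)"]) auto
        qed
      qed
    qed
  qed
qed

section \<open>Choosing the number of instances\<close>

lemma poly_lt_power: "\<exists>d. \<forall>m. poly (p :: nat poly) m < (m + 2) ^ d"
proof (induction p)
  case 0
  then show ?case by (intro exI[of _ 0]) simp
next
  case (pCons a p)
  then obtain d where d: "\<And>m. poly p m < (m + 2) ^ d" by blast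
  have "poly (pCons a p) m < (m + 2) ^ (a + d + 1)" for m
  proof -
    \<comment> \<open>The base is at least 2 even for \<open>m = 0\<close>, so a power of it absorbs
      the coefficient.\<close>
    have "a < (m + 2) ^ a" by (rule less_le_trans[OF less_exp power_mono]) auto
    also have "\<dots> \<le> (m + 2) ^ (a + d)" by (rule power_increasing) auto
    finally have 1: "a < (m + 2) ^ (a + d)" .
    have "poly p m \<le> (m + 2) ^ d" using d[of m] by simp
    also have "\<dots> \<le> (m + 2) ^ (a + d)" by (rule power_increasing) auto
    finally have 2: "m * poly p m \<le> m * (m + 2) ^ (a + d)" by (rule mult_le_mono2)
    have "poly (pCons a p) m = a + m * poly p m" by simp
    also have "\<dots> < (m + 2) ^ (a + d) + m * (m + 2) ^ (a + d)" using 1 2 by (rule add_less_le_mono)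
    also have "\<dots> \<le> (m + 2) * (m + 2) ^ (a + d)" by (simp add: algebra_simps)
    finally show ?thesis by simp
  qed
  then show ?case by blast
qed

text \<open>Put \<open>b = m + 2\<close> and \<open>p = b ^ D\<close>. As \<open>n\<close> is at
  most a fixed power \<open>b ^ d\<close> times \<open>p\<close>, the size is at most
  \<open>b ^ (r + (d + D) * (k - \<delta>))\<close>, and \<open>D * \<delta> \<ge> r + d * k\<close>
  brings this below \<open>p ^ k\<close>. The 2 on the left pays for counting all strings of length
  at most \<open>h n + 1\<close>.\<close>

lemma compression_size_bound:
  fixes h :: "nat \<Rightarrow> nat" and Q :: "nat poly"
  assumes h: "(\<lambda>n. real (h n)) \<in> O(\<lambda>n. real n powr (real k - \<epsilon>))" and e: "\<epsilon> > 0" and k: "k \<ge> 1"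
  shows "\<exists>D. \<forall>m n. n \<le> poly Q m * (m + 2) ^ D \<longrightarrow> h n + 2 \<le> ((m + 2) ^ D) ^ k"
proof -
  \<comment> \<open>\<open>\<epsilon>\<close> may exceed \<open>k\<close>; the cut at 1 keeps the
    exponent \<open>k - \<delta>\<close> nonnegative, so that powers grow with their base.\<close>
  define \<delta> where "\<delta> = min \<epsilon> 1"
  have \<delta>: "\<delta> > 0" "\<delta> \<le> \<epsilon>" "\<delta> \<le> real k" using e k by (auto simp: \<delta>_def)
  obtain c where c: "c > 0" "\<forall>\<^sub>F n in at_top. norm (real (h n)) \<le> c * norm (real n powr (real k - \<epsilon>))"
    using h by (elim landau_o.bigE)
  then obtain n0 where n0: "\<And>n. n \<ge> n0 \<Longrightarrow> real (h n) \<le> c * real n powr (real k - \<epsilon>)"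
    by (auto simp: eventually_at_top_linorder)
  \<comment> \<open>The sum takes care of the finitely many \<open>n\<close> before the asymptotic
    bound sets in, the 2 of the summand 2 next to \<open>h n\<close>.\<close>
  define C where "C = c + real (\<Sum>n<Suc n0. h n) + 2"
  have hC: "real (h n) + 2 \<le> C * real (n + 1) powr (real k - \<delta>)" for n
  proof -
    have one: "1 \<le> real (n + 1) powr (real k - \<delta>)" using \<delta> by (intro ge_one_powr_ge_zero) auto
    have "real (h n) \<le> (c + real (\<Sum>n<Suc n0. h n)) * real (n + 1) powr (real k - \<delta>)"
    proof (cases "n < Suc n0")
      case True
      then have "real (h n) \<le> real (\<Sum>n<Suc n0. h n)" by (intro of_nat_mono member_le_sum) auto
      also have "\<dots> \<le> c + real (\<Sum>n<Suc n0. h n)" using c(1) by simp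
      also have "\<dots> \<le> (c + real (\<Sum>n<Suc n0. h n)) * real (n + 1) powr (real k - \<delta>)"
        using one c(1) mult_left_mono[OF one, of "c + real (\<Sum>n<Suc n0. h n)"] by (simp add: add_nonneg_nonneg sum_nonneg)
      finally show ?thesis .
    next
      case False
      have "real (h n) \<le> c * real n powr (real k - \<epsilon>)" using False by (intro n0) simp
      also have "real n powr (real k - \<epsilon>) \<le> real n powr (real k - \<delta>)" using False \<delta> by (intro powr_mono) auto
      also have "real n powr (real k - \<delta>) \<le> real (n + 1) powr (real k - \<delta>)" using \<delta> by (intro powr_mono2) auto
      finally have "real (h n) \<le> c * real (n + 1) powr (real k - \<delta>)" using c(1) by simp
      also have "\<dots> \<le> (c + real (\<Sum>n<Suc n0. h n)) * real (n + 1) powr (real k - \<delta>)"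
        by (intro mult_right_mono) (simp_all add: add_nonneg_nonneg sum_nonneg)
      finally show ?thesis .
    qed
    then show ?thesis unfolding C_def using one by (simp add: algebra_simps)
  qed
  obtain d where d: "\<And>m. poly Q m < (m + 2) ^ d" using poly_lt_power by blast
  obtain r where r: "C \<le> 2 ^ r" using real_arch_pow[of 2 C] by (auto intro: less_imp_le)
  obtain D :: nat where D: "(real r + real d * real k) / \<delta> \<le> real D" using real_arch_simple by blast
  have "h n + 2 \<le> ((m + 2) ^ D) ^ k" if n: "n \<le> poly Q m * (m + 2) ^ D" for m n
  proof -
    define b where "b = real (m + 2)"
    have b: "b \<ge> 2" "b > 0" "b \<ge> 1" by (auto simp: b_def)
    have "n + 1 \<le> poly Q m * (m + 2) ^ D + (m + 2) ^ D" using n by (rule add_mono) simp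
    also have "\<dots> = (poly Q m + 1) * (m + 2) ^ D" by simp
    also have "\<dots> \<le> (m + 2) ^ d * (m + 2) ^ D" using d[of m] by (intro mult_le_mono1) simp
    finally have "real (n + 1) \<le> b ^ d * b ^ D" unfolding b_def by (metis of_nat_le_iff of_nat_mult of_nat_power)
    also have "\<dots> = b powr (real d + real D)" using b by (simp add: powr_add powr_realpow)
    finally have "real (n + 1) powr (real k - \<delta>) \<le> (b powr (real d + real D)) powr (real k - \<delta>)"
      using \<delta> by (intro powr_mono2) auto
    also have "\<dots> = b powr ((real d + real D) * (real k - \<delta>))" by (simp add: powr_powr)
    finally have 1: "real (n + 1) powr (real k - \<delta>) \<le> b powr ((real d + real D) * (real k - \<delta>))" .
    have "C \<le> b ^ r" using r b power_mono[of 2 b r] by linarith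
    then have C: "C \<le> b powr real r" using b by (simp add: powr_realpow)
    have C0: "C \<ge> 0" using c(1) by (simp add: C_def sum_nonneg)
    have "real (h n) + 2 \<le> b powr real r * b powr ((real d + real D) * (real k - \<delta>))"
      by (rule order_trans[OF hC mult_mono[OF C 1]]) auto
    also have "\<dots> = b powr (real r + (real d + real D) * (real k - \<delta>))" by (simp add: powr_add)
    also have "\<dots> \<le> b powr (real D * real k)"
    proof (rule powr_mono)
      have "real r + real d * real k \<le> real D * \<delta>" using D \<delta>(1) by (simp add: field_simps)
      moreover have "0 \<le> real d * \<delta>" using \<delta> by simp
      ultimately show "real r + (real d + real D) * (real k - \<delta>) \<le> real D * real k" by (simp add: algebra_simps)
    qed (use b in auto)
    also have "\<dots> = b ^ (D * k)" using b by (simp add: powr_realpow flip: of_nat_mult)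
    finally have "real (h n + 2) \<le> real (((m + 2) ^ D) ^ k)" by (simp add: b_def power_mult)
    then show ?thesis by (simp only: of_nat_le_iff)
  qed
  then show ?thesis by blast
qed

section \<open>Advice programs\<close>

definition double :: "bool list \<Rightarrow> bool list" where
  "double x = concat (map (\<lambda>b. [True, b]) x)"

lemma double_simps [simp]: "double [] = []" "double (b # x) = True # b # double x" "double (x @ y) = double x @ double y"
  by (auto simp: double_def)

lemma str_pair_double: "str_pair x y = double x @ False # y"
  by (simp add: str_pair_def double_def)

text \<open>\<open>PB\<close> counts ones from 0 and writes the count plus 1, hence
  \<open>c - 1\<close> ones for code \<open>c\<close>.\<close>

definition unary_code :: "nat \<Rightarrow> bool list" where
  "unary_code c = replicate (c - 1) True @ [False]"

lemma parse_string: "parse g (PA 0) xs cs (double (double x) @ s) = parse g (PA 0) (xs @ x) cs s"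
  by (induction x arbitrary: xs) (auto simp: numeral_eq_Suc)

lemma parse_code: "n + i \<le> 8 \<Longrightarrow>
  parse g (PB False n) x cs (double (replicate i True @ [False]) @ s) = parse g (PB False 0) x ((n + i + 1) # cs) s"
  by (induction i arbitrary: n) auto

lemma parse_codes:
  "set ds \<subseteq> {1..9} \<Longrightarrow>
   parse g (PB False 0) x cs (double (concat (map unary_code ds)) @ s) = parse g (PB False 0) x (rev ds @ cs) s"
proof (induction ds arbitrary: cs)
  case (Cons d ds)
  have "parse g (PB False 0) x cs (double (unary_code d) @ t) = parse g (PB False 0) x (d # cs) t" for t
  proof -
    have "0 + (d - 1) \<le> 8" "0 + (d - 1) + 1 = d" using Cons.prems by auto
    then show ?thesis using parse_code[of 0 "d - 1" g x cs t] unfolding unary_code_def by simp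
  qed
  then show ?case using Cons by simp
qed simp

text \<open>The third tape is a stack executed from its top, so the advice lists \<open>ds\<close>
  in reverse.\<close>

lemma parse_program:
  assumes "set ds \<subseteq> {1..9}"
  shows "parse g (PA 0) [] [] (str_pair (str_pair x (concat (map unary_code (rev ds)))) w) = interp g x ds w (int (length x)) []"
proof -
  have "str_pair (str_pair x (concat (map unary_code (rev ds)))) w =
     double (double x) @ True # False # double (concat (map unary_code (rev ds))) @ False # w"
    by (simp add: str_pair_double)
  then show ?thesis using assms
    by (simp add: parse_string[of g "[]" "[]" x, simplified] parse_codes)
qed

section \<open>Programs that print a string matching a template\<close>

lemma interp_left: "interp g x (replicate n (Suc 0) @ cs) w p z = interp g x cs w (p - int n) z"
  by (induction n arbitrary: p) (auto simp: algebra_simps)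

lemma interp_right: "interp g x (replicate n 2 @ cs) w p z = interp g x cs w (p + int n) z"
  by (induction n arbitrary: p) (auto simp: algebra_simps)

text \<open>A bit of an encoded instance as seen from one index: constant, the test whether bit
  \<open>j\<close> of \<open>x\<close> differs from \<open>b\<close>, or taken from the
  witness.\<close>

datatype block = Fixed bool | XBit nat bool | Free

fun fits :: "bool list \<Rightarrow> block \<Rightarrow> bool \<Rightarrow> bool" where
  "fits x (Fixed b) c \<longleftrightarrow> c = b"
| "fits x (XBit j b) c \<longleftrightarrow> c = (x ! j \<noteq> b)"
| "fits x Free c \<longleftrightarrow> True"

text \<open>After parsing, the head on \<open>x\<close> rests on cell \<open>m\<close>, just behind
  the last bit; each block finds it there and returns it there.\<close>

fun compile :: "nat \<Rightarrow> block \<Rightarrow> nat list" where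
  "compile m (Fixed b) = [if b then 6 else 5]"
| "compile m (XBit j b) = replicate (m - j) 1 @ (if b then 4 else 3) # replicate (m - j) 2"
| "compile m Free = [7]"

fun block_ok :: "nat \<Rightarrow> block \<Rightarrow> bool" where
  "block_ok m (XBit j b) \<longleftrightarrow> j < m"
| "block_ok m _ \<longleftrightarrow> True"

lemma length_compile: "length (compile m B) \<le> 2 * m + 1"
  by (cases B) auto

lemma set_compile: "set (compile m B) \<subseteq> {1..7}"
  by (cases B) auto

lemma interp_compile:
  assumes "length x = m" "block_ok m B"
  shows "interp g x (compile m B @ cs) w (int m) z \<longleftrightarrow>
    (case B of Free \<Rightarrow> (case w of [] \<Rightarrow> False | b # w' \<Rightarrow> interp g x cs w' (int m) (z @ [b]))
       | _ \<Rightarrow> interp g x cs w (int m) (z @ [fits x B True]))"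
proof (cases B)
  case (XBit j b)
  then have j: "j < m" "int m - int (m - j) = int j" using assms by auto
  show ?thesis unfolding XBit using j assms(1) by (cases b) (simp_all add: interp_left interp_right)
qed simp_all

abbreviation compile_all :: "nat \<Rightarrow> block list \<Rightarrow> nat list" where
  "compile_all m Bs \<equiv> concat (map (compile m) Bs)"

lemma interp_compile_sound:
  assumes "length x = m" "list_all (block_ok m) Bs" "interp g x (compile_all m Bs @ cs) w (int m) z"
  shows "\<exists>zs w'. list_all2 (fits x) Bs zs \<and> interp g x cs w' (int m) (z @ zs)"
  using assms(2,3)
proof (induction Bs arbitrary: w z)
  case Nil
  then show ?case by (intro exI[of _ "[]"] exI[of _ w]) simp
next
  case (Cons B Bs)
  have "interp g x (compile m B @ compile_all m Bs @ cs) w (int m) z" using Cons.prems(2) by simp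
  then obtain b w' where b: "fits x B b" "interp g x (compile_all m Bs @ cs) w' (int m) (z @ [b])"
    using interp_compile[OF assms(1), of B g] Cons.prems(1)
    by (cases B) (auto split: list.splits)
  obtain zs w'' where "list_all2 (fits x) Bs zs" "interp g x cs w'' (int m) ((z @ [b]) @ zs)"
    using Cons.IH[OF _ b(2)] Cons.prems(1) by auto
  then show ?case using b(1) by (intro exI[of _ "b # zs"] exI[of _ w'']) simp
qed

lemma interp_compile_complete:
  assumes "length x = m" "list_all (block_ok m) Bs" "list_all2 (fits x) Bs zs"
  shows "\<exists>w0. length w0 \<le> length Bs \<and>
    (\<forall>w z. interp g x (compile_all m Bs @ cs) (w0 @ w) (int m) z = interp g x cs w (int m) (z @ zs))"
  using assms(3,2)
proof (induction rule: list_all2_induct)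
  case Nil
  then show ?case by (intro exI[of _ "[]"]) auto
next
  case (Cons B Bs b zs)
  then obtain w0 where w0: "length w0 \<le> length Bs"
    "\<And>w z. interp g x (compile_all m Bs @ cs) (w0 @ w) (int m) z = interp g x cs w (int m) (z @ zs)"
    by auto
  let ?w = "(case B of Free \<Rightarrow> [b] | _ \<Rightarrow> []) @ w0"
  have "interp g x (concat (map (compile m) (B # Bs)) @ cs) (?w @ w) (int m) z = interp g x cs w (int m) (z @ b # zs)" for w z
    using interp_compile[OF assms(1), of B g "compile_all m Bs @ cs" "?w @ w" z] Cons.hyps(1) Cons.prems w0(2)
    by (cases B) auto
  moreover have "length ?w \<le> length (B # Bs)" using w0(1) by (cases B) auto
  ultimately show ?case by blast
qed

abbreviation bit_codes :: "bool list \<Rightarrow> nat list" where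
  "bit_codes y \<equiv> map (\<lambda>b. if b then 6 else 5) y"

lemma matches_codes_string:
  assumes "cs = [] \<or> hd cs = 8"
  shows "matches_codes (bit_codes y @ cs) y' \<longleftrightarrow> y' = y"
proof (induction y arbitrary: y')
  case Nil
  then show ?case using assms by (cases cs) auto
next
  case (Cons b y)
  then show ?case by (cases y') auto
qed

text \<open>The leading 8 asks the witness whether to run this item. It also ends the comparison
  string of the item before and is the target of a skip, since no other 8 occurs.\<close>

definition item :: "nat \<Rightarrow> bool list \<times> block list \<Rightarrow> nat list" where
  "item m = (\<lambda>(y, Bs). 8 # compile_all m Bs @ 9 # bit_codes y)"

abbreviation program :: "nat \<Rightarrow> (bool list \<times> block list) list \<Rightarrow> nat list" where
  "program m its \<equiv> concat (map (item m) its)"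

lemma items_hd: "program m its = [] \<or> hd (program m its) = 8"
  by (cases its) (auto simp: item_def split: prod.splits)

lemma set_item: "set (item m it) \<subseteq> {1..9}"
  using set_compile by (fastforce simp: item_def split: prod.splits)

lemma interp_items_Cons:
  assumes "length x = m"
  shows "interp g x (program m ((y, Bs) # its)) w (int m) [] \<longleftrightarrow>
    (case w of [] \<Rightarrow> False | b # w' \<Rightarrow>
      if b then interp g x (compile_all m Bs @ 9 # bit_codes y @ program m its) w' (int m) []
      else interp g x (program m its) w' (int m) [])"
proof -
  let ?body = "compile_all m Bs @ 9 # bit_codes y"
  let ?rest = "program m its"
  have "\<forall>c\<in>set ?body. c \<noteq> 8" using set_compile by fastforce
  then have "skip_item (?body @ ?rest) = skip_item ?rest" by (subst dropWhile_append2) auto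
  also have "\<dots> = ?rest"
  proof -
    have "cs = [] \<or> hd cs = 8 \<Longrightarrow> skip_item cs = cs" for cs :: "nat list" by (cases cs) auto
    then show ?thesis using items_hd[of m its] .
  qed
  finally have d: "skip_item (?body @ ?rest) = ?rest" .
  have "program m ((y, Bs) # its) = 8 # ?body @ ?rest" by (simp add: item_def)
  then show ?thesis using d by (simp split: list.splits)
qed

lemma interp_run:
  "interp g x (9 # bit_codes y @ program m its) w p z \<longleftrightarrow> False \<in> set z \<and> g z = y"
  by (simp add: matches_codes_string[OF items_hd])

lemma interp_items_sound:
  assumes "length x = m" "\<forall>(y, Bs)\<in>set its. list_all (block_ok m) Bs"
    "interp g x (program m its) w (int m) []"
  shows "\<exists>(y, Bs)\<in>set its. \<exists>zs. list_all2 (fits x) Bs zs \<and> g zs = y"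
  using assms(2,3)
proof (induction its arbitrary: w)
  case (Cons it its)
  obtain y Bs where it: "it = (y, Bs)" by (cases it)
  obtain b w' where w: "w = b # w'"
    using Cons.prems(2) interp_items_Cons[OF assms(1), of g y Bs its w] it by (cases w) auto
  show ?case
  proof (cases b)
    case True
    have ok: "list_all (block_ok m) Bs" using Cons.prems(1) it by simp
    have "interp g x (compile_all m Bs @ 9 # bit_codes y @ program m its) w' (int m) []"
      using Cons.prems(2) interp_items_Cons[OF assms(1), of g y Bs its w] it w True by simp
    from interp_compile_sound[OF assms(1) ok this] obtain zs w'' where zs: "list_all2 (fits x) Bs zs"
      "interp g x (9 # bit_codes y @ program m its) w'' (int m) ([] @ zs)" by blast
    then show ?thesis using it unfolding interp_run by auto
  next
    case False
    then have "interp g x (program m its) w' (int m) []"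
      using Cons.prems(2) interp_items_Cons[OF assms(1), of g y Bs its w] it w by simp
    from Cons.IH[OF _ this] show ?thesis using Cons.prems(1) by auto
  qed
qed simp

text \<open>The witness spends a \<open>False\<close> on every earlier item, a \<open>True\<close>
  on the chosen one, and then supplies the free bits of its template.\<close>

lemma interp_items_complete:
  assumes "length x = m" "\<forall>(y, Bs)\<in>set its. list_all (block_ok m) Bs"
    "(y, Bs) \<in> set its" "list_all2 (fits x) Bs zs" "g zs = y" "False \<in> set zs"
  shows "\<exists>w. length w \<le> length its + length Bs \<and> interp g x (program m its) w (int m) []"
  using assms(2,3)
proof (induction its)
  case (Cons it its)
  obtain y' Bs' where it: "it = (y', Bs')" by (cases it)
  show ?case
  proof (cases "it = (y, Bs)")
    case True
    have ok: "list_all (block_ok m) Bs" using Cons.prems(1) True by simp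
    obtain w0 where w0: "length w0 \<le> length Bs"
      "\<And>w z. interp g x (compile_all m Bs @ 9 # bit_codes y @ program m its) (w0 @ w) (int m) z
        = interp g x (9 # bit_codes y @ program m its) w (int m) (z @ zs)"
      using interp_compile_complete[OF assms(1) ok assms(4)] by blast
    have "interp g x (program m (it # its)) (True # w0) (int m) []"
      unfolding True interp_items_Cons[OF assms(1)] using w0(2)[of "[]" "[]"] assms(5,6) by (simp only: interp_run list.case if_True append_Nil2 append_Nil simp_thms)
    then show ?thesis using w0(1) by (intro exI[of _ "True # w0"]) simp
  next
    case False
    then have "(y, Bs) \<in> set its" using Cons.prems by auto
    then obtain w where w: "length w \<le> length its + length Bs" "interp g x (program m its) w (int m) []"
      using Cons by auto
    have "interp g x (program m (it # its)) (False # w) (int m) []"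
      unfolding it interp_items_Cons[OF assms(1)] using w(2) by simp
    then show ?thesis using w(1) by (intro exI[of _ "False # w"]) simp
  qed
qed simp

section \<open>The lower bound\<close>

definition dec_param :: "bool list \<Rightarrow> bool list \<times> nat" where
  "dec_param z = (tl (dropWhile id z), length (takeWhile id z))"

lemma dec_enc_param [simp]: "dec_param (enc_param a) = a"
proof -
  obtain x k where a: "a = (x, k)" by (cases a)
  have "takeWhile id (replicate k True @ False # x) = replicate k True" "dropWhile id (replicate k True @ False # x) = False # x"
    by (induction k) auto
  then show ?thesis by (simp add: a dec_param_def unary_def)
qed

text \<open>Strings with a \<open>False\<close> are exactly the encodings; this is why the verifier
  looks for one before it runs the compression machine.\<close>

lemma enc_dec_param: "False \<in> set z \<Longrightarrow> enc_param (dec_param z) = z"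
  by (induction z) (auto simp: dec_param_def unary_def)

lemma enc_param_inject: "enc_param a = enc_param b \<Longrightarrow> a = b"
  by (metis dec_enc_param)

lemma list_all2_Fixed: "list_all2 (fits x) (map Fixed a) b \<longleftrightarrow> b = a"
  by (induction a arbitrary: b) (auto simp: list_all2_Cons1)

lemma length_product_lists_replicate: "length (tuple_list r n) = n ^ r"
proof -
  have "distinct (tuple_list r n)" by (rule distinct_product_lists) auto
  then have "length (tuple_list r n) = card (tuples {0..<n} r)"
    using distinct_card set_product_lists_replicate by metis
  also have "tuples {0..<n} r = {xs. set xs \<subseteq> {0..<n} \<and> length xs = r}" by (auto simp: tuples_def)
  finally show ?thesis by (simp add: card_lists_length_eq)
qed

lemma distinct_map_exists:
  assumes "distinct xs" "length ys = length xs"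
  shows "\<exists>v. ys = map v xs"
proof -
  have "ys = map (\<lambda>x. the (map_of (zip xs ys) x)) xs"
    using assms by (intro nth_equalityI) (auto simp: map_of_zip_nth)
  then show ?thesis by blast
qed

section \<open>Instance strings as templates\<close>

context
  fixes q r k p m n :: nat and E :: "nat set set" and L :: "nat \<Rightarrow> nat set" and F :: "nat list set"
    and t :: "nat list \<times> nat \<times> bool \<Rightarrow> nat list"
  assumes inj: "inj_on t (bit_indices k p m)" and disj: "t ` bit_indices k p m \<inter> F = {}"
    and inst: "RCLC_instance q r {0..<n} E L (F \<union> t ` bit_indices k p m)"
begin

definition instance_string :: "(nat list \<times> nat \<times> bool) set \<Rightarrow> bool list" where
  "instance_string G = enc_param (enc_RCLC q r n E L (F \<union> t ` G), n)"

text \<open>At index \<open>f\<close> the triple \<open>(f, j, b)\<close> is forbidden exactly if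
  \<open>b\<close> is not bit \<open>j\<close> of \<open>x\<close>. Other indices are free: they may
  even forbid both values of a bit, or neither.\<close>

definition tuple_block :: "nat list \<Rightarrow> nat list \<Rightarrow> block" where
  "tuple_block f xs = (if xs \<in> F then Fixed True else if xs \<in> t ` bit_indices k p m then
     (case inv_into (bit_indices k p m) t xs of (f', j, b) \<Rightarrow> if f' = f then XBit j b else Free)
     else Fixed False)"

definition template :: "nat list \<Rightarrow> block list" where
  "template f = map Fixed (unary n @ False # edge_bits n E @
       list_bits q n L) @
     map (tuple_block f) (tuple_list r n)"

lemma instance_string_eq:
  "instance_string G = (unary n @ False # edge_bits n E @
       list_bits q n L) @
     map (\<lambda>xs. xs \<in> F \<union> t ` G) (tuple_list r n)"
  by (simp add: instance_string_def enc_RCLC_def)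

lemma tuple_block_t:
  "u \<in> bit_indices k p m \<Longrightarrow> tuple_block f (t u) = (case u of (f', j, b) \<Rightarrow> if f' = f then XBit j b else Free)"
  using inj disj by (auto simp: tuple_block_def)

lemma length_template: "length (template f) = n + 1 + n * n + n * q + n ^ r"
  by (simp add: template_def length_product_lists_replicate unary_def)

lemma template_ok: "list_all (block_ok m) (template f)"
proof -
  have "block_ok m (tuple_block f xs)" for xs
  proof (cases "xs \<in> F \<or> xs \<notin> t ` bit_indices k p m")
    case False
    then obtain u where "u \<in> bit_indices k p m" "xs = t u" by blast
    then show ?thesis by (auto simp: tuple_block_t bit_indices_def split: prod.splits)
  qed (auto simp: tuple_block_def)
  then show ?thesis by (auto simp: template_def list_all_iff)
qed

lemma instance_fits_template:
  assumes "G \<subseteq> bit_indices k p m" "\<And>j b. j < m \<Longrightarrow> (f, j, b) \<in> G \<longleftrightarrow> x ! j \<noteq> b"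
  shows "list_all2 (fits x) (template f) (instance_string G)"
proof -
  have "fits x (tuple_block f xs) (xs \<in> F \<union> t ` G)" for xs
  proof (cases "xs \<in> t ` bit_indices k p m")
    case True
    then obtain f' j b where u: "(f', j, b) \<in> bit_indices k p m" "xs = t (f', j, b)" by auto
    have "xs \<notin> F" using disj True by blast
    moreover have "xs \<in> t ` G \<longleftrightarrow> (f', j, b) \<in> G" using u inj assms(1) by (auto simp: inj_on_def)
    ultimately show ?thesis using u assms(2)[of j b] by (auto simp: tuple_block_t bit_indices_def)
  next
    case False
    then show ?thesis using assms(1) by (auto simp: tuple_block_def)
  qed
  then have "list_all2 (fits x) (map (tuple_block f) (tuple_list r n))
      (map (\<lambda>xs. xs \<in> F \<union> t ` G) (tuple_list r n))"
    by (simp add: list_all2_map1 list_all2_map2 list_all2_same)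
  then show ?thesis unfolding template_def instance_string_eq
    by (intro list_all2_appendI) (simp_all only: list_all2_Fixed)
qed

text \<open>Whatever is guessed for the free bits describes some set \<open>G\<close> of forbidden
  triples, so a fitting string is always an instance to which \<open>OR_embedding\<close>
  applies.\<close>

lemma template_fits_instance:
  assumes f: "f \<in> selections k p" and fit: "list_all2 (fits x) (template f) zs"
  shows "\<exists>G \<subseteq> bit_indices k p m. zs = instance_string G \<and> (\<forall>j<m. \<forall>b. (f, j, b) \<in> G \<longleftrightarrow> x ! j \<noteq> b)"
proof -
  let ?pl = "tuple_list r n"
  obtain z1 z2 where z: "zs = z1 @ z2" "list_all2 (fits x) (map (tuple_block f) ?pl) z2"
    "z1 = unary n @ False # edge_bits n E @
       list_bits q n L"
    using fit unfolding template_def list_all2_append1 list_all2_Fixed by blast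
  have dist: "distinct ?pl" by (rule distinct_product_lists) auto
  have "length z2 = length ?pl" using z(2) by (auto dest: list_all2_lengthD)
  then obtain v where v: "z2 = map v ?pl" using distinct_map_exists[OF dist] by blast
  have fv: "fits x (tuple_block f xs) (v xs)" if "xs \<in> set ?pl" for xs
    using z(2) that unfolding v by (auto simp: list_all2_map1 list_all2_map2 list_all2_same)
  have tpl: "t u \<in> set ?pl" if "u \<in> bit_indices k p m" for u
    using inst that unfolding set_product_lists_replicate RCLC_instance_def by blast
  define G where "G = {u \<in> bit_indices k p m. v (t u)}"
  have "v xs \<longleftrightarrow> xs \<in> F \<union> t ` G" if xs: "xs \<in> set ?pl" for xs
  proof (cases "xs \<in> t ` bit_indices k p m")
    case True
    then obtain u where u: "u \<in> bit_indices k p m" "xs = t u" by blast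
    have "xs \<notin> F" using disj True by blast
    moreover have "xs \<in> t ` G \<longleftrightarrow> u \<in> G" using u inj by (auto simp: inj_on_def G_def)
    ultimately show ?thesis using u by (simp add: G_def)
  next
    case False
    then have "xs \<notin> t ` G" by (auto simp: G_def)
    then show ?thesis using fv[OF xs] False by (auto simp: tuple_block_def split: if_splits)
  qed
  then have "zs = instance_string G" unfolding z(1) z(3) v instance_string_eq by simp
  moreover have "(f, j, b) \<in> G \<longleftrightarrow> x ! j \<noteq> b" if "j < m" for j b
  proof -
    have u: "(f, j, b) \<in> bit_indices k p m" using f that by (simp add: bit_indices_def)
    have "v (t (f, j, b)) = (x ! j \<noteq> b)" using fv[OF tpl[OF u]] by (simp add: tuple_block_t[OF u])
    then show ?thesis using u by (simp add: G_def)
  qed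
  ultimately show ?thesis by (intro exI[of _ G]) (auto simp: G_def)
qed

end

text \<open>Bounds the witness by the program, hence by the advice and the paired input. The witness
  bound of the NP language can therefore be the identity, independently of \<open>A\<close>.\<close>

lemma length_items_ge:
  assumes "(y, Bs) \<in> set its"
  shows "length its + length Bs \<le> length (program m its)"
proof -
  have "length Bs' \<le> length (concat (map (compile m) Bs'))" for Bs'
  proof (induction Bs')
    case (Cons B Bs')
    have "1 \<le> length (compile m B)" by (cases B) auto
    then show ?case using Cons by simp
  qed simp
  then have it: "2 + length (snd it) \<le> length (item m it)" for it by (cases it) (simp add: item_def trans_le_add1)
  have len: "length its' \<le> length (concat (map (item m) its'))" for its'
  proof (induction its')
    case (Cons a its') then show ?case using it[of a] by simp
  qed simp
  show ?thesis using assms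
  proof (induction its)
    case (Cons a its)
    then show ?case using it[of a] len[of its] by (cases "a = (y, Bs)") auto
  qed simp
qed

text \<open>Completeness is the cover by pairs. For soundness, an accepting run yields an instance
  \<open>G\<close> that holds \<open>x\<close> at index \<open>f\<close> and has the same image as a
  family outside \<open>A\<close>. That family is unsolvable, so \<open>G\<close> is too, whereas
  \<open>x\<close> in \<open>A\<close> would solve it through \<open>f\<close>.\<close>

lemma witness_program:
  assumes emb: "OR_embedding q r R k A m p n E L F t" and p: "p \<ge> 1"
    and Fc: "\<And>x k. (x, k) \<in> RCLC q r R \<longleftrightarrow> Fc (x, k) \<in> Q'"
    and size: "\<And>x k. length (fst (Fc (x, k))) + snd (Fc (x, k)) \<le> h k"
    and hp: "h n + 2 \<le> p ^ k"
  defines "g \<equiv> \<lambda>z. enc_param (Fc (dec_param z))"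
  shows "\<exists>its. length its \<le> m + 1 \<and>
    (\<forall>(y, Bs)\<in>set its. length y \<le> p ^ k \<and> length Bs = n + 1 + n * n + n * q + n ^ r) \<and>
    (\<forall>x. length x = m \<longrightarrow>
       (x \<notin> A \<longrightarrow> (\<exists>w. length w \<le> length (program m its) \<and> interp g x (program m its) w (int m) [])) \<and>
       (\<forall>w. interp g x (program m its) w (int m) [] \<longrightarrow> x \<notin> A))"
proof -
  let ?J = "bit_indices k p m" and ?I = "selections k p"
  have inj: "inj_on t ?J" and disj: "t ` ?J \<inter> F = {}" using emb by (auto simp: OR_embedding_def)
  have comp: "RCLC_instance q r {0..<n} E L (F \<union> t ` G) \<and> (RCLC_solvable q R {0..<n} E L (F \<union> t ` G) \<longleftrightarrow>
       (\<exists>f\<in>?I. \<exists>x\<in>A. length x = m \<and> (\<forall>j<m. (f, j, x ! j) \<notin> G)))" if "G \<subseteq> ?J" for G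
    using emb that unfolding OR_embedding_def by blast
  have inst: "RCLC_instance q r {0..<n} E L (F \<union> t ` ?J)" using comp by blast
  let ?z = "instance_string q r n E L F t" and ?tp = "template q r k p m n E L F t"
  have gz: "g (?z G) = enc_param (Fc (enc_RCLC q r n E L (F \<union> t ` G), n))" for G
    unfolding g_def instance_string_def[OF inj disj inst] dec_enc_param ..
  \<comment> \<open>The family \<open>X\<close> as an instance: at each index the complement of
    every bit of its string is forbidden.\<close>
  define GX where "GX X = {(f, j, b) \<in> ?J. X f ! j \<noteq> b}" for X :: "nat list \<Rightarrow> bool list"
  have GX: "GX X \<subseteq> ?J" "f \<in> ?I \<Longrightarrow> j < m \<Longrightarrow> (f, j, b) \<in> GX X \<longleftrightarrow> X f ! j \<noteq> b" for X f j b
    by (auto simp: GX_def bit_indices_def)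
  define S where "S = {x. length x = m \<and> x \<notin> A}"
  \<comment> \<open>The separator adds one bit to the at most \<open>h n\<close> others; there are
    fewer than \<open>2 ^ (h n + 2)\<close> such strings.\<close>
  define Y where "Y = {y :: bool list. length y \<le> h n + 1}"
  have "{x :: bool list. length x = m} = {x. set x \<subseteq> UNIV \<and> length x = m}" by auto
  then have fin: "finite {x :: bool list. length x = m}" "card {x :: bool list. length x = m} = 2 ^ m"
    using finite_lists_length_eq[of "UNIV :: bool set" m] card_lists_length_eq[of "UNIV :: bool set" m] by auto
  have sub: "S \<subseteq> {x. length x = m}" by (auto simp: S_def)
  have "card S \<le> 2 ^ m" using card_mono[OF fin(1) sub] fin(2) by simp
  then have S: "finite S" "card S < 2 ^ (m + 1)" using finite_subset[OF sub fin(1)] by (simp_all add: le_less_trans)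
  have "Y = {y. set y \<subseteq> UNIV \<and> length y \<le> h n + 1}" by (auto simp: Y_def)
  then have Y: "finite Y" "card Y = (\<Sum>i\<le>h n + 1. 2 ^ i)"
    using finite_lists_length_le[of "UNIV :: bool set" "h n + 1"] card_lists_length_le[of "UNIV :: bool set" "h n + 1"] by auto
  have "(\<Sum>i\<le>N. 2 ^ i) < (2 :: nat) ^ Suc N" for N by (induction N) auto
  from this[of "h n + 1"] have "(\<Sum>i\<le>h n + 1. 2 ^ i) \<le> (2 :: nat) ^ (h n + 2)" by simp
  also have "\<dots> \<le> 2 ^ (p ^ k)" using hp by (intro power_increasing) auto
  finally have cY: "card Y \<le> 2 ^ card ?I" using Y(2) by (simp add: card_selections)
  have I: "finite ?I" "?I \<noteq> {}" using finite_selections card_selections[of k p] p by (auto simp: card_eq_0_iff)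
  have lenY: "length (g (?z G)) \<le> h n + 1" for G
    unfolding gz using size[of "enc_RCLC q r n E L (F \<union> t ` G)" n]
    by (cases "Fc (enc_RCLC q r n E L (F \<union> t ` G), n)") (simp add: unary_def)
  define \<Phi> where "\<Phi> X = g (?z (GX X))" for X
  have "\<Phi> ` (?I \<rightarrow>\<^sub>E S) \<subseteq> Y" using lenY by (auto simp: \<Phi>_def Y_def)
  from complementary_witness_cover[OF I Y(1) cY S this]
  obtain ys where ys: "length ys \<le> m + 1" "\<forall>(y, f)\<in>set ys. f \<in> ?I \<and> y \<in> \<Phi> ` (?I \<rightarrow>\<^sub>E S)"
    "\<forall>x\<in>S. \<exists>(y, f)\<in>set ys. \<exists>X\<in>?I \<rightarrow>\<^sub>E S. X f = x \<and> \<Phi> X = y" by blast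
  define its where "its = map (\<lambda>(y, f). (y, ?tp f)) ys"
  have ok: "\<forall>(y, Bs)\<in>set its. list_all (block_ok m) Bs"
    using template_ok[OF inj disj inst] by (auto simp: its_def)
  \<comment> \<open>A member of \<open>A\<close> that survives at index \<open>f\<close> agrees with
    \<open>X f\<close> in every bit, but \<open>X f\<close> is outside \<open>A\<close>.\<close>
  have unsat: "\<not> RCLC_solvable q R {0..<n} E L (F \<union> t ` GX X)" if "X \<in> ?I \<rightarrow>\<^sub>E S" for X
  proof
    assume "RCLC_solvable q R {0..<n} E L (F \<union> t ` GX X)"
    then obtain f x where f: "f \<in> ?I" "x \<in> A" "length x = m" "\<forall>j<m. (f, j, x ! j) \<notin> GX X"
      using comp[OF GX(1)] by blast
    have "X f \<in> S" using that f(1) by auto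
    then have "X f = x" using f GX(2)[OF f(1)] by (intro nth_equalityI) (auto simp: S_def)
    then show False using \<open>X f \<in> S\<close> f(2) by (simp add: S_def)
  qed
  have "(x \<notin> A \<longrightarrow> (\<exists>w. length w \<le> length (program m its) \<and> interp g x (program m its) w (int m) [])) \<and>
       (\<forall>w. interp g x (program m its) w (int m) [] \<longrightarrow> x \<notin> A)"
    if x: "length x = m" for x
  proof (intro conjI impI allI)
    assume "x \<notin> A"
    then have "x \<in> S" using x by (simp add: S_def)
    then obtain y f X where f: "(y, f) \<in> set ys" "X \<in> ?I \<rightarrow>\<^sub>E S" "X f = x" "\<Phi> X = y" using ys(3) by blast
    have fI: "f \<in> ?I" using ys(2) f(1) by blast
    have "list_all2 (fits x) (?tp f) (?z (GX X))"
      by (rule instance_fits_template[OF inj disj inst GX(1)]) (use GX(2)[OF fI] f(3) in simp)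
    moreover have "(y, ?tp f) \<in> set its" using f(1) by (force simp: its_def)
    moreover have "False \<in> set (?z (GX X))" by (simp add: instance_string_eq[OF inj disj inst])
    moreover have "g (?z (GX X)) = y" using f(4) by (simp add: \<Phi>_def)
    ultimately obtain w where "length w \<le> length its + length (?tp f)" "interp g x (program m its) w (int m) []"
      using interp_items_complete[OF x ok] by blast
    then show "\<exists>w. length w \<le> length (program m its) \<and> interp g x (program m its) w (int m) []"
      using length_items_ge[OF \<open>(y, ?tp f) \<in> set its\<close>, of m] by (meson order_trans)
  next
    fix w assume "interp g x (program m its) w (int m) []"
    from interp_items_sound[OF x ok this] obtain y f zs where y: "(y, f) \<in> set ys" "list_all2 (fits x) (?tp f) zs" "g zs = y"
      by (auto simp: its_def)
    have fI: "f \<in> ?I" using ys(2) y(1) by blast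
    obtain G where G: "G \<subseteq> ?J" "zs = ?z G" "\<forall>j<m. \<forall>b. (f, j, b) \<in> G \<longleftrightarrow> x ! j \<noteq> b"
      using template_fits_instance[OF inj disj inst fI y(2)] by blast
    obtain X where X: "X \<in> ?I \<rightarrow>\<^sub>E S" "y = \<Phi> X" using ys(2) y(1) by blast
    have "g (?z G) = g (?z (GX X))" using y(3) G(2) X(2) by (simp add: \<Phi>_def)
    then have "Fc (enc_RCLC q r n E L (F \<union> t ` G), n) = Fc (enc_RCLC q r n E L (F \<union> t ` GX X), n)"
      unfolding gz by (rule enc_param_inject)
    then have "(enc_RCLC q r n E L (F \<union> t ` G), n) \<in> RCLC q r R \<longleftrightarrow> (enc_RCLC q r n E L (F \<union> t ` GX X), n) \<in> RCLC q r R"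
      unfolding Fc by simp
    then have "\<not> RCLC_solvable q R {0..<n} E L (F \<union> t ` G)"
      using unsat[OF X(1)] comp[OF G(1)] comp[OF GX(1)] enc_RCLC_mem_iff by blast
    then show "x \<notin> A" using comp[OF G(1)] fI x G(3) by blast
  qed
  moreover have "\<forall>(y, Bs)\<in>set its. length y \<le> p ^ k \<and> length Bs = n + 1 + n * n + n * q + n ^ r"
  proof clarify
    fix y Bs assume "(y, Bs) \<in> set its"
    then obtain f where f: "(y, f) \<in> set ys" "Bs = ?tp f" by (auto simp: its_def)
    then obtain X where "y = \<Phi> X" using ys(2) by blast
    then have "length y \<le> p ^ k" using lenY[of "GX X"] hp by (simp add: \<Phi>_def)
    then show "length y \<le> p ^ k \<and> length Bs = n + 1 + n * n + n * q + n ^ r"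
      using f(2) length_template[OF inj disj inst] by simp
  qed
  moreover have "length its \<le> m + 1" using ys(1) by (simp add: its_def)
  ultimately show ?thesis by blast
qed

lemma length_items_le:
  assumes "length its \<le> a" "\<forall>(y, Bs)\<in>set its. length y \<le> b \<and> length Bs \<le> c"
  shows "length (program m its) \<le> a * (2 + (2 * m + 1) * c + b)"
proof -
  have c: "length (compile_all m Bs) \<le> (2 * m + 1) * length Bs" for Bs
  proof (induction Bs)
    case (Cons B Bs)
    then show ?case using length_compile[of m B] by simp
  qed simp
  have "length (program m its) \<le> length its * (2 + (2 * m + 1) * c + b)"
    using assms(2)
  proof (induction its)
    case (Cons it its)
    obtain y Bs where it: "it = (y, Bs)" by (cases it)
    then have "length y \<le> b" "length Bs \<le> c" using Cons.prems by auto
    then have "length (item m it) \<le> 2 + (2 * m + 1) * c + b"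
      using c[of Bs] mult_le_mono2[of "length Bs" c "2 * m + 1"] it by (simp add: item_def)
    then show ?case using Cons by simp
  qed simp
  also have "\<dots> \<le> a * (2 + (2 * m + 1) * c + b)" using assms(1) by (rule mult_le_mono1)
  finally show ?thesis .
qed

theorem theorem3p2:
  fixes q r k :: nat and R :: "nat list set" and \<epsilon> :: real
  assumes "q \<ge> 1" and "r \<ge> 1" and "k \<ge> 3"
    and "R \<subseteq> tuples {1..q} r"
    and "OR_definable q r R k"
    and "\<epsilon> > 0"
    and "\<not> NP \<subseteq> with_poly_advice coNP"
  shows "\<not> (\<exists>h :: nat \<Rightarrow> nat.
            (\<lambda>n. real (h n)) \<in> O(\<lambda>n. real n powr (real k - \<epsilon>)) \<and>
            admits_compression (RCLC q r R) h)"
proof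
  assume "\<exists>h :: nat \<Rightarrow> nat. (\<lambda>n. real (h n)) \<in> O(\<lambda>n. real n powr (real k - \<epsilon>)) \<and> admits_compression (RCLC q r R) h"
  then obtain h Q' Fc where h: "(\<lambda>n. real (h n)) \<in> O(\<lambda>n. real n powr (real k - \<epsilon>))"
    and c: "compression_of_size (RCLC q r R) Q' Fc h" by (auto simp: admits_compression_def)
  have Fc: "\<And>x k. (x, k) \<in> RCLC q r R \<longleftrightarrow> Fc (x, k) \<in> Q'"
    and size: "\<And>x k. length (fst (Fc (x, k))) + snd (Fc (x, k)) \<le> h k"
    using c by (auto simp: compression_of_size_def)
  obtain M pf where M: "wf_tm M" "\<And>a. tm_outputs_within M (enc_param a) (poly pf (length (enc_param a))) (enc_param (Fc a))"
    using c unfolding compression_of_size_def polytime_computable_def by blast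
  define g where "g = (\<lambda>z. enc_param (Fc (dec_param z)))"
  have "tm_outputs_within M z (poly pf (length z)) (g z)" if "False \<in> set z" for z
    using M(2)[of "dec_param z"] enc_dec_param[OF that] by (simp add: g_def)
  then have C: "{s. parse g (PA 0) [] [] s} \<in> PTIME" by (rule parse_PTIME[OF M(1)])
  \<comment> \<open>\<open>U\<close> depends on the compression only; the language \<open>A\<close>
    and the input length enter through the advice.\<close>
  define U where "U = {u. \<exists>w. length w \<le> poly [:0, 1:] (length u) \<and> str_pair u w \<in> {s. parse g (PA 0) [] [] s}}"
  have "U \<in> NP" unfolding NP_def mem_Collect_eq
    by (rule bexI[OF _ C], rule exI[of _ "[:0, 1:]"]) (simp add: U_def)
  then have coU: "- U \<in> coNP" by (simp add: coNP_def)
  have "A \<in> with_poly_advice coNP" if A: "A \<in> NP" for A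
  proof -
    obtain Q :: "nat poly" where Q: "\<And>m p. p \<ge> 1 \<Longrightarrow> \<exists>n E L F t. n \<le> poly Q m * p \<and> OR_embedding q r R k A m p n E L F t"
      by (rule OR_composition[OF A assms(5,3)]) (rule that)
    \<comment> \<open>\<open>D\<close> depends on \<open>A\<close> but not on \<open>m\<close>, so
      \<open>p = (m + 2) ^ D\<close> and with it the advice stay polynomial in
      \<open>m\<close>.\<close>
    obtain D where D: "\<And>m n. n \<le> poly Q m * (m + 2) ^ D \<Longrightarrow> h n + 2 \<le> ((m + 2) ^ D) ^ k"
      using compression_size_bound[OF h assms(6), of Q] assms(3) by auto
    define N where "N m = poly Q m * (m + 2) ^ D" for m
    define len where "len m = (m + 1) * (2 + (2 * m + 1) * (N m + 1 + N m * N m + N m * q + N m ^ r) + ((m + 2) ^ D) ^ k)" for m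
    have "\<exists>ds. set ds \<subseteq> {1..9} \<and> length ds \<le> len m \<and> (\<forall>x. length x = m \<longrightarrow>
       (x \<notin> A \<longrightarrow> (\<exists>w. length w \<le> length ds \<and> interp g x ds w (int m) [])) \<and> (\<forall>w. interp g x ds w (int m) [] \<longrightarrow> x \<notin> A))" for m
    proof -
      define p where "p = (m + 2) ^ D"
      have p: "p \<ge> 1" by (simp add: p_def)
      obtain n E L F t where n: "n \<le> poly Q m * p" and emb: "OR_embedding q r R k A m p n E L F t"
        using Q[OF p, of m] by blast
      have hp: "h n + 2 \<le> p ^ k" using D[of n m] n by (simp add: p_def)
      from witness_program[OF emb p Fc size hp, folded g_def]
      obtain its where its: "length its \<le> m + 1"
        "\<forall>(y, Bs)\<in>set its. length y \<le> p ^ k \<and> length Bs = n + 1 + n * n + n * q + n ^ r"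
        "\<forall>x. length x = m \<longrightarrow>
          (x \<notin> A \<longrightarrow> (\<exists>w. length w \<le> length (program m its) \<and> interp g x (program m its) w (int m) [])) \<and>
          (\<forall>w. interp g x (program m its) w (int m) [] \<longrightarrow> x \<notin> A)"
        by blast
      have nN: "n \<le> N m" using n by (simp add: N_def p_def)
      have "n + 1 + n * n + n * q + n ^ r \<le> N m + 1 + N m * N m + N m * q + N m ^ r"
        using nN by (intro add_mono mult_le_mono power_mono) auto
      then have "\<forall>(y, Bs)\<in>set its. length y \<le> p ^ k \<and> length Bs \<le> N m + 1 + N m * N m + N m * q + N m ^ r"
        using its(2) by auto
      from length_items_le[OF its(1) this, of m] have "length (program m its) \<le> len m"
        by (simp only: len_def p_def)
      moreover have "set (program m its) \<subseteq> {1..9}" using set_item by fastforce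
      ultimately show ?thesis using its(3) by blast
    qed
    \<comment> \<open>One program for each length, chosen without any uniformity.\<close>
    then obtain ds where ds: "\<And>m. set (ds m) \<subseteq> {1..9}" "\<And>m. length (ds m) \<le> len m"
      "\<And>x. x \<notin> A \<Longrightarrow> \<exists>w. length w \<le> length (ds (length x)) \<and> interp g x (ds (length x)) w (int (length x)) []"
      "\<And>x w. interp g x (ds (length x)) w (int (length x)) [] \<Longrightarrow> x \<notin> A"
      by metis
    define adv where "adv m = concat (map unary_code (rev (ds m)))" for m
    have len_codes: "length xs \<le> length (concat (map unary_code xs)) \<and> length (concat (map unary_code xs)) \<le> 9 * length xs"
      if "set xs \<subseteq> {1..9}" for xs
      using that by (induction xs) (auto simp: unary_code_def)
    have la: "length (ds m) \<le> length (adv m)" "length (adv m) \<le> 9 * len m" for m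
      using len_codes[of "rev (ds m)"] ds(1,2)[of m] by (auto simp: adv_def)
    have "poly_bounded (\<lambda>m. 9 * len m)"
      unfolding len_def N_def by (intro poly_bounded_intros)
    then obtain pa where pa: "\<And>m. 9 * len m \<le> poly pa m" by (auto simp: poly_bounded_def)
    have "x \<in> A \<longleftrightarrow> str_pair x (adv (length x)) \<in> - U" for x
    proof -
      let ?u = "str_pair x (adv (length x))"
      have par: "str_pair ?u w \<in> {s. parse g (PA 0) [] [] s} \<longleftrightarrow> interp g x (ds (length x)) w (int (length x)) []" for w
        using parse_program[OF ds(1)[of "length x"], of g x w] by (simp add: adv_def)
      have lu: "length (ds (length x)) \<le> length ?u" using la(1)[of "length x"] by (simp add: length_str_pair)
      have "?u \<in> U \<longleftrightarrow> x \<notin> A"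
      proof
        assume "?u \<in> U"
        then obtain w where w: "interp g x (ds (length x)) w (int (length x)) []" unfolding U_def using par by blast
        then show "x \<notin> A" by (rule ds(4))
      next
        assume "x \<notin> A"
        then obtain w where "length w \<le> length (ds (length x))" "interp g x (ds (length x)) w (int (length x)) []" using ds(3) by blast
        then show "?u \<in> U" unfolding U_def mem_Collect_eq par[unfolded mem_Collect_eq] using lu by (intro exI[of _ w]) simp
      qed
      then show ?thesis by blast
    qed
    moreover have "length (adv m) \<le> poly pa m" for m using la(2) pa order_trans by blast
    ultimately show ?thesis unfolding with_poly_advice_def mem_Collect_eq using coU by blast
  qed
  then show False using assms(7) by blast
qed

end
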